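(* Let $I=(-1,1)$, $y_d\in L_2(I)$, $\beta>0$, and assume that $f\in H^{\frac12-\epsilon}(I)$ and $\psi\in H^{\frac32-\epsilon}(I)$ for all $\epsilon>0$, and $\int_I\psi\,dx>0$. Let $V=\{v\in H^2(I): v(-1)=v(1)=0\}$, let $\bar y$ be the solution of the continuous problem and, for each mesh $\mathcal{T}_h$ in a quasi-uniform family of partitions of $I$, let $\bar y_h$ be the solution of the discrete problem (both defined in the context), and put $\bar u=-\bar y''-f$, $\bar u_h=-\bar y_h''-f$. Then for every $\epsilon>0$ there is a positive constant $C_\epsilon$, independent of the mesh size $h$, such that $$|\bar y-\bar y_h|_{H^1(I)}+\|\bar u-\bar u_h\|_{L_2(I)}\leq C_\epsilon h^{\frac12-\epsilon}.$$
   Context: $H^s(I)$ denotes the ($L_2$-based, Sobolev--Slobodeckij for non-integer $s$) Sobolev space; $|v|_{H^1(I)}=\|v'\|_{L_2(I)}$. The condition "for all $\epsilon>0$" on the data concerns small $\epsilon$ (e.g. all $\epsilon\in(0,1/2)$). Continuous problem: let $K=\{y\in V: y'\leq\psi \text{ on } I\}$. Then $\bar y\in K$ is the unique minimizer over $y\in K$ of $\frac12\big[\|y-y_d\|_{L_2(I)}^2+\beta\|y''+f\|_{L_2(I)}^2\big]$. Discrete problem: $\mathcal{T}_h$ is a partition of $I$ (into subintervals, with grid points including $-1$ and $1$) with mesh size $h$ (maximal subinterval length); the family is quasi-uniform, i.e. the ratio of $h$ to the minimal subinterval length is bounded uniformly over the family. $V_h\subset V$ is the cubic Hermite finite element space associated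 with $\mathcal{T}_h$, i.e. the space of $C^1$ functions on $[-1,1]$ that belong to $V$ and are cubic polynomials on each subinterval of $\mathcal{T}_h$. $P_h$ is the nodal interpolation operator for the continuous piecewise linear ($P_1$) finite element space associated with $\mathcal{T}_h$. Let $K_h=\{y\in V_h: P_hy'\leq P_h\psi \text{ on } [-1,1]\}$, i.e. the constraint $y'\le\psi$ is imposed only at the grid points. Then $\bar y_h\in K_h$ is the unique minimizer over $y_h\in K_h$ of $\frac12\big[\|y_h-y_d\|_{L_2(I)}^2+\beta\|y_h''+f\|_{L_2(I)}^2\big]$. The constant $C_\epsilon$ may depend on $\epsilon$, the data $y_d,\beta,f,\psi$ and the quasi-uniformity constant, but not on $h$. *)

theory Defs
  imports "HOL-Analysis.Analysis" "HOL-Computational_Algebra.Polynomial"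
begin

text \<open>
  Elements of function spaces on the interval are represented by functions on the whole real
  line; their values off the interval (off the closed interval where continuous representatives
  are used) are irrelevant.
\<close>

abbreviation I :: "real set" where
  "I \<equiv> {-1<..<1}"

definition L2 :: "(real \<Rightarrow> real) set" where
  "L2 = {v \<in> borel_measurable (lebesgue_on I). integrable (lebesgue_on I) (\<lambda>x. (v x)\<^sup>2)}"

definition L2_norm :: "(real \<Rightarrow> real) \<Rightarrow> real" where
  "L2_norm v = sqrt (integral\<^sup>L (lebesgue_on I) (\<lambda>x. (v x)\<^sup>2))"

definition test_function :: "(real \<Rightarrow> real) \<Rightarrow> bool" where
  "test_function \<phi> \<longleftrightarrow>
     (\<forall>n x. (deriv ^^ n) \<phi> differentiable (at x)) \<and>
     compact (closure {x. \<phi> x \<noteq> 0}) \<and> closure {x. \<phi> x \<noteq> 0} \<subseteq> I"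

definition locally_integrable :: "(real \<Rightarrow> real) \<Rightarrow> bool" where
  "locally_integrable v \<longleftrightarrow> (\<forall>K. compact K \<and> K \<subseteq> I \<longrightarrow> v absolutely_integrable_on K)"

definition has_weak_deriv :: "nat \<Rightarrow> (real \<Rightarrow> real) \<Rightarrow> (real \<Rightarrow> real) \<Rightarrow> bool" where
  "has_weak_deriv n v g \<longleftrightarrow>
     locally_integrable v \<and> locally_integrable g \<and>
     (\<forall>\<phi>. test_function \<phi> \<longrightarrow>
        integral\<^sup>L (lebesgue_on I) (\<lambda>x. v x * (deriv ^^ n) \<phi> x) =
        (-1) ^ n * integral\<^sup>L (lebesgue_on I) (\<lambda>x. g x * \<phi> x))"

text \<open>A weak derivative is only determined almost everywhere on the interval; it is used below
  only in ways that do not depend on the representative chosen here.\<close>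

definition weak_deriv :: "nat \<Rightarrow> (real \<Rightarrow> real) \<Rightarrow> real \<Rightarrow> real" where
  "weak_deriv n v = (SOME g. has_weak_deriv n v g)"

text \<open>Finiteness of the Slobodeckij seminorm of order \<open>\<sigma> \<in> (0,1)\<close>.\<close>

definition slobodeckij_finite :: "real \<Rightarrow> (real \<Rightarrow> real) \<Rightarrow> bool" where
  "slobodeckij_finite \<sigma> v \<longleftrightarrow>
     integrable (lebesgue_on I \<Otimes>\<^sub>M lebesgue_on I)
       (\<lambda>(x, y). (v x - v y)\<^sup>2 / \<bar>x - y\<bar> powr (1 + 2 * \<sigma>))"

text \<open>The space \<open>H\<^sup>s\<close>, meant for real \<open>s \<ge> 0\<close> only.\<close>

definition sobolev :: "real \<Rightarrow> (real \<Rightarrow> real) set" where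
  "sobolev s =
     {v \<in> L2. (\<forall>j\<le>nat \<lfloor>s\<rfloor>. \<exists>g\<in>L2. has_weak_deriv j v g) \<and>
              (s \<notin> \<int> \<longrightarrow> slobodeckij_finite (frac s) (weak_deriv (nat \<lfloor>s\<rfloor>) v))}"

definition H1_seminorm :: "(real \<Rightarrow> real) \<Rightarrow> real" where
  "H1_seminorm v = L2_norm (weak_deriv 1 v)"

text \<open>Boundary values refer to the continuous representative on the closed interval.\<close>

definition V :: "(real \<Rightarrow> real) set" where
  "V = {v \<in> sobolev 2. continuous_on {-1..1} v \<and> v (-1) = 0 \<and> v 1 = 0}"

definition cost ::
    "(real \<Rightarrow> real) \<Rightarrow> real \<Rightarrow> (real \<Rightarrow> real) \<Rightarrow> (real \<Rightarrow> real) \<Rightarrow> real" where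
  "cost y\<^sub>d \<beta> f y =
     1 / 2 * ((L2_norm (\<lambda>x. y x - y\<^sub>d x))\<^sup>2 + \<beta> * (L2_norm (\<lambda>x. weak_deriv 2 y x + f x))\<^sup>2)"

definition K :: "(real \<Rightarrow> real) \<Rightarrow> (real \<Rightarrow> real) set" where
  "K \<psi> = {y \<in> V. AE x in lebesgue_on I. weak_deriv 1 y x \<le> \<psi> x}"

definition control :: "(real \<Rightarrow> real) \<Rightarrow> (real \<Rightarrow> real) \<Rightarrow> real \<Rightarrow> real" where
  "control f y = (\<lambda>x. - weak_deriv 2 y x - f x)"

text \<open>A partition is given by its set of grid points; \<open>cells\<close> collects the pairs of end points
  of its subintervals.\<close>

definition mesh :: "real set \<Rightarrow> bool" where
  "mesh T \<longleftrightarrow> finite T \<and> T \<subseteq> {-1..1} \<and> -1 \<in> T \<and> 1 \<in> T"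

definition cells :: "real set \<Rightarrow> (real \<times> real) set" where
  "cells T = {(a, b). a \<in> T \<and> b \<in> T \<and> a < b \<and> T \<inter> {a<..<b} = {}}"

definition mesh_size :: "real set \<Rightarrow> real" where
  "mesh_size T = Max ((\<lambda>(a, b). b - a) ` cells T)"

definition min_cell_length :: "real set \<Rightarrow> real" where
  "min_cell_length T = Min ((\<lambda>(a, b). b - a) ` cells T)"

definition quasi_uniform :: "real set set \<Rightarrow> bool" where
  "quasi_uniform \<T> \<longleftrightarrow> (\<exists>\<rho>. \<forall>T\<in>\<T>. mesh_size T / min_cell_length T \<le> \<rho>)"

text \<open>Differentiation within the closed interval makes the derivative at \<open>-1\<close> and \<open>1\<close>
  one-sided.\<close>

definition C1_closed :: "(real \<Rightarrow> real) \<Rightarrow> bool" where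
  "C1_closed v \<longleftrightarrow>
     (\<exists>D. (\<forall>x\<in>{-1..1}. (v has_real_derivative D x) (at x within {-1..1})) \<and>
          continuous_on {-1..1} D)"

definition V\<^sub>h :: "real set \<Rightarrow> (real \<Rightarrow> real) set" where
  "V\<^sub>h T =
     {v \<in> V. C1_closed v \<and>
        (\<forall>(a, b)\<in>cells T. \<exists>p :: real poly. degree p \<le> 3 \<and> (\<forall>x\<in>{a..b}. v x = poly p x))}"

text \<open>The piecewise linear nodal interpolant at a point \<open>x\<close> of the closed interval. At a grid
  point \<open>a = b = x\<close>, and the formula evaluates to \<open>v x\<close> since \<open>0 / 0 = 0\<close>.\<close>

definition P\<^sub>h :: "real set \<Rightarrow> (real \<Rightarrow> real) \<Rightarrow> real \<Rightarrow> real" where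
  "P\<^sub>h T v x =
     (let a = Max {t \<in> T. t \<le> x}; b = Min {t \<in> T. x \<le> t}
      in v a + (x - a) / (b - a) * (v b - v a))"

definition K\<^sub>h :: "(real \<Rightarrow> real) \<Rightarrow> real set \<Rightarrow> (real \<Rightarrow> real) set" where
  "K\<^sub>h \<psi> T =
     {y \<in> V\<^sub>h T. \<forall>x\<in>{-1..1}.
        P\<^sub>h T (\<lambda>t. vector_derivative y (at t within {-1..1})) x \<le> P\<^sub>h T \<psi> x}"

end

theory Submission
  imports Defs
begin

text \<open>
  Write \<open>y\<close> for the solution of the continuous problem, \<open>y\<^sub>h\<close> for the discrete one,
  \<open>p = y'\<close>, \<open>g = y''\<close>, and \<open>J'\<close> for the derivative of the cost at \<open>y\<close>. The estimate is that of a
  conforming method for a variational inequality: the error is controlled by the distance of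
  \<open>y\<close> to its cubic Hermite interpolant and by the amount by which \<open>y\<^sub>h'\<close> exceeds the bound \<open>\<psi>\<close>
  between the grid points. Both are of the expected order once \<open>y''\<close> has, up to \<open>\<epsilon>\<close>, half a
  derivative. Two elementary bounds carry the argument.

  \<^bold>\<open>A bound for \<open>J'\<close>.\<close> Since the mean of \<open>\<psi>\<close> is a number \<open>m > 0\<close>, the primitive of
  \<open>\<psi> - m\<close> is an element of \<open>V\<close> whose derivative stays at distance \<open>m\<close> below the constraint. If
  \<open>\<bar>v'\<bar> \<le> m\<close>, adding \<open>v\<close> to this element keeps it admissible, and the variational inequality bounds
  \<open>J' v\<close> from below. By scaling, \<open>J' v \<le> \<mu> sup \<bar>v'\<bar>\<close> for all \<open>v \<in> V\<close> (\<open>J'_le_sup\<close>), where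
  \<open>\<mu>\<close> plays the role of the mass of the Lagrange multiplier. A convex combination
  with the same element shows that an element of \<open>V\<close> which violates the constraint by at most
  \<open>\<delta>\<close> can decrease the linearised cost by at most \<open>\<mu> \<delta>\<close> (\<open>J'_violation\<close>).

  \<^bold>\<open>A bound for the oscillation.\<close> The quantity that enters the estimates is \<open>osc T g\<close>, the
  squared distance of \<open>g\<close> to its cell averages. Applied to \<open>v\<close> with \<open>v'' = w\<close>, the bound for \<open>J'\<close> says that the
  pairing of \<open>y'' + f\<close> with \<open>w\<close> is at most a constant times the supremum of the primitive of \<open>w\<close>,
  which is a weak form of bounded variation. Testing with \<open>w = G - avg T G\<close>, where \<open>G = y'' + f\<close>,
  whose primitive vanishes at the grid points, yields \<open>osc T G = O(h)\<close>
  (\<open>osc_weak_BV\<close>). For \<open>f\<close> and \<open>\<psi>'\<close> the Slobodeckij integral bounds the oscillation by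
  \<open>O(h powr (2 \<sigma>))\<close> directly (\<open>osc_slobodeckij\<close>), with \<open>\<sigma> = 1/2 - \<epsilon>\<close>. Since \<open>y'' = G - f\<close>,
  \<open>osc T y''\<close> and \<open>osc T \<psi>'\<close> are \<open>O(h powr (2 \<sigma>))\<close>.

  \<^bold>\<open>Conclusion.\<close> The Hermite interpolant has the derivative of \<open>y\<close> at the grid points, hence is
  admissible, and both its squared error in second derivatives and the square of its supremum
  error in first derivatives divided by \<open>h\<close> are multiples of \<open>osc T y''\<close> (\<open>Hermite_interpolant\<close>).
  A function that is non-positive at the grid points is at most \<open>sqrt (h osc)\<close> in between
  (\<open>le_if_le_at_nodes\<close>), which bounds the violation of the constraint by \<open>y\<^sub>h\<close>. Inserting these
  bounds in the discrete variational inequality (\<open>discrete_error\<close>) gives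
  \<open>O(h powr (2 \<sigma>))\<close> for the squared error of the second derivatives, which dominates
  the error of the first derivatives because these have mean zero.

  All of this is carried out with classical functions: an element of \<open>V\<close> is described by a
  continuous first derivative and a square-integrable second derivative of which it is an iterated
  primitive (\<open>V_iff\<close>). That description rests on the uniqueness of weak derivatives,
  hence on a supply of test functions.
\<close>

section \<open>Smooth functions and bump functions\<close>

definition smooth :: "(real \<Rightarrow> real) \<Rightarrow> bool" where
  "smooth \<phi> \<longleftrightarrow> (\<forall>n x. (deriv ^^ n) \<phi> differentiable (at x))"

text \<open>
  Coinduction: a class of functions that is closed under differentiation contains only smooth
  functions. No formula for higher derivatives is ever written down.
\<close>

lemma smoothI:
  assumes "X \<phi>"
    and step: "\<And>f. X f \<Longrightarrow> \<exists>f'. X f' \<and> (\<forall>x. (f has_real_derivative f' x) (at x))"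
  shows "smooth \<phi>"
proof -
  have "X ((deriv ^^ n) \<phi>)" for n
  proof (induction n)
    case (Suc n)
    then obtain f' where f': "X f'" "\<forall>x. ((deriv ^^ n) \<phi> has_real_derivative f' x) (at x)"
      using step by blast
    then have "deriv ((deriv ^^ n) \<phi>) = f'" by (auto intro: DERIV_imp_deriv)
    with f' show ?case by simp
  qed (simp add: assms(1))
  then show ?thesis
    unfolding smooth_def using step by (meson real_differentiable_def)
qed

lemma smooth_deriv: "smooth \<phi> \<Longrightarrow> smooth (deriv \<phi>)"
  unfolding smooth_def by (metis funpow_simps_right(2) comp_apply)

lemma smooth_DERIV: "smooth \<phi> \<Longrightarrow> (\<phi> has_real_derivative deriv \<phi> x) (at x)"
  unfolding smooth_def
  by (metis DERIV_deriv_iff_real_differentiable funpow_0)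

lemma smooth_continuous_on: "smooth \<phi> \<Longrightarrow> continuous_on S \<phi>"
  by (meson DERIV_isCont continuous_at_imp_continuous_on smooth_DERIV)

lemma smooth_lincomb:
  assumes "smooth \<phi>" "smooth \<eta>"
  shows "smooth (\<lambda>x. a * \<phi> x + b * \<eta> x)"
proof (rule smoothI[where X = "\<lambda>f. \<exists>\<phi> \<eta>. smooth \<phi> \<and> smooth \<eta> \<and> f = (\<lambda>x. a * \<phi> x + b * \<eta> x)"])
  show "\<exists>\<phi>' \<eta>'. smooth \<phi>' \<and> smooth \<eta>' \<and> (\<lambda>x. a * \<phi> x + b * \<eta> x) = (\<lambda>x. a * \<phi>' x + b * \<eta>' x)"
    using assms by blast
next
  fix f assume "\<exists>\<phi> \<eta>. smooth \<phi> \<and> smooth \<eta> \<and> f = (\<lambda>x. a * \<phi> x + b * \<eta> x)"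
  then obtain \<phi> \<eta> where *: "smooth \<phi>" "smooth \<eta>" "f = (\<lambda>x. a * \<phi> x + b * \<eta> x)" by blast
  have "\<forall>x. (f has_real_derivative (a * deriv \<phi> x + b * deriv \<eta> x)) (at x)"
    unfolding *(3) by (intro allI DERIV_add DERIV_cmult smooth_DERIV *)
  with * show "\<exists>f'. (\<exists>\<phi> \<eta>. smooth \<phi> \<and> smooth \<eta> \<and> f' = (\<lambda>x. a * \<phi> x + b * \<eta> x)) \<and>
      (\<forall>x. (f has_real_derivative f' x) (at x))"
    by (intro exI[of _ "\<lambda>x. a * deriv \<phi> x + b * deriv \<eta> x"]) (blast intro: smooth_deriv)
qed

text \<open>
  The smallest class that contains the product of two smooth functions and, by the Leibniz rule, is
  closed under differentiation.
\<close>

inductive sum_of_products :: "(real \<Rightarrow> real) \<Rightarrow> bool" where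
  "smooth \<phi> \<Longrightarrow> smooth \<eta> \<Longrightarrow> sum_of_products (\<lambda>x. \<phi> x * \<eta> x)"
| "sum_of_products f \<Longrightarrow> sum_of_products g \<Longrightarrow> sum_of_products (\<lambda>x. f x + g x)"

lemma smooth_mult:
  assumes "smooth \<phi>" "smooth \<eta>"
  shows "smooth (\<lambda>x. \<phi> x * \<eta> x)"
proof (rule smoothI[where X = sum_of_products])
  fix f assume "sum_of_products f"
  then show "\<exists>f'. sum_of_products f' \<and> (\<forall>x. (f has_real_derivative f' x) (at x))"
  proof induction
    case (1 \<phi> \<eta>)
    show ?case
    proof (intro exI conjI allI)
      show "sum_of_products (\<lambda>x. deriv \<phi> x * \<eta> x + deriv \<eta> x * \<phi> x)"
        using 1 by (intro sum_of_products.intros smooth_deriv)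
      show "((\<lambda>x. \<phi> x * \<eta> x) has_real_derivative deriv \<phi> x * \<eta> x + deriv \<eta> x * \<phi> x) (at x)" for x
        using 1 by (intro DERIV_mult smooth_DERIV)
    qed
  next
    case (2 f g)
    then obtain f' g' where "sum_of_products f'" "\<forall>x. (f has_real_derivative f' x) (at x)"
      and "sum_of_products g'" "\<forall>x. (g has_real_derivative g' x) (at x)" by blast
    then show ?case
      by (intro exI[of _ "\<lambda>x. f' x + g' x"]) (simp add: sum_of_products.intros(2) DERIV_add)
  qed
qed (use assms in \<open>rule sum_of_products.intros\<close>)

lemma smooth_affine:
  assumes "smooth \<phi>"
  shows "smooth (\<lambda>x. \<phi> (k * x + d))"
proof (rule smoothI[where X = "\<lambda>f. \<exists>c \<phi>. smooth \<phi> \<and> f = (\<lambda>x. c * \<phi> (k * x + d))"])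
  show "\<exists>c \<phi>'. smooth \<phi>' \<and> (\<lambda>x. \<phi> (k * x + d)) = (\<lambda>x. c * \<phi>' (k * x + d))"
    using assms by (intro exI[of _ 1] exI[of _ \<phi>]) simp
next
  fix f assume "\<exists>c \<phi>. smooth \<phi> \<and> f = (\<lambda>x. c * \<phi> (k * x + d))"
  then obtain c \<phi> where *: "smooth \<phi>" "f = (\<lambda>x. c * \<phi> (k * x + d))" by blast
  have "(f has_real_derivative (c * k) * deriv \<phi> (k * x + d)) (at x)" for x
  proof -
    have "((\<lambda>x. \<phi> (k * x + d)) has_real_derivative deriv \<phi> (k * x + d) * k) (at x)"
      by (rule DERIV_chain2[OF smooth_DERIV[OF *(1)]]) (auto intro!: derivative_eq_intros)
    from DERIV_cmult[OF this, of c] show ?thesis unfolding *(2) by (simp add: ac_simps)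
  qed
  with * show "\<exists>f'. (\<exists>c \<phi>. smooth \<phi> \<and> f' = (\<lambda>x. c * \<phi> (k * x + d))) \<and>
      (\<forall>x. (f has_real_derivative f' x) (at x))"
    by (intro exI[of _ "\<lambda>x. (c * k) * deriv \<phi> (k * x + d)"]) (blast intro: smooth_deriv)
qed

text \<open>
  For \<open>p = 1\<close> this is the function \<open>exp (- 1 / x)\<close>, continued by zero. The polynomial factor makes
  the family closed under differentiation.
\<close>

definition flat :: "real poly \<Rightarrow> real \<Rightarrow> real" where
  "flat p x = (if x > 0 then poly p (1 / x) * exp (- (1 / x)) else 0)"

lemma poly_exp_tendsto_0: "((\<lambda>y. poly p y * exp (- y)) \<longlongrightarrow> (0::real)) at_top"
proof -
  have "((\<lambda>y. \<Sum>i\<le>degree p. coeff p i * (y ^ i / exp y)) \<longlongrightarrow> (\<Sum>i\<le>degree p. coeff p i * 0)) at_top"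
    by (intro tendsto_intros tendsto_power_div_exp_0)
  moreover have "(\<lambda>y. poly p y * exp (- y)) = (\<lambda>y. \<Sum>i\<le>degree p. coeff p i * (y ^ i / exp y))"
    by (simp add: poly_altdef sum_divide_distrib exp_minus divide_inverse[symmetric])
  ultimately show ?thesis by simp
qed

text \<open>
  At the origin the difference quotient is \<open>(1 / h) poly p (1 / h) exp (- 1 / h)\<close>, and the exponential
  beats every polynomial in \<open>1 / h\<close>.
\<close>

lemma flat_DERIV:
  "(flat p has_real_derivative flat ([:0, 0, 1:] * (p - pderiv p)) x) (at x)"
proof -
  consider "x > 0" | "x < 0" | "x = 0" by linarith
  then show ?thesis
  proof cases
    case 1
    have "((\<lambda>x. poly p (1 / x) * exp (- (1 / x))) has_real_derivative
        flat ([:0, 0, 1:] * (p - pderiv p)) x) (at x)"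
    proof -
      have "((\<lambda>x. poly p (1 / x)) has_real_derivative poly (pderiv p) (1 / x) * (- (1 / x\<^sup>2))) (at x)"
        using 1 by (intro DERIV_chain2[OF poly_DERIV])
          (auto intro!: derivative_eq_intros simp: power2_eq_square)
      moreover have "((\<lambda>x. exp (- (1 / x))) has_real_derivative exp (- (1 / x)) * (1 / x\<^sup>2)) (at x)"
        using 1 by (auto intro!: derivative_eq_intros simp: power2_eq_square)
      ultimately have "((\<lambda>x. poly p (1 / x) * exp (- (1 / x))) has_real_derivative
          poly (pderiv p) (1 / x) * (- (1 / x\<^sup>2)) * exp (- (1 / x))
            + exp (- (1 / x)) * (1 / x\<^sup>2) * poly p (1 / x)) (at x)"
        by (rule DERIV_mult)
      then show ?thesis
        using 1 by (simp add: flat_def power2_eq_square algebra_simps)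
    qed
    moreover have "eventually (\<lambda>y. flat p y = poly p (1 / y) * exp (- (1 / y))) (nhds x)"
      using eventually_nhds_in_open[of "{0<..}" x] 1
      by (auto elim!: eventually_mono simp: flat_def)
    ultimately show ?thesis by (subst DERIV_cong_ev[OF refl _ refl])
  next
    case 2
    have "((\<lambda>x. 0) has_real_derivative flat ([:0, 0, 1:] * (p - pderiv p)) x) (at x)"
      using 2 by (simp add: flat_def)
    moreover have "eventually (\<lambda>y. flat p y = 0) (nhds x)"
      using eventually_nhds_in_open[of "{..<0}" x] 2
      by (auto elim!: eventually_mono simp: flat_def)
    ultimately show ?thesis by (subst DERIV_cong_ev[OF refl _ refl])
  next
    case 3
    have "((\<lambda>h. flat p h / h) \<longlongrightarrow> 0) (at_right 0)"
    proof -
      have "((\<lambda>h. poly (pCons 0 p) (inverse h) * exp (- (inverse h))) \<longlongrightarrow> 0) (at_right 0)"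
        by (rule filterlim_compose[OF poly_exp_tendsto_0 filterlim_inverse_at_top_right])
      then show ?thesis
        by (rule Lim_transform_eventually)
          (auto simp: eventually_at_filter flat_def inverse_eq_divide intro!: always_eventually)
    qed
    moreover have "((\<lambda>h. flat p h / h) \<longlongrightarrow> 0) (at_left 0)"
      by (rule Lim_transform_eventually[of "\<lambda>_. 0"])
        (auto simp: eventually_at_filter flat_def)
    ultimately show ?thesis
      using 3 by (simp add: DERIV_def filterlim_split_at flat_def)
  qed
qed

lemma smooth_flat: "smooth (flat p)"
  by (rule smoothI[where X = "\<lambda>f. \<exists>p. f = flat p"]) (use flat_DERIV in blast)+

text \<open>
  The parameter \<open>k\<close> sharpens the bump: for \<open>k \<rightarrow> \<infinity>\<close> it approaches the indicator function of the interval
  and stays between 0 and 1.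
\<close>

definition bump :: "real \<Rightarrow> real \<Rightarrow> real \<Rightarrow> real \<Rightarrow> real" where
  "bump a b k x = flat 1 (k * (x - a)) * flat 1 (k * (b - x))"

lemma smooth_bump: "smooth (bump a b k)"
proof -
  have "smooth (\<lambda>x. flat 1 (k * x + (- k * a)) * flat 1 (- k * x + k * b))"
    by (intro smooth_mult smooth_affine smooth_flat)
  then show ?thesis by (simp add: bump_def[abs_def] algebra_simps)
qed

lemma bump_bounds: "0 \<le> bump a b k x" "bump a b k x \<le> 1"
  by (auto simp: bump_def flat_def intro!: mult_le_one)

lemma bump_outside: "k > 0 \<Longrightarrow> x \<notin> {a<..<b} \<Longrightarrow> bump a b k x = 0"
  by (auto simp: bump_def flat_def zero_less_mult_iff)

lemma bump_tendsto:
  "(\<lambda>n. bump a b (real (Suc n)) x) \<longlonglongrightarrow> indicator {a<..<b} x"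
proof (cases "x \<in> {a<..<b}")
  case True
  have *: "(\<lambda>n. flat 1 (real (Suc n) * c)) \<longlonglongrightarrow> 1" if "c > 0" for c
  proof -
    have "(\<lambda>n. exp (- (inverse (real (Suc n)) * (1 / c)))) \<longlonglongrightarrow> exp (- (0 * (1 / c)))"
      by (intro tendsto_intros LIMSEQ_inverse_real_of_nat)
    moreover have "flat 1 (real (Suc n) * c) = exp (- (inverse (real (Suc n)) * (1 / c)))" for n
      using that by (simp add: flat_def divide_simps)
    ultimately show ?thesis by simp
  qed
  have "(\<lambda>n. bump a b (real (Suc n)) x) \<longlonglongrightarrow> 1 * 1"
    unfolding bump_def using True by (intro tendsto_mult *) auto
  with True show ?thesis by simp
next
  case False
  then show ?thesis using bump_outside[of "real (Suc _)" x a b] by simp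
qed

lemma test_function_iff:
  "test_function \<phi> \<longleftrightarrow>
     smooth \<phi> \<and> (\<exists>c d. -1 < c \<and> c < d \<and> d < 1 \<and> (\<forall>x. x \<notin> {c..d} \<longrightarrow> \<phi> x = 0))"
proof
  assume t: "test_function \<phi>"
  let ?S = "closure {x. \<phi> x \<noteq> 0}"
  have "\<exists>c d. -1 < c \<and> c < d \<and> d < 1 \<and> ?S \<subseteq> {c..d}"
  proof (cases "?S = {}")
    case True
    then show ?thesis by (intro exI[of _ 0] exI[of _ "1/2"]) auto
  next
    case False
    have S: "compact ?S" "?S \<subseteq> I" using t unfolding test_function_def by auto
    obtain l where l: "l \<in> ?S" "\<forall>x\<in>?S. l \<le> x"
      using compact_attains_inf[OF S(1) False] by blast
    obtain u where u: "u \<in> ?S" "\<forall>x\<in>?S. x \<le> u"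
      using compact_attains_sup[OF S(1) False] by blast
    have *: "l \<in> I" "u \<in> I" using S(2) l(1) u(1) by blast+
    \<comment> \<open>Moving the upper end halfway towards 1 keeps the interval nondegenerate.\<close>
    have "?S \<subseteq> {l..(u + 1) / 2}"
    proof
      fix x assume "x \<in> ?S"
      then have "l \<le> x" "x \<le> u" using l u by blast+
      with * show "x \<in> {l..(u + 1) / 2}" by auto
    qed
    moreover have "l \<le> u" using l u by blast
    ultimately show ?thesis using * by (intro exI[of _ l] exI[of _ "(u + 1) / 2"]) auto
  qed
  then obtain c d where cd: "-1 < c" "c < d" "d < 1" "?S \<subseteq> {c..d}" by blast
  have "\<phi> x = 0" if "x \<notin> {c..d}" for x
    using cd(4) that closure_subset[of "{x. \<phi> x \<noteq> 0}"] by blast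
  with t cd show "smooth \<phi> \<and> (\<exists>c d. -1 < c \<and> c < d \<and> d < 1 \<and> (\<forall>x. x \<notin> {c..d} \<longrightarrow> \<phi> x = 0))"
    unfolding test_function_def smooth_def by blast
next
  assume "smooth \<phi> \<and> (\<exists>c d. -1 < c \<and> c < d \<and> d < 1 \<and> (\<forall>x. x \<notin> {c..d} \<longrightarrow> \<phi> x = 0))"
  then obtain c d where *: "smooth \<phi>" "-1 < c" "d < 1" "\<forall>x. x \<notin> {c..d} \<longrightarrow> \<phi> x = 0" by blast
  have sub: "closure {x. \<phi> x \<noteq> 0} \<subseteq> {c..d}"
    by (rule closure_minimal) (use * in auto)
  then have "compact (closure {x. \<phi> x \<noteq> 0})"
    by (meson bounded_closed_interval bounded_subset closed_closure compact_eq_bounded_closed)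
  with * sub show "test_function \<phi>"
    unfolding test_function_def smooth_def by force
qed

lemma test_function_bump: "-1 < a \<Longrightarrow> a < b \<Longrightarrow> b < 1 \<Longrightarrow> k > 0 \<Longrightarrow> test_function (bump a b k)"
  unfolding test_function_iff
  by (intro conjI smooth_bump exI[of _ a] exI[of _ b] allI impI bump_outside) auto

lemma test_function_deriv:
  assumes "test_function \<phi>"
  shows "test_function (deriv \<phi>)"
proof -
  obtain c d where *: "smooth \<phi>" "-1 < c" "c < d" "d < 1" "\<forall>x. x \<notin> {c..d} \<longrightarrow> \<phi> x = 0"
    using assms unfolding test_function_iff by blast
  have "deriv \<phi> x = 0" if "x \<notin> {c..d}" for x
  proof -
    have "eventually (\<lambda>y. y \<in> - {c..d}) (nhds x)"
      using that by (intro eventually_nhds_in_open) auto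
    then have "eventually (\<lambda>y. \<phi> y = 0) (nhds x)"
      by (rule eventually_mono) (use * in auto)
    then have "(\<phi> has_real_derivative 0) (at x)"
      by (subst DERIV_cong_ev[OF refl _ refl]) auto
    then show ?thesis by (rule DERIV_imp_deriv)
  qed
  with * show ?thesis unfolding test_function_iff by (meson smooth_deriv)
qed

section \<open>Integration on the interval and square-integrable functions\<close>

abbreviation L1 :: "(real \<Rightarrow> real) \<Rightarrow> bool" where
  "L1 f \<equiv> f absolutely_integrable_on {-1..1}"

text \<open>
  The end points form a null set. Integrals over the open interval can therefore be computed as gauge
  integrals over the closed one, for which the additivity over adjacent intervals and the fundamental
  theorem of calculus are at hand.
\<close>

lemma integrable_I_iff: "integrable (lebesgue_on I) f \<longleftrightarrow> L1 f"
  unfolding absolutely_integrable_on_Icc_iff_Ioo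
  by (simp add: set_integrable_def integrable_restrict_space)

lemma integral_I: "L1 f \<Longrightarrow> integral\<^sup>L (lebesgue_on I) f = integral {-1..1} f"
  by (simp add: lebesgue_integral_eq_integral integrable_I_iff integral_open_interval_real)

lemma L1_integrable: "L1 f \<Longrightarrow> -1 \<le> a \<Longrightarrow> b \<le> 1 \<Longrightarrow> f integrable_on {a..b}"
  by (rule set_lebesgue_integral_eq_integral(1), rule absolutely_integrable_on_subinterval) auto

lemma L1_integrable_J: "L1 f \<Longrightarrow> f integrable_on {-1..1}"
  by (rule L1_integrable) auto

lemma AE_I_iff: "(AE x in lebesgue_on I. P x) \<longleftrightarrow> negligible {x \<in> I. \<not> P x}"
proof -
  have "(AE x in lebesgue_on I. P x) \<longleftrightarrow> (AE x in lebesgue. x \<in> I \<longrightarrow> P x)"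
    by (subst AE_restrict_space_iff) auto
  also have "\<dots> \<longleftrightarrow> (\<exists>N. negligible N \<and> {x. \<not> (x \<in> I \<longrightarrow> P x)} \<subseteq> N)"
    by (simp add: eventually_ae_filter_negligible)
  also have "\<dots> \<longleftrightarrow> negligible {x \<in> I. \<not> P x}"
    by (auto intro: negligible_subset elim!: negligible_subset)
  finally show ?thesis .
qed

lemma integral_cong_AE_I:
  assumes "AE x in lebesgue_on I. f x = g x" "-1 \<le> a" "b \<le> 1"
  shows "integral {a..b} f = integral {a..b} g"
proof (rule integral_spike)
  show "negligible ({x \<in> I. \<not> f x = g x} \<union> {-1, 1})"
    using assms(1) unfolding AE_I_iff by simp
  show "g x = f x" if "x \<in> {a..b} - ({x \<in> I. \<not> f x = g x} \<union> {-1, 1})" for x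
    using that assms(2,3) by force
qed

lemma L1_add: "L1 f \<Longrightarrow> L1 g \<Longrightarrow> L1 (\<lambda>x. f x + g x)"
  and L1_diff: "L1 f \<Longrightarrow> L1 g \<Longrightarrow> L1 (\<lambda>x. f x - g x)"
  and L1_cmult: "L1 f \<Longrightarrow> L1 (\<lambda>x. c * f x)"
  by (simp_all add: integrable_I_iff[symmetric])

lemma L1_const: "L1 (\<lambda>x. c)"
  by (intro absolutely_integrable_continuous_real continuous_intros)

lemma integral_mono_L1:
  "L1 f \<Longrightarrow> L1 g \<Longrightarrow> -1 \<le> a \<Longrightarrow> b \<le> 1 \<Longrightarrow> (\<And>x. x \<in> {a..b} \<Longrightarrow> f x \<le> g x)
    \<Longrightarrow> integral {a..b} f \<le> integral {a..b} g"
  by (intro integral_le L1_integrable)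

lemma integral_cong_open:
  fixes f g :: "real \<Rightarrow> real"
  assumes "\<And>x. x \<in> {a<..<b} \<Longrightarrow> f x = g x"
  shows "integral {a..b} f = integral {a..b} g"
  by (rule integral_spike[of "{a, b}"]) (use assms in auto)

lemma L2_iff: "f \<in> L2 \<longleftrightarrow> f \<in> borel_measurable (lebesgue_on I) \<and> L1 (\<lambda>x. (f x)\<^sup>2)"
  by (auto simp: L2_def integrable_I_iff)

lemma L2_measurable: "f \<in> L2 \<Longrightarrow> f \<in> borel_measurable (lebesgue_on I)"
  by (simp add: L2_iff)

lemma L2_square: "f \<in> L2 \<Longrightarrow> L1 (\<lambda>x. (f x)\<^sup>2)"
  by (simp add: L2_iff)

lemma L2_boundI:
  assumes "f \<in> borel_measurable (lebesgue_on I)" "L1 g" "AE x in lebesgue_on I. (f x)\<^sup>2 \<le> g x"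
  shows "f \<in> L2"
  using assms unfolding L2_def integrable_I_iff[symmetric]
  by (auto intro!: Bochner_Integration.integrable_bound[of _ g] elim!: eventually_mono)

text \<open>
  The product is dominated by the sum of the squares.
\<close>

lemma L2_mult:
  assumes "f \<in> L2" "g \<in> L2"
  shows "L1 (\<lambda>x. f x * g x)"
  unfolding integrable_I_iff[symmetric]
proof (rule Bochner_Integration.integrable_bound)
  show "integrable (lebesgue_on I) (\<lambda>x. (f x)\<^sup>2 + (g x)\<^sup>2)"
    using assms by (simp add: L2_def)
  show "AE x in lebesgue_on I. norm (f x * g x) \<le> norm ((f x)\<^sup>2 + (g x)\<^sup>2)"
  proof (intro always_eventually allI)
    fix x
    have "2 * \<bar>f x * g x\<bar> \<le> (f x)\<^sup>2 + (g x)\<^sup>2"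
      using sum_squares_bound[of "\<bar>f x\<bar>" "\<bar>g x\<bar>"] by (simp add: abs_mult)
    then show "norm (f x * g x) \<le> norm ((f x)\<^sup>2 + (g x)\<^sup>2)" by simp
  qed
qed (use assms[THEN L2_measurable] in measurable)

lemma L2_scale: "f \<in> L2 \<Longrightarrow> (\<lambda>x. c * f x) \<in> L2"
  unfolding L2_def by (auto simp: power_mult_distrib)

lemma L2_add:
  assumes "f \<in> L2" "g \<in> L2"
  shows "(\<lambda>x. f x + g x) \<in> L2"
proof (rule L2_boundI)
  show "L1 (\<lambda>x. (f x)\<^sup>2 + (2 * (f x * g x) + (g x)\<^sup>2))"
    using assms by (intro L1_add L1_cmult L2_mult L2_square)
qed (use assms[THEN L2_measurable] in \<open>auto simp: power2_sum\<close>)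

lemma L2_diff: "f \<in> L2 \<Longrightarrow> g \<in> L2 \<Longrightarrow> (\<lambda>x. f x - g x) \<in> L2"
  using L2_add[of f "\<lambda>x. (-1) * g x"] L2_scale[of g "-1"] by simp

lemma L2_continuous:
  assumes "continuous_on {-1..1} f"
  shows "f \<in> L2"
  unfolding L2_iff
proof
  show "f \<in> borel_measurable (lebesgue_on I)"
    by (rule continuous_imp_measurable_on_sets_lebesgue)
      (auto intro: continuous_on_subset[OF assms])
  show "L1 (\<lambda>x. (f x)\<^sup>2)"
    by (intro absolutely_integrable_continuous_real continuous_intros assms)
qed

lemma L2_const: "(\<lambda>x. c) \<in> L2"
  by (intro L2_continuous continuous_intros)

lemma L2_L1: "f \<in> L2 \<Longrightarrow> L1 f"
  using L2_mult[OF _ L2_const[of 1]] by simp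

lemma L2_indicator:
  assumes "f \<in> L2"
  shows "(\<lambda>x. indicator {a<..<b} x * f x) \<in> L2"
proof (rule L2_boundI)
  show "L1 (\<lambda>x. (f x)\<^sup>2)" using assms by (rule L2_square)
  have [measurable]: "indicator {a<..<b} \<in> borel_measurable (lebesgue_on I)"
    by (intro borel_measurable_indicator') (auto simp: sets_restrict_space_iff intro!: )
  show "(\<lambda>x. indicator {a<..<b} x * f x) \<in> borel_measurable (lebesgue_on I)"
    using L2_measurable[OF assms] by measurable
qed (auto simp: indicator_def)

lemma L2_sum: "finite A \<Longrightarrow> (\<And>i. i \<in> A \<Longrightarrow> f i \<in> L2) \<Longrightarrow> (\<lambda>x. \<Sum>i\<in>A. f i x) \<in> L2"
  by (induction rule: finite_induct) (auto intro: L2_const L2_add)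

lemma L2_cong_AE:
  assumes "f \<in> L2" "AE x in lebesgue_on I. f x = g x"
  shows "g \<in> L2"
proof (rule L2_boundI)
  show "L1 (\<lambda>x. (f x)\<^sup>2)" using assms by (simp add: L2_square)
  show "g \<in> borel_measurable (lebesgue_on I)"
    using L2_measurable[OF assms(1)] assms(2)
    by (simp add: borel_measurable_restrict_space_iff AE_restrict_space_iff)
      (rule borel_measurable_AE, auto elim!: eventually_mono simp: indicator_def)
  show "AE x in lebesgue_on I. (g x)\<^sup>2 \<le> (f x)\<^sup>2" using assms(2) by eventually_elim simp
qed

lemma L2_norm_eq: "f \<in> L2 \<Longrightarrow> L2_norm f = sqrt (integral {-1..1} (\<lambda>x. (f x)\<^sup>2))"
  unfolding L2_norm_def by (subst integral_I) (auto simp: L2_square)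

lemma L2_norm_square: "f \<in> L2 \<Longrightarrow> (L2_norm f)\<^sup>2 = integral {-1..1} (\<lambda>x. (f x)\<^sup>2)"
  by (simp add: L2_norm_eq integral_nonneg L1_integrable_J[OF L2_square])

lemma L2_norm_cong_AE:
  assumes "f \<in> L2" "AE x in lebesgue_on I. f x = g x"
  shows "L2_norm g = L2_norm f"
proof -
  have "AE x in lebesgue_on I. (f x)\<^sup>2 = (g x)\<^sup>2" using assms(2) by eventually_elim simp
  from integral_cong_AE_I[OF this, of "-1" 1] show ?thesis
    by (simp add: L2_norm_eq assms L2_cong_AE[OF assms])
qed

text \<open>
  The integral of \<open>(f - t g)\<^sup>2\<close> is a quadratic polynomial in \<open>t\<close> without negative values, so its discriminant is
  not positive.
\<close>

lemma Cauchy_Schwarz_integral: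
  assumes f: "f \<in> L2" and g: "g \<in> L2" and ab: "-1 \<le> a" "b \<le> 1"
  shows "(integral {a..b} (\<lambda>x. f x * g x))\<^sup>2
      \<le> integral {a..b} (\<lambda>x. (f x)\<^sup>2) * integral {a..b} (\<lambda>x. (g x)\<^sup>2)"
proof -
  define P Q R where "P = integral {a..b} (\<lambda>x. (f x)\<^sup>2)"
    and "Q = integral {a..b} (\<lambda>x. f x * g x)" and "R = integral {a..b} (\<lambda>x. (g x)\<^sup>2)"
  have int: "(\<lambda>x. (f x)\<^sup>2) integrable_on {a..b}" "(\<lambda>x. f x * g x) integrable_on {a..b}"
      "(\<lambda>x. (g x)\<^sup>2) integrable_on {a..b}"
    using f g ab by (auto intro!: L1_integrable L2_mult L2_square)
  have quad: "P - 2 * t * Q + t\<^sup>2 * R \<ge> 0" for t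
  proof -
    have "0 \<le> integral {a..b} (\<lambda>x. ((f x)\<^sup>2 - (2 * t) * (f x * g x)) + t\<^sup>2 * (g x)\<^sup>2)"
    proof (rule integral_nonneg)
      show "(\<lambda>x. ((f x)\<^sup>2 - (2 * t) * (f x * g x)) + t\<^sup>2 * (g x)\<^sup>2) integrable_on {a..b}"
        by (intro integrable_add integrable_diff integrable_on_mult_right int)
      show "0 \<le> ((f x)\<^sup>2 - (2 * t) * (f x * g x)) + t\<^sup>2 * (g x)\<^sup>2" for x
        using zero_le_power2[of "f x - t * g x"] by (simp add: power2_diff power_mult_distrib algebra_simps)
    qed
    also have "\<dots> = P - 2 * t * Q + t\<^sup>2 * R"
      unfolding P_def Q_def R_def
      by (simp add: integral_add integral_diff integrable_diff integrable_on_mult_right int)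
    finally show ?thesis .
  qed
  have P: "P \<ge> 0" using quad[of 0] by simp
  have R: "R \<ge> 0" unfolding R_def by (intro integral_nonneg int) auto
  have "Q\<^sup>2 \<le> P * R"
  proof (cases "R = 0")
    case True
    have "Q = 0"
    proof (rule ccontr)
      assume "Q \<noteq> 0"
      \<comment> \<open>For \<open>R = 0\<close> the polynomial is affine; at this point its value is \<open>-1\<close>.\<close>
      with quad[of "(P + 1) / (2 * Q)"] True show False by simp
    qed
    with True show ?thesis by simp
  next
    case False
    with R have "R > 0" by simp
    \<comment> \<open>\<open>Q / R\<close> is the minimiser.\<close>
    with quad[of "Q / R"] show ?thesis
      by (simp add: field_simps power2_eq_square)
  qed
  then show ?thesis by (simp add: P_def Q_def R_def)
qed

lemma abs_integral_le_L2:
  assumes g: "g \<in> L2" and ab: "-1 \<le> a" "a \<le> b" "b \<le> 1"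
  shows "\<bar>integral {a..b} g\<bar> \<le> sqrt ((b - a) * integral {a..b} (\<lambda>x. (g x)\<^sup>2))"
  using Cauchy_Schwarz_integral[OF L2_const[of 1] g ab(1,3)] ab
  by (intro real_le_rsqrt) simp

definition prim :: "(real \<Rightarrow> real) \<Rightarrow> real \<Rightarrow> real" where
  "prim g x = integral {-1..x} g"

lemma prim_diff:
  assumes "L1 g" "-1 \<le> x" "x \<le> y" "y \<le> 1"
  shows "prim g y - prim g x = integral {x..y} g"
  unfolding prim_def
  using Henstock_Kurzweil_Integration.integral_combine[of "-1" x y g] assms
    L1_integrable[OF assms(1), of "-1" y] by simp

lemma prim_start [simp]: "prim g (-1) = 0"
  by (simp add: prim_def)

lemma prim_continuous: "L1 g \<Longrightarrow> continuous_on {-1..1} (prim g)"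
  unfolding prim_def[abs_def] by (intro indefinite_integral_continuous_1 L1_integrable_J)

lemma prim_add: "L1 f \<Longrightarrow> L1 g \<Longrightarrow> x \<le> 1 \<Longrightarrow> prim (\<lambda>x. f x + g x) x = prim f x + prim g x"
  and prim_sub: "L1 f \<Longrightarrow> L1 g \<Longrightarrow> x \<le> 1 \<Longrightarrow> prim (\<lambda>x. f x - g x) x = prim f x - prim g x"
  unfolding prim_def by (simp_all add: integral_add integral_diff L1_integrable)

lemma prim_cmult: "prim (\<lambda>x. c * f x) x = c * prim f x"
  unfolding prim_def by simp

lemma prim_const: "-1 \<le> x \<Longrightarrow> prim (\<lambda>_. c) x = c * (x + 1)"
  unfolding prim_def by simp

lemma prim_DERIV:
  assumes "continuous_on {-1..1} p" "x \<in> {-1..1}"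
  shows "(prim p has_real_derivative p x) (at x within {-1..1})"
  unfolding prim_def[abs_def] has_real_derivative_iff_has_vector_derivative
  using integral_has_vector_derivative[OF assms] .

section \<open>Uniqueness of weak derivatives and integration by parts\<close>

lemma L1_mult_continuous:
  assumes "L1 w" "continuous_on {-1..1} \<phi>"
  shows "L1 (\<lambda>x. w x * \<phi> x)"
proof -
  have "L1 (\<lambda>x. \<phi> x * w x)"
  proof (rule absolutely_integrable_bounded_measurable_product_real)
    show "\<phi> \<in> borel_measurable (lebesgue_on {-1..1})"
      by (rule continuous_imp_measurable_on_sets_lebesgue[OF assms(2)]) auto
    show "bounded (\<phi> ` {-1..1})"
      by (intro compact_imp_bounded compact_continuous_image assms) auto
  qed (use assms in auto)
  then show ?thesis by (simp add: mult.commute)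
qed

lemma test_continuous: "test_function \<phi> \<Longrightarrow> continuous_on S \<phi>"
  by (simp add: test_function_iff smooth_continuous_on)

lemma L1_mult_test: "L1 w \<Longrightarrow> test_function \<phi> \<Longrightarrow> L1 (\<lambda>x. w x * \<phi> x)"
  by (intro L1_mult_continuous test_continuous)

lemma integral_I_supported:
  fixes f :: "real \<Rightarrow> real"
  assumes "-1 < a" "b < 1" "f absolutely_integrable_on {a..b}" "\<And>x. x \<notin> {a..b} \<Longrightarrow> f x = 0"
  shows "integrable (lebesgue_on I) f" "integral\<^sup>L (lebesgue_on I) f = integral {a..b} f"
proof -
  have L: "L1 f"
    using assms(1-3)
    by (rule_tac absolutely_integrable_spike_set[where S = "{a..b}"])
      (auto intro!: negligible_subset[of "{}"] simp: assms(4))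
  then show "integrable (lebesgue_on I) f" by (simp add: integrable_I_iff)
  have "integral {-1..1} f = integral {a..b} f"
    by (rule integral_spike_set; rule negligible_subset[of "{}"]) (use assms in auto)
  then show "integral\<^sup>L (lebesgue_on I) f = integral {a..b} f" using integral_I[OF L] by simp
qed

lemma L1_locally_integrable:
  assumes "L1 v" shows "locally_integrable v"
  unfolding locally_integrable_def
proof (intro allI impI)
  fix K :: "real set" assume K: "compact K \<and> K \<subseteq> I"
  then have "K \<in> sets lebesgue" "K \<subseteq> {-1..1}"
    by (auto intro!: lmeasurable_compact[THEN fmeasurableD] dest: subsetD)
  with assms show "v absolutely_integrable_on K"
    by (auto intro: set_integrable_subset)
qed

lemma locally_integrable_Icc:
  assumes "locally_integrable w" "-1 < a" "b < 1"
  shows "w absolutely_integrable_on {a..b}"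
proof -
  have "{a..b} \<subseteq> I" using assms by force
  with assms(1) show ?thesis unfolding locally_integrable_def by blast
qed

lemma locally_integrable_mult_test:
  assumes "locally_integrable w" "test_function \<phi>"
  shows "integrable (lebesgue_on I) (\<lambda>x. w x * \<phi> x)"
proof -
  obtain c d where cd: "-1 < c" "c < d" "d < 1" "\<forall>x. x \<notin> {c..d} \<longrightarrow> \<phi> x = 0"
    using assms(2) unfolding test_function_iff by blast
  have w: "w absolutely_integrable_on {c..d}"
    using locally_integrable_Icc[OF assms(1)] cd by blast
  have "(\<lambda>x. \<phi> x * w x) absolutely_integrable_on {c..d}"
  proof (rule absolutely_integrable_bounded_measurable_product_real)
    show "\<phi> \<in> borel_measurable (lebesgue_on {c..d})"
      by (rule continuous_imp_measurable_on_sets_lebesgue[OF test_continuous[OF assms(2)]]) auto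
    show "bounded (\<phi> ` {c..d})"
      by (intro compact_imp_bounded compact_continuous_image test_continuous assms) auto
  qed (use w in auto)
  then show ?thesis
    using cd by (intro integral_I_supported(1)[of c d]) (auto simp: mult.commute)
qed

text \<open>
  Bump functions turn the hypothesis into the vanishing of all integrals of \<open>w\<close> over compact subintervals,
  by dominated convergence. Almost every value of \<open>w\<close> is a limit of averages over such intervals. The
  interval is exhausted by compact ones because \<open>w\<close> is only locally integrable.
\<close>

lemma fundamental_lemma:
  assumes w: "locally_integrable w"
    and 0: "\<And>\<phi>. test_function \<phi> \<Longrightarrow> integral\<^sup>L (lebesgue_on I) (\<lambda>x. w x * \<phi> x) = 0"
  shows "AE x in lebesgue_on I. w x = 0"
proof -
  have int0: "integral {a..b} w = 0" if ab: "-1 < a" "a < b" "b < 1" for a b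
  proof -
    let ?f = "\<lambda>k x. w x * bump a b (real (Suc k)) x"
    have wab: "w absolutely_integrable_on {a..b}"
      using locally_integrable_Icc[OF w] ab by blast
    have test: "test_function (bump a b (real (Suc k)))" for k
      using ab by (intro test_function_bump) auto
    have fint: "?f k absolutely_integrable_on {a..b}" for k
    proof -
      have "(\<lambda>x. bump a b (real (Suc k)) x * w x) absolutely_integrable_on {a..b}"
      proof (rule absolutely_integrable_bounded_measurable_product_real)
        show "bump a b (real (Suc k)) \<in> borel_measurable (lebesgue_on {a..b})"
          by (rule continuous_imp_measurable_on_sets_lebesgue[OF test_continuous[OF test]]) auto
        show "bounded (bump a b (real (Suc k)) ` {a..b})"
          by (intro compact_imp_bounded compact_continuous_image test_continuous test) auto
      qed (use wab in auto)
      then show ?thesis by (simp add: mult.commute)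
    qed
    have zero: "integral {a..b} (?f k) = 0" for k
    proof -
      have "integral\<^sup>L (lebesgue_on I) (?f k) = integral {a..b} (?f k)"
        using ab fint by (intro integral_I_supported(2)) (auto simp: bump_outside)
      with 0[OF test[of k]] show ?thesis by simp
    qed
    have "(\<lambda>k. integral {a..b} (?f k)) \<longlonglongrightarrow> integral {a..b} (\<lambda>x. w x * indicator {a<..<b} x)"
    proof (rule dominated_convergence(2))
      show "?f k integrable_on {a..b}" for k
        using fint by (rule set_lebesgue_integral_eq_integral(1))
      show "(\<lambda>x. \<bar>w x\<bar>) integrable_on {a..b}"
        using wab unfolding absolutely_integrable_on_def by simp
      show "norm (?f k x) \<le> \<bar>w x\<bar>" for k x
        using bump_bounds[of a b "real (Suc k)" x] by (simp add: abs_mult mult_left_le)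
      show "(\<lambda>k. ?f k x) \<longlonglongrightarrow> w x * indicator {a<..<b} x" for x
        by (intro tendsto_intros bump_tendsto)
    qed
    then have "integral {a..b} (\<lambda>x. w x * indicator {a<..<b} x) = 0"
      unfolding zero by (simp add: LIMSEQ_const_iff)
    moreover have "integral {a..b} (\<lambda>x. w x * indicator {a<..<b} x) = integral {a..b} w"
      by (rule integral_cong_open) auto
    ultimately show ?thesis by simp
  qed
  have "negligible {x \<in> {- 1 + 1 / real (Suc n)<..<1 - 1 / real (Suc n)}. w x \<noteq> 0}" for n
  proof -
    define a b where "a = -1 + 1 / real (Suc n)" and "b = 1 - 1 / real (Suc n)"
    have ab: "-1 < a" "b < 1" by (auto simp: a_def b_def)
    define u where "u = (\<lambda>x. if x \<in> {a..b} then w x else 0)"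
    have "w absolutely_integrable_on {a..b}"
      using locally_integrable_Icc[OF w] ab by blast
    then have "u absolutely_integrable_on UNIV"
      unfolding u_def absolutely_integrable_restrict_UNIV .
    then have "u integrable_on cbox s t" for s t
      using absolutely_integrable_on_subcbox set_lebesgue_integral_eq_integral(1) by blast
    then obtain N where N: "negligible N" and lim: "\<And>x e. \<lbrakk>x \<notin> N; 0 < e\<rbrakk> \<Longrightarrow>
        \<exists>d>0. \<forall>h. 0 < h \<and> h < d \<longrightarrow> norm (integral (cbox x (x + h *\<^sub>R One)) u /\<^sub>R h ^ DIM(real) - u x) < e"
      using integrable_ccontinuous_explicit[of u] by blast
    have "w x = 0" if x: "x \<in> {a<..<b}" "x \<notin> N" for x
    proof (rule ccontr)
      assume "w x \<noteq> 0"
      then obtain d where d: "d > 0"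
        "\<forall>h. 0 < h \<and> h < d \<longrightarrow> norm (integral (cbox x (x + h *\<^sub>R One)) u /\<^sub>R h ^ DIM(real) - u x) < \<bar>w x\<bar>"
        using lim[OF x(2), of "\<bar>w x\<bar>"] by auto
      define h where "h = min (d / 2) ((b - x) / 2)"
      have h: "0 < h" "h < d" "x + h < b" using d x by (auto simp: h_def min_def field_simps)
      have "integral {x..x + h} u = integral {x..x + h} w"
        by (rule integral_cong) (use h x in \<open>auto simp: u_def\<close>)
      also have "\<dots> = 0" using int0[of x "x + h"] h x ab by auto
      finally show False using d(2)[rule_format, of h] h x by (simp add: u_def)
    qed
    then have "{x \<in> {a<..<b}. w x \<noteq> 0} \<subseteq> N" by blast
    with N show ?thesis unfolding a_def b_def by (rule negligible_subset)
  qed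
  then have "negligible (\<Union>n. {x \<in> {- 1 + 1 / real (Suc n)<..<1 - 1 / real (Suc n)}. w x \<noteq> 0})"
    by blast
  moreover have "{x \<in> I. w x \<noteq> 0} \<subseteq> (\<Union>n. {x \<in> {- 1 + 1 / real (Suc n)<..<1 - 1 / real (Suc n)}. w x \<noteq> 0})"
  proof
    fix x assume x: "x \<in> {x \<in> I. w x \<noteq> 0}"
    then obtain n where "inverse (real (Suc n)) < min (x + 1) (1 - x)"
      using reals_Archimedean[of "min (x + 1) (1 - x)"] by auto
    with x show "x \<in> (\<Union>n. {x \<in> {- 1 + 1 / real (Suc n)<..<1 - 1 / real (Suc n)}. w x \<noteq> 0})"
      by (intro UN_I[of n]) (auto simp: inverse_eq_divide)
  qed
  ultimately show ?thesis unfolding AE_I_iff by (rule negligible_subset)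
qed

lemma weak_deriv_unique:
  assumes g: "has_weak_deriv n v g" and g': "has_weak_deriv n v g'"
  shows "AE x in lebesgue_on I. g x = g' x"
proof -
  have loc: "locally_integrable g" "locally_integrable g'"
    using assms unfolding has_weak_deriv_def by auto
  have "AE x in lebesgue_on I. g x - g' x = 0"
  proof (rule fundamental_lemma)
    show "locally_integrable (\<lambda>x. g x - g' x)"
      using loc unfolding locally_integrable_def by (auto intro: set_integral_diff(1))
    fix \<phi> assume t: "test_function \<phi>"
    have "(-1) ^ n * integral\<^sup>L (lebesgue_on I) (\<lambda>x. g x * \<phi> x)
        = (-1) ^ n * integral\<^sup>L (lebesgue_on I) (\<lambda>x. g' x * \<phi> x)"
      using g[unfolded has_weak_deriv_def, THEN conjunct2, THEN conjunct2, rule_format, OF t]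
        g'[unfolded has_weak_deriv_def, THEN conjunct2, THEN conjunct2, rule_format, OF t] by simp
    then have "integral\<^sup>L (lebesgue_on I) (\<lambda>x. g x * \<phi> x)
        = integral\<^sup>L (lebesgue_on I) (\<lambda>x. g' x * \<phi> x)" by simp
    then show "integral\<^sup>L (lebesgue_on I) (\<lambda>x. (g x - g' x) * \<phi> x) = 0"
      using locally_integrable_mult_test[OF loc(1) t] locally_integrable_mult_test[OF loc(2) t]
      by (simp add: left_diff_distrib)
  qed
  then show ?thesis by simp
qed

text \<open>
  Hence the choice made in the definition of \<open>weak_deriv\<close> affects values on a null set only.
\<close>

lemma weak_deriv_eq: "has_weak_deriv n v g \<Longrightarrow> AE x in lebesgue_on I. weak_deriv n v x = g x"
  unfolding weak_deriv_def by (metis weak_deriv_unique someI)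

text \<open>
  As \<open>g\<close> is merely integrable, its primitive need not be differentiable everywhere. Instead one integrates
  \<open>g t * deriv \<phi> x\<close> over the triangle \<open>t \<le> x\<close> in both orders.
\<close>

lemma integral_by_parts_test:
  assumes g: "L1 g" and \<phi>: "test_function \<phi>"
  shows "integral {-1..1} (\<lambda>x. prim g x * deriv \<phi> x) = - integral {-1..1} (\<lambda>x. g x * \<phi> x)"
proof -
  let ?M = "lebesgue_on I"
  interpret M: finite_measure ?M by (intro finite_measure_lebesgue_on) simp
  interpret P: pair_sigma_finite ?M ?M ..
  \<comment> \<open>The integrand on the square, cut off outside the triangle.\<close>
  define F where "F = (\<lambda>x t. if t \<le> x then g t * deriv \<phi> x else 0)"
  have \<phi>': "test_function (deriv \<phi>)" using \<phi> by (rule test_function_deriv)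
  have bnd: "bounded (deriv \<phi> ` {-1..1})"
    by (intro compact_imp_bounded compact_continuous_image test_continuous \<phi>') auto
  then obtain B where "\<forall>x\<in>{-1..1}. \<bar>deriv \<phi> x\<bar> \<le> B"
    unfolding bounded_iff by auto
  then have B: "\<bar>deriv \<phi> x\<bar> \<le> B" if "x \<in> {-1..1}" for x using that by blast
  have "B \<ge> 0" using B[of 0] by simp
  have gint: "integrable ?M g" using g by (simp add: integrable_I_iff)
  have [measurable]: "g \<in> borel_measurable ?M" using gint by simp
  have [measurable]: "deriv \<phi> \<in> borel_measurable ?M"
    by (rule continuous_imp_measurable_on_sets_lebesgue[OF test_continuous[OF \<phi>']]) auto
  have id [measurable]: "(\<lambda>x. x) \<in> borel_measurable ?M"
    by (rule continuous_imp_measurable_on_sets_lebesgue) (auto intro: continuous_intros)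
  have [measurable]: "case_prod F \<in> borel_measurable (?M \<Otimes>\<^sub>M ?M)"
  proof -
    have [measurable]: "(\<lambda>z. fst z) \<in> borel_measurable (?M \<Otimes>\<^sub>M ?M)"
      using measurable_compose[OF measurable_fst id] by simp
    have [measurable]: "(\<lambda>z. snd z) \<in> borel_measurable (?M \<Otimes>\<^sub>M ?M)"
      using measurable_compose[OF measurable_snd id] by simp
    have 1: "(\<lambda>z. g (snd z)) \<in> borel_measurable (?M \<Otimes>\<^sub>M ?M)"
      by (rule measurable_compose[OF measurable_snd]) simp
    have 2: "(\<lambda>z. deriv \<phi> (fst z)) \<in> borel_measurable (?M \<Otimes>\<^sub>M ?M)"
      by (rule measurable_compose[OF measurable_fst]) simp
    have "(\<lambda>z. if snd z \<le> fst z then g (snd z) * deriv \<phi> (fst z) else 0) \<in> borel_measurable (?M \<Otimes>\<^sub>M ?M)"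
      using 1 2 by measurable
    then show ?thesis by (simp add: F_def case_prod_beta')
  qed
  have Fint: "integrable ?M (F x)" if "x \<in> I" for x
  proof (rule Bochner_Integration.integrable_bound[of _ "\<lambda>t. B * g t"])
    show "AE t in ?M. norm (F x t) \<le> norm (B * g t)"
      using B[of x] that \<open>B \<ge> 0\<close> 
      by (auto simp: F_def abs_mult mult.commute[of B] intro!: always_eventually mult_left_mono)
  qed (use gint that in auto)
  have F: "integrable (?M \<Otimes>\<^sub>M ?M) (case_prod F)"
  proof (rule P.Fubini_integrable)
    show "AE x in ?M. integrable ?M (\<lambda>y. case_prod F (x, y))"
      using Fint by (auto intro!: AE_I2)
    show "integrable ?M (\<lambda>x. \<integral>y. norm (case_prod F (x, y)) \<partial>?M)"
    proof (rule M.integrable_const_bound)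
      show "AE x in ?M. norm (\<integral>y. norm (case_prod F (x, y)) \<partial>?M) \<le> (\<integral>y. B * \<bar>g y\<bar> \<partial>?M)"
      proof (rule AE_I2)
        fix x assume "x \<in> space ?M"
        then have x: "x \<in> I" by simp
        have "(\<integral>y. norm (F x y) \<partial>?M) \<le> (\<integral>y. B * \<bar>g y\<bar> \<partial>?M)"
        proof (rule integral_mono)
          show "norm (F x y) \<le> B * \<bar>g y\<bar>" for y
            using B[of x] x \<open>B \<ge> 0\<close> 
            by (auto simp: F_def abs_mult mult.commute[of B] intro!: mult_left_mono)
        qed (use Fint[OF x] gint in auto)
        then show "norm (\<integral>y. norm (case_prod F (x, y)) \<partial>?M) \<le> (\<integral>y. B * \<bar>g y\<bar> \<partial>?M)"
          by simp
      qed
    qed measurable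
  qed measurable
  have swap: "(\<integral>y. (\<integral>x. F x y \<partial>?M) \<partial>?M) = (\<integral>x. (\<integral>y. F x y \<partial>?M) \<partial>?M)"
    by (rule P.Fubini_integral[OF F])
  have inner1: "(\<integral>y. F x y \<partial>?M) = prim g x * deriv \<phi> x" if x: "x \<in> I" for x
  proof -
    have "L1 (F x)" using Fint[OF x] by (simp add: integrable_I_iff)
    then have "(\<integral>y. F x y \<partial>?M) = integral {-1..1} (\<lambda>t. if t \<le> x then g t * deriv \<phi> x else 0)"
      by (simp add: integral_I F_def)
    also have "\<dots> = integral {-1..1} (\<lambda>t. if t \<in> {-1..x} then g t * deriv \<phi> x else 0)"
      by (rule integral_cong) auto
    also have "\<dots> = integral {-1..x} (\<lambda>t. g t * deriv \<phi> x)"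
      using x unfolding Henstock_Kurzweil_Integration.integral_restrict_Int by (simp add: Int_absorb2)
    finally show ?thesis by (simp add: prim_def)
  qed
  have inner2: "(\<integral>x. F x t \<partial>?M) = - (g t * \<phi> t)" if t: "t \<in> I" for t
  proof -
    have DERIV: "(\<phi> has_real_derivative deriv \<phi> x) (at x within S)" for x S
      using \<phi> smooth_DERIV has_field_derivative_at_within unfolding test_function_iff by blast
    have "(\<phi> 1 - \<phi> t) = integral {t..1} (deriv \<phi>)"
      by (rule integral_unique[symmetric], rule fundamental_theorem_of_calculus)
        (use t DERIV in \<open>auto simp: has_real_derivative_iff_has_vector_derivative[symmetric]\<close>)
    moreover have "\<phi> 1 = 0" using \<phi> unfolding test_function_iff by force
    ultimately have ftc: "integral {t..1} (deriv \<phi>) = - \<phi> t" by simp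
    have L: "L1 (\<lambda>x. F x t)"
    proof -
      have [simp]: "{t..1} \<in> sets lebesgue" by simp
      have "deriv \<phi> absolutely_integrable_on {t..1}"
        by (intro absolutely_integrable_continuous_real test_continuous \<phi>')
      then have "(\<lambda>x. if x \<in> {t..1} then deriv \<phi> x else 0) absolutely_integrable_on UNIV"
        unfolding absolutely_integrable_restrict_UNIV .
      then have "L1 (\<lambda>x. if x \<in> {t..1} then deriv \<phi> x else 0)"
        by (rule set_integrable_subset) auto
      then have "L1 (\<lambda>x. g t * (if x \<in> {t..1} then deriv \<phi> x else 0))" by (rule L1_cmult)
      then show ?thesis
        by (rule absolutely_integrable_spike[of _ _ "{}"]) (auto simp: F_def)
    qed
    then have "(\<integral>x. F x t \<partial>?M) = integral {-1..1} (\<lambda>x. F x t)" by (rule integral_I)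
    also have "\<dots> = integral {-1..1} (\<lambda>x. if x \<in> {t..1} then g t * deriv \<phi> x else 0)"
      by (rule integral_cong) (auto simp: F_def)
    also have "\<dots> = integral {t..1} (\<lambda>x. g t * deriv \<phi> x)"
      using t unfolding Henstock_Kurzweil_Integration.integral_restrict_Int by (simp add: Int_absorb2)
    finally show ?thesis by (simp add: ftc)
  qed
  have "(\<integral>t. - (g t * \<phi> t) \<partial>?M) = (\<integral>t. (\<integral>x. F x t \<partial>?M) \<partial>?M)"
    by (rule Bochner_Integration.integral_cong) (use inner2 in auto)
  also have "\<dots> = (\<integral>x. prim g x * deriv \<phi> x \<partial>?M)"
    unfolding swap by (rule Bochner_Integration.integral_cong) (use inner1 in auto)
  finally have "- (\<integral>t. g t * \<phi> t \<partial>?M) = (\<integral>x. prim g x * deriv \<phi> x \<partial>?M)" by simp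
  moreover have "L1 (\<lambda>x. prim g x * deriv \<phi> x)"
    using absolutely_integrable_continuous_real[OF prim_continuous[OF g]] \<phi>' by (rule L1_mult_test)
  moreover have "L1 (\<lambda>x. g x * \<phi> x)" using g \<phi> by (rule L1_mult_test)
  ultimately show ?thesis by (simp add: integral_I)
qed

section \<open>Weak derivatives and primitives\<close>

text \<open>
  A test function with mean zero is the derivative of a test function. An arbitrary test function \<open>\<phi>\<close>
  acquires mean zero by subtracting a multiple of a fixed bump \<open>\<eta>\<close>, which costs the constant \<open>c\<close>.
\<close>

lemma du_Bois_Reymond:
  assumes w: "L1 w"
    and 0: "\<And>\<phi>. test_function \<phi> \<Longrightarrow> integral {-1..1} (\<lambda>x. w x * deriv \<phi> x) = 0"
  shows "\<exists>c. AE x in lebesgue_on I. w x = c"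
proof -
  define \<eta> where "\<eta> = bump (- 1 / 2) (1 / 2) 1"
  have \<eta>: "test_function \<eta>" unfolding \<eta>_def by (rule test_function_bump) auto
  have int1: "L1 \<phi>" if "test_function \<phi>" for \<phi>
    by (intro absolutely_integrable_continuous_real test_continuous that)
  define A where "A = integral {-1..1} \<eta>"
  have "A \<noteq> 0"
  proof
    assume "A = 0"
    then have "\<forall>x\<in>cbox (-1) 1. \<eta> x = 0"
      unfolding A_def using integral_eq_0_iff[of "-1" "1::real" \<eta>] test_continuous[OF \<eta>]
      by (simp add: \<eta>_def bump_bounds)
    then have "\<eta> 0 = 0" by simp
    then show False by (simp add: \<eta>_def bump_def flat_def)
  qed
  define c where "c = integral {-1..1} (\<lambda>x. w x * \<eta> x) / A"
  have "AE x in lebesgue_on I. w x - c = 0"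
  proof (rule fundamental_lemma)
    show "locally_integrable (\<lambda>x. w x - c)"
      by (intro L1_locally_integrable L1_diff w L1_const)
    fix \<phi> assume \<phi>: "test_function \<phi>"
    \<comment> \<open>This multiple of the bump makes the mean of \<open>\<theta>\<close> vanish, so that \<open>\<Phi>\<close> has compact support.\<close>
    define s where "s = integral {-1..1} \<phi> / A"
    define \<theta> where "\<theta> = (\<lambda>x. \<phi> x - s * \<eta> x)"
    obtain c1 d1 where 1: "-1 < c1" "c1 < d1" "d1 < 1" "\<forall>x. x \<notin> {c1..d1} \<longrightarrow> \<phi> x = 0"
      using \<phi> unfolding test_function_iff by blast
    obtain c2 d2 where 2: "-1 < c2" "c2 < d2" "d2 < 1" "\<forall>x. x \<notin> {c2..d2} \<longrightarrow> \<eta> x = 0"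
      using \<eta> unfolding test_function_iff by blast
    define a b where "a = min c1 c2" and "b = max d1 d2"
    have ab: "-1 < a" "a < b" "b < 1" using 1 2 by (auto simp: a_def b_def)
    have out: "\<theta> x = 0" if "x \<notin> {a..b}" for x
    proof -
      have "x \<notin> {c1..d1}" "x \<notin> {c2..d2}" using that by (auto simp: a_def b_def)
      then show ?thesis using 1 2 by (simp add: \<theta>_def)
    qed
    have smooth: "smooth \<theta>"
      using smooth_lincomb[of \<phi> \<eta> 1 "- s"] \<phi> \<eta> unfolding test_function_iff \<theta>_def by simp
    have mean0: "integral {-1..1} \<theta> = 0"
      unfolding \<theta>_def using int1[OF \<phi>] int1[OF \<eta>] \<open>A \<noteq> 0\<close>
      by (simp add: integral_diff L1_integrable_J L1_cmult s_def flip: A_def)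
    define \<Phi> where "\<Phi> = (\<lambda>x. integral {-1..x} \<theta>)"
    have DERIV: "(\<Phi> has_real_derivative \<theta> x) (at x)" for x
    proof (cases "x < a")
      case True
      have "\<Phi> y = 0" if "y < a" for y
      proof -
        have "\<Phi> y = integral {-1..y} (\<lambda>_. 0)"
          unfolding \<Phi>_def by (rule integral_cong) (use that out in auto)
        then show ?thesis by simp
      qed
      then have "eventually (\<lambda>y. \<Phi> y = 0) (nhds x)"
        using eventually_nhds_in_open[of "{..<a}" x] True by (auto elim!: eventually_mono)
      then have "(\<Phi> has_real_derivative 0) (at x)"
        by (subst DERIV_cong_ev[OF refl _ refl]) auto
      with out[of x] True show ?thesis by simp
    next
      case False
      have "(\<Phi> has_real_derivative \<theta> x) (at x within {-1..x + 1})"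
        unfolding \<Phi>_def has_real_derivative_iff_has_vector_derivative
        by (rule integral_has_vector_derivative)
          (use False ab smooth_continuous_on[OF smooth] in auto)
      moreover have "at x within {-1..x + 1} = at x"
        by (rule at_within_interior) (use False ab in auto)
      ultimately show ?thesis by simp
    qed
    have "smooth \<Phi>"
    proof (rule smoothI[where X = "\<lambda>f. smooth f \<or> f = \<Phi>"])
      fix f assume "smooth f \<or> f = \<Phi>"
      then show "\<exists>f'. (smooth f' \<or> f' = \<Phi>) \<and> (\<forall>x. (f has_real_derivative f' x) (at x))"
      proof
        assume "smooth f"
        then show ?thesis by (intro exI[of _ "deriv f"]) (simp add: smooth_deriv smooth_DERIV)
      next
        assume "f = \<Phi>"
        then show ?thesis using DERIV smooth by (intro exI[of _ \<theta>]) simp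
      qed
    qed simp
    moreover have "\<Phi> x = 0" if "x \<notin> {a..b}" for x
    proof (cases "x < a")
      case True
      have "\<Phi> x = integral {-1..x} (\<lambda>_. 0)"
        unfolding \<Phi>_def by (rule integral_cong) (use True out in auto)
      then show ?thesis by simp
    next
      case False
      with that have "x > b" by auto
      have "\<Phi> x = integral {a..b} \<theta>"
        unfolding \<Phi>_def by (rule integral_spike_set; rule negligible_subset[of "{}"])
          (use \<open>x > b\<close> ab out in auto)
      also have "\<dots> = integral {-1..1} \<theta>"
        by (rule integral_spike_set; rule negligible_subset[of "{}"])
          (use ab out in auto)
      finally show ?thesis using mean0 by simp
    qed
    ultimately have "test_function \<Phi>" unfolding test_function_iff using ab by blast
    moreover have "deriv \<Phi> = \<theta>" using DERIV by (auto intro: DERIV_imp_deriv)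
    ultimately have "integral {-1..1} (\<lambda>x. w x * \<theta> x) = 0" using 0[of \<Phi>] by simp
    moreover have "integral {-1..1} (\<lambda>x. w x * \<theta> x)
        = integral {-1..1} (\<lambda>x. w x * \<phi> x) - s * integral {-1..1} (\<lambda>x. w x * \<eta> x)"
    proof -
      have "integral {-1..1} (\<lambda>x. w x * \<theta> x)
          = integral {-1..1} (\<lambda>x. w x * \<phi> x - s * (w x * \<eta> x))"
        by (simp add: \<theta>_def algebra_simps)
      also have "\<dots> = integral {-1..1} (\<lambda>x. w x * \<phi> x) - s * integral {-1..1} (\<lambda>x. w x * \<eta> x)"
        using L1_mult_test[OF w \<phi>] L1_mult_test[OF w \<eta>]
        by (simp add: integral_diff L1_integrable_J L1_cmult)
      finally show ?thesis .
    qed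
    moreover have "integral\<^sup>L (lebesgue_on I) (\<lambda>x. (w x - c) * \<phi> x)
        = integral {-1..1} (\<lambda>x. w x * \<phi> x) - c * integral {-1..1} \<phi>"
    proof -
      have "integral\<^sup>L (lebesgue_on I) (\<lambda>x. (w x - c) * \<phi> x)
          = integral {-1..1} (\<lambda>x. (w x - c) * \<phi> x)"
        by (intro integral_I L1_mult_test L1_diff w L1_const \<phi>)
      also have "\<dots> = integral {-1..1} (\<lambda>x. w x * \<phi> x - c * \<phi> x)"
        by (simp add: algebra_simps)
      also have "\<dots> = integral {-1..1} (\<lambda>x. w x * \<phi> x) - c * integral {-1..1} \<phi>"
        using L1_mult_test[OF w \<phi>] int1[OF \<phi>]
        by (simp add: integral_diff L1_integrable_J L1_cmult)
      finally show ?thesis .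
    qed
    ultimately show "integral\<^sup>L (lebesgue_on I) (\<lambda>x. (w x - c) * \<phi> x) = 0"
      by (simp add: c_def s_def)
  qed
  then show ?thesis by (intro exI[of _ c]) simp
qed

lemma integral_I_mult_test:
  "L1 w \<Longrightarrow> test_function \<phi> \<Longrightarrow>
    integral\<^sup>L (lebesgue_on I) (\<lambda>x. w x * \<phi> x) = integral {-1..1} (\<lambda>x. w x * \<phi> x)"
  by (intro integral_I L1_mult_test)

lemma integral_deriv_test:
  assumes \<phi>: "test_function \<phi>"
  shows "integral {-1..1} (deriv \<phi>) = 0"
proof -
  have "(\<phi> has_real_derivative deriv \<phi> x) (at x within S)" for x S
    using \<phi> smooth_DERIV has_field_derivative_at_within unfolding test_function_iff by blast
  then have "integral {-1..1} (deriv \<phi>) = \<phi> 1 - \<phi> (-1)"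
    by (intro integral_unique fundamental_theorem_of_calculus)
      (auto simp: has_real_derivative_iff_has_vector_derivative[symmetric])
  moreover have "\<phi> 1 = 0" "\<phi> (-1) = 0" using \<phi> unfolding test_function_iff by force+
  ultimately show ?thesis by simp
qed

lemma continuous_L1: "continuous_on {-1..1} f \<Longrightarrow> L1 f"
  by (rule absolutely_integrable_continuous_real)

lemma integral_by_parts_primitive:
  assumes g: "L1 g" and v: "\<And>x. x \<in> {-1..1} \<Longrightarrow> v x = c + prim g x" and \<phi>: "test_function \<phi>"
  shows "integral {-1..1} (\<lambda>x. v x * deriv \<phi> x) = - integral {-1..1} (\<lambda>x. g x * \<phi> x)"
proof -
  have \<phi>': "test_function (deriv \<phi>)" using \<phi> by (rule test_function_deriv)
  have 1: "L1 (deriv \<phi>)" by (intro continuous_L1 test_continuous \<phi>')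
  have 2: "L1 (\<lambda>x. prim g x * deriv \<phi> x)"
    by (intro L1_mult_test continuous_L1 prim_continuous g \<phi>')
  have "integral {-1..1} (\<lambda>x. v x * deriv \<phi> x)
      = integral {-1..1} (\<lambda>x. c * deriv \<phi> x + prim g x * deriv \<phi> x)"
    by (rule integral_cong) (simp add: v algebra_simps)
  also have "\<dots> = c * integral {-1..1} (deriv \<phi>) + integral {-1..1} (\<lambda>x. prim g x * deriv \<phi> x)"
    using L1_cmult[OF 1] 2 by (simp add: integral_add L1_integrable_J)
  finally show ?thesis using integral_deriv_test[OF \<phi>] integral_by_parts_test[OF g \<phi>] by simp
qed

lemma primitive_continuous:
  assumes "L1 g" "\<And>x. x \<in> {-1..1} \<Longrightarrow> v x = c + prim g x"
  shows "continuous_on {-1..1} v"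
proof -
  have "continuous_on {-1..1} (\<lambda>x. c + prim g x)"
    by (intro continuous_intros prim_continuous assms)
  then show ?thesis by (rule continuous_on_eq) (simp add: assms(2))
qed

lemma primitive_has_weak_deriv:
  assumes g: "L1 g" and v: "\<And>x. x \<in> {-1..1} \<Longrightarrow> v x = c + prim g x"
  shows "has_weak_deriv 1 v g"
proof -
  have "L1 v" using primitive_continuous[OF assms] by (rule continuous_L1)
  then show ?thesis
    unfolding has_weak_deriv_def
    using integral_by_parts_primitive[OF assms] g
    by (simp add: L1_locally_integrable integral_I_mult_test test_function_deriv)
qed

lemma weak_deriv_primitive:
  assumes v: "L1 v" and g: "L1 g" and vg: "has_weak_deriv 1 v g"
  shows "\<exists>c. AE x in lebesgue_on I. v x = c + prim g x"
proof -
  have pg: "L1 (prim g)" by (intro continuous_L1 prim_continuous g)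
  have "\<exists>c. AE x in lebesgue_on I. v x - prim g x = c"
  proof (rule du_Bois_Reymond)
    fix \<phi> assume \<phi>: "test_function \<phi>"
    then have \<phi>': "test_function (deriv \<phi>)" by (rule test_function_deriv)
    have "integral\<^sup>L (lebesgue_on I) (\<lambda>x. v x * deriv \<phi> x)
        = - integral\<^sup>L (lebesgue_on I) (\<lambda>x. g x * \<phi> x)"
      using vg \<phi> unfolding has_weak_deriv_def by simp
    then have "integral {-1..1} (\<lambda>x. v x * deriv \<phi> x) = - integral {-1..1} (\<lambda>x. g x * \<phi> x)"
      by (simp only: integral_I_mult_test[OF v \<phi>'] integral_I_mult_test[OF g \<phi>])
    also have "\<dots> = integral {-1..1} (\<lambda>x. prim g x * deriv \<phi> x)"
      using integral_by_parts_test[OF g \<phi>] by simp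
    finally show "integral {-1..1} (\<lambda>x. (v x - prim g x) * deriv \<phi> x) = 0"
      unfolding left_diff_distrib
      by (subst integral_diff) (auto intro!: L1_integrable_J L1_mult_test v pg \<phi>')
  qed (intro L1_diff v pg)
  then show ?thesis by (auto simp: algebra_simps)
qed

text \<open>
  A continuous nonnegative function with integral zero vanishes; apply this to the squared difference.
\<close>

lemma continuous_AE_eq:
  fixes f g :: "real \<Rightarrow> real"
  assumes f: "continuous_on {-1..1} f" and g: "continuous_on {-1..1} g"
    and ae: "AE x in lebesgue_on I. f x = g x" and x: "x \<in> {-1..1}"
  shows "f x = g x"
proof -
  have "AE x in lebesgue_on I. (f x - g x)\<^sup>2 = 0" using ae by eventually_elim simp
  from integral_cong_AE_I[OF this, of "-1" 1] have "integral (cbox (-1) 1) (\<lambda>x. (f x - g x)\<^sup>2) = 0"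
    by simp
  then have "\<forall>x\<in>cbox (-1) 1. (f x - g x)\<^sup>2 = 0"
    using integral_eq_0_iff[of "-1" "1::real" "\<lambda>x. (f x - g x)\<^sup>2"] f g
    by (simp add: continuous_intros)
  with x show ?thesis by simp
qed

text \<open>
  The elements of \<open>V\<close> together with classical representatives \<open>p\<close>, \<open>g\<close> of their first two derivatives.
  The boundary condition at \<open>-1\<close> is implicit in taking \<open>y\<close> as a primitive anchored at \<open>-1\<close>; the last
  conjunct is the one at \<open>1\<close>.
\<close>

definition derivs :: "(real \<Rightarrow> real) \<Rightarrow> (real \<Rightarrow> real) \<Rightarrow> (real \<Rightarrow> real) \<Rightarrow> bool" where
  "derivs y p g \<longleftrightarrow> g \<in> L2 \<and> (\<forall>x\<in>{-1..1}. p x = p (-1) + prim g x) \<and>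
     (\<forall>x\<in>{-1..1}. y x = prim p x) \<and> prim p 1 = 0"

lemma derivsD:
  assumes "derivs y p g"
  shows "g \<in> L2" "x \<in> {-1..1} \<Longrightarrow> p x = p (-1) + prim g x"
    "x \<in> {-1..1} \<Longrightarrow> y x = prim p x" "prim p 1 = 0"
  using assms unfolding derivs_def by blast+

lemma derivs_L2:
  assumes "derivs y p g"
  shows "g \<in> L2" "continuous_on {-1..1} p" "p \<in> L2" "continuous_on {-1..1} y" "y \<in> L2"
proof -
  show g: "g \<in> L2" using assms by (rule derivsD)
  show p: "continuous_on {-1..1} p"
    by (rule primitive_continuous[OF L2_L1[OF g] derivsD(2)[OF assms]])
  then show "p \<in> L2" by (rule L2_continuous)
  show y: "continuous_on {-1..1} y"
    by (rule primitive_continuous[OF continuous_L1[OF p], of _ 0]) (simp add: derivsD(3)[OF assms])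
  then show "y \<in> L2" by (rule L2_continuous)
qed

lemma derivs_weak:
  assumes d: "derivs y p g"
  shows "has_weak_deriv 1 y p" "has_weak_deriv 2 y g"
proof -
  note L = derivs_L2[OF d]
  note g1 = L2_L1[OF L(1)] and p1 = L2_L1[OF L(3)] and y1 = L2_L1[OF L(5)]
  note p = derivsD(2)[OF d]
  have y: "\<And>x. x \<in> {-1..1} \<Longrightarrow> y x = 0 + prim p x" by (simp add: derivsD(3)[OF d])
  show "has_weak_deriv 1 y p"
    using p1 y by (rule primitive_has_weak_deriv)
  show "has_weak_deriv 2 y g"
    unfolding has_weak_deriv_def
  proof (intro conjI allI impI L1_locally_integrable g1 y1)
    fix \<phi> assume \<phi>: "test_function \<phi>"
    then have \<phi>': "test_function (deriv \<phi>)" "test_function (deriv (deriv \<phi>))"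
      by (simp_all add: test_function_deriv)
    have "integral {-1..1} (\<lambda>x. y x * deriv (deriv \<phi>) x) = - integral {-1..1} (\<lambda>x. p x * deriv \<phi> x)"
      by (rule integral_by_parts_primitive[OF p1 y \<phi>'(1)])
    also have "\<dots> = integral {-1..1} (\<lambda>x. g x * \<phi> x)"
      using integral_by_parts_primitive[OF g1 p \<phi>] by simp
    finally show "integral\<^sup>L (lebesgue_on I) (\<lambda>x. y x * (deriv ^^ 2) \<phi> x) =
        (- 1)\<^sup>2 * integral\<^sup>L (lebesgue_on I) (\<lambda>x. g x * \<phi> x)"
      using g1 y1 \<phi> \<phi>' by (simp add: integral_I_mult_test numeral_2_eq_2)
  qed
qed

lemma derivs_weak_deriv:
  assumes "derivs y p g"
  shows "AE x in lebesgue_on I. weak_deriv 1 y x = p x" "AE x in lebesgue_on I. weak_deriv 2 y x = g x"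
  using derivs_weak[OF assms] by (auto intro: weak_deriv_eq)

text \<open>
  Apply the defining identity of the first derivative to the test function \<open>deriv \<phi>\<close>.
\<close>

lemma has_weak_deriv_second:
  assumes "has_weak_deriv 1 v p" "has_weak_deriv 2 v g"
  shows "has_weak_deriv 1 p g"
  unfolding has_weak_deriv_def
proof (intro conjI allI impI)
  fix \<phi> assume \<phi>: "test_function \<phi>"
  have "integral\<^sup>L (lebesgue_on I) (\<lambda>x. v x * deriv (deriv \<phi>) x)
      = - integral\<^sup>L (lebesgue_on I) (\<lambda>x. p x * deriv \<phi> x)"
    using assms(1) test_function_deriv[OF \<phi>] unfolding has_weak_deriv_def by simp
  moreover have "integral\<^sup>L (lebesgue_on I) (\<lambda>x. v x * deriv (deriv \<phi>) x)
      = integral\<^sup>L (lebesgue_on I) (\<lambda>x. g x * \<phi> x)"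
    using assms(2) \<phi> unfolding has_weak_deriv_def by (simp add: numeral_2_eq_2)
  ultimately show "integral\<^sup>L (lebesgue_on I) (\<lambda>x. p x * (deriv ^^ 1) \<phi> x) =
      (- 1) ^ 1 * integral\<^sup>L (lebesgue_on I) (\<lambda>x. g x * \<phi> x)" by simp
qed (use assms in \<open>auto simp: has_weak_deriv_def\<close>)

lemma weak_deriv_continuous_primitive:
  assumes v: "continuous_on {-1..1} v" and g: "L1 g" and vg: "has_weak_deriv 1 v g" and x: "x \<in> {-1..1}"
  shows "v x = v (-1) + prim g x"
proof -
  obtain c where c: "AE x in lebesgue_on I. v x = c + prim g x"
    using weak_deriv_primitive[OF continuous_L1[OF v] g vg] by blast
  have "continuous_on {-1..1} (\<lambda>x. c + prim g x)"
    by (intro continuous_intros prim_continuous g)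
  then have *: "v x = c + prim g x" if "x \<in> {-1..1}" for x
    using continuous_AE_eq[OF v _ c that] by blast
  from *[of "-1"] have "v (-1) = c" by simp
  with *[OF x] show ?thesis by simp
qed

text \<open>
  If \<open>q\<close> and \<open>g\<close> are weak derivatives of \<open>y\<close> of orders one and two, then \<open>g\<close> is a weak derivative of \<open>q\<close>, so
  \<open>q\<close> agrees almost everywhere with a continuous primitive \<open>p\<close> of \<open>g\<close>, and \<open>y\<close>, being continuous, is
  everywhere the primitive of \<open>p\<close>.
\<close>

lemma V_iff: "y \<in> V \<longleftrightarrow> (\<exists>p g. derivs y p g)"
proof
  assume y: "y \<in> V"
  then have cont: "continuous_on {-1..1} y" and bd: "y (-1) = 0" "y 1 = 0"
    and ex: "\<forall>j\<le>2. \<exists>g\<in>L2. has_weak_deriv j y g"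
    by (auto simp: V_def sobolev_def)
  obtain q where q: "q \<in> L2" "has_weak_deriv 1 y q" using ex[rule_format, of 1] by auto
  obtain g where g: "g \<in> L2" "has_weak_deriv 2 y g" using ex[rule_format, of 2] by auto
  have "has_weak_deriv 1 q g" using q(2) g(2) by (rule has_weak_deriv_second)
  then obtain c where c: "AE x in lebesgue_on I. q x = c + prim g x"
    using weak_deriv_primitive[OF L2_L1[OF q(1)] L2_L1[OF g(1)]] by blast
  define p where "p = (\<lambda>x. c + prim g x)"
  \<comment> \<open>Among the representatives of the first derivative, \<open>p\<close> is the continuous one.\<close>
  have pq: "AE x in lebesgue_on I. p x = q x" using c by eventually_elim (simp add: p_def)
  have prim_p: "prim p x = prim q x" if "x \<in> {-1..1}" for x
    unfolding prim_def using that integral_cong_AE_I[OF pq, of "-1" x] by simp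
  have y': "y x = prim q x" if "x \<in> {-1..1}" for x
    using weak_deriv_continuous_primitive[OF cont L2_L1[OF q(1)] q(2) that] bd by simp
  have "derivs y p g"
    unfolding derivs_def using g bd prim_p y' y'[of 1] by (auto simp: p_def)
  then show "\<exists>p g. derivs y p g" by blast
next
  assume "\<exists>p g. derivs y p g"
  then obtain p g where d: "derivs y p g" by blast
  note L = derivs_L2[OF d]
  have "has_weak_deriv 0 y y"
    using L1_locally_integrable[OF L2_L1[OF L(5)]] by (simp add: has_weak_deriv_def)
  then have "\<exists>g\<in>L2. has_weak_deriv j y g" if "j \<le> 2" for j
  proof -
    have "j = 0 \<or> j = 1 \<or> j = 2" using that by auto
    with \<open>has_weak_deriv 0 y y\<close> show ?thesis using L derivs_weak[OF d] by blast
  qed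
  moreover have "y (-1) = 0" "y 1 = 0" using derivsD(3,4)[OF d] by auto
  ultimately show "y \<in> V" using L by (simp add: V_def sobolev_def)
qed

section \<open>Meshes and the oscillation on cells\<close>

lemma cells_finite: "mesh T \<Longrightarrow> finite (cells T)"
  by (rule finite_subset[of _ "T \<times> T"]) (auto simp: cells_def mesh_def)

lemma cellsD:
  assumes "mesh T" "(a, b) \<in> cells T"
  shows "a \<in> T" "b \<in> T" "-1 \<le> a" "a < b" "b \<le> 1" "b - a \<le> mesh_size T"
proof -
  show "a \<in> T" "b \<in> T" "-1 \<le> a" "a < b" "b \<le> 1"
    using assms by (auto simp: cells_def mesh_def)
  show "b - a \<le> mesh_size T"
    unfolding mesh_size_def using assms cells_finite[OF assms(1)]
    by (intro Max_ge) (auto intro: rev_image_eqI)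
qed

lemma cells_pred:
  assumes T: "mesh T" and t: "t \<in> T" "t \<noteq> -1"
  obtains a where "(a, t) \<in> cells T"
proof -
  let ?S = "{s \<in> T. s < t}"
  have "finite ?S" "?S \<noteq> {}" using T t by (auto simp: mesh_def subset_iff less_le)
  then have m: "Max ?S \<in> ?S" "\<And>s. s \<in> ?S \<Longrightarrow> s \<le> Max ?S" using Max_in by auto
  have "T \<inter> {Max ?S<..<t} = {}"
  proof (rule ccontr)
    assume "T \<inter> {Max ?S<..<t} \<noteq> {}"
    then obtain s where "s \<in> T" "Max ?S < s" "s < t" by auto
    with m(2)[of s] show False by simp
  qed
  with m(1) t show ?thesis by (intro that[of "Max ?S"]) (auto simp: cells_def)
qed

text \<open>
  Induction along the grid from left to right. It turns statements about integrals over cells into statements about integrals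
  from \<open>-1\<close> to a grid point.
\<close>

lemma mesh_induct [consumes 2, case_names start cell]:
  assumes T: "mesh T" and t: "t \<in> T" and start: "P (-1)"
    and cell: "\<And>a b. (a, b) \<in> cells T \<Longrightarrow> P a \<Longrightarrow> P b"
  shows "P t"
proof -
  have "finite T" using T by (simp add: mesh_def)
  show ?thesis using t
  proof (induction "card {s \<in> T. s < t}" arbitrary: t rule: less_induct)
    case less
    show ?case
    proof (cases "t = -1")
      case False
      then obtain a where a: "(a, t) \<in> cells T" using cells_pred[OF T less.prems] by blast
      have "{s \<in> T. s < a} \<subset> {s \<in> T. s < t}" using cellsD[OF T a] by force
      then have "card {s \<in> T. s < a} < card {s \<in> T. s < t}"
        using \<open>finite T\<close> by (intro psubset_card_mono) auto
      then have "P a" using less.hyps cellsD(1)[OF T a] by blast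
      with a show ?thesis by (rule cell)
    qed (use start in simp)
  qed
qed

lemma cells_cover:
  assumes T: "mesh T" and x: "x \<in> {-1..1}"
  obtains a b where "(a, b) \<in> cells T" "x \<in> {a..b}"
proof -
  have fin: "finite T" using T by (simp add: mesh_def)
  have "\<exists>t\<in>T. x \<le> t \<and> t \<noteq> -1" using T x by (intro bexI[of _ 1]) (auto simp: mesh_def)
  then have ne: "{t \<in> T. x \<le> t \<and> t \<noteq> -1} \<noteq> {}" by blast
  define b where "b = Min {t \<in> T. x \<le> t \<and> t \<noteq> -1}"
  have b: "b \<in> T" "x \<le> b" "b \<noteq> -1"
    using Min_in[OF _ ne] fin unfolding b_def by auto
  have bmin: "b \<le> t" if "t \<in> T" "x \<le> t" "t \<noteq> -1" for t
    unfolding b_def using fin that by (intro Min_le) auto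
  obtain a where a: "(a, b) \<in> cells T" using cells_pred[OF T b(1,3)] by blast
  have "a \<le> x"
  proof (rule ccontr)
    assume "\<not> a \<le> x"
    then have "b \<le> a" using bmin[of a] cellsD[OF T a] x by force
    with cellsD(4)[OF T a] show False by simp
  qed
  with a b show ?thesis by (intro that[of a b]) auto
qed

lemma mesh_size_bounds:
  assumes T: "mesh T"
  shows "0 < mesh_size T" "mesh_size T \<le> 2"
proof -
  have "(0 :: real) \<in> {-1..1}" by simp
  then obtain a b where ab: "(a, b) \<in> cells T" using cells_cover[OF T] by blast
  show "0 < mesh_size T" using cellsD[OF T ab] by simp
  have "cells T \<noteq> {}" using ab by auto
  then show "mesh_size T \<le> 2"
    unfolding mesh_size_def using cells_finite[OF T] cellsD(3,5)[OF T]
    by (subst Max_le_iff) force+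
qed

lemma cells_disjoint:
  assumes "(a, b) \<in> cells T" "(a', b') \<in> cells T" "x \<in> {a<..<b}" "x \<in> {a'<..<b'}"
  shows "a' = a \<and> b' = b"
proof -
  have "a \<notin> {a'<..<b'}" "b \<notin> {a'<..<b'}" "a' \<notin> {a<..<b}" "b' \<notin> {a<..<b}"
    using assms(1,2) unfolding cells_def by blast+
  with assms(3,4) show ?thesis by auto
qed

text \<open>
  The weight \<open>\<kappa>\<close> is the same for all \<open>v\<close>; at a grid point it is \<open>0 / 0 = 0\<close>.
\<close>

lemma P\<^sub>h_convex_combination:
  assumes T: "mesh T" and x: "x \<in> {-1..1}"
  obtains a b \<kappa> where "a \<in> T" "b \<in> T" "0 \<le> \<kappa>" "\<kappa> \<le> 1"
    "\<And>v. P\<^sub>h T v x = (1 - \<kappa>) * v a + \<kappa> * v b"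
proof -
  define a b where "a = Max {t \<in> T. t \<le> x}" and "b = Min {t \<in> T. x \<le> t}"
  have "finite T" "-1 \<in> T" "1 \<in> T" using T by (auto simp: mesh_def)
  have "a \<in> {t \<in> T. t \<le> x}"
    unfolding a_def by (rule Max_in) (use x \<open>finite T\<close> \<open>-1 \<in> T\<close> in auto)
  moreover have "b \<in> {t \<in> T. x \<le> t}"
    unfolding b_def by (rule Min_in) (use x \<open>finite T\<close> \<open>1 \<in> T\<close> in auto)
  ultimately have ab: "a \<in> T" "b \<in> T" "a \<le> x" "x \<le> b" by auto
  have "P\<^sub>h T v x = (1 - (x - a) / (b - a)) * v a + (x - a) / (b - a) * v b" for v
    unfolding P\<^sub>h_def Let_def a_def[symmetric] b_def[symmetric] by (simp only: algebra_simps)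
  moreover have "0 \<le> (x - a) / (b - a)" "(x - a) / (b - a) \<le> 1"
    using ab by (auto simp: divide_le_eq_1)
  ultimately show ?thesis using that ab by blast
qed

lemma P\<^sub>h_node:
  assumes "mesh T" "t \<in> T"
  shows "P\<^sub>h T v t = v t"
proof -
  have "finite T" using assms by (simp add: mesh_def)
  then have "Max {s \<in> T. s \<le> t} = t" "Min {s \<in> T. t \<le> s} = t"
    using assms by (auto intro: Max_eqI Min_eqI)
  then show ?thesis by (simp add: P\<^sub>h_def)
qed

text \<open>
  An inequality between interpolants is an inequality at the grid points, as an interpolated value is a
  convex combination of nodal values.
\<close>

lemma P\<^sub>h_le_iff:
  assumes T: "mesh T"
  shows "(\<forall>x\<in>{-1..1}. P\<^sub>h T v x \<le> P\<^sub>h T w x) \<longleftrightarrow> (\<forall>t\<in>T. v t \<le> w t)"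
proof
  assume *: "\<forall>x\<in>{-1..1}. P\<^sub>h T v x \<le> P\<^sub>h T w x"
  show "\<forall>t\<in>T. v t \<le> w t"
  proof
    fix t assume t: "t \<in> T"
    then have "t \<in> {-1..1}" using T by (auto simp: mesh_def)
    with * have "P\<^sub>h T v t \<le> P\<^sub>h T w t" by blast
    then show "v t \<le> w t" by (simp add: P\<^sub>h_node[OF T t])
  qed
next
  assume *: "\<forall>t\<in>T. v t \<le> w t"
  show "\<forall>x\<in>{-1..1}. P\<^sub>h T v x \<le> P\<^sub>h T w x"
  proof
    fix x :: real assume "x \<in> {-1..1}"
    then obtain a b \<kappa> where "a \<in> T" "b \<in> T" "0 \<le> \<kappa>" "\<kappa> \<le> 1"
      "\<And>v. P\<^sub>h T v x = (1 - \<kappa>) * v a + \<kappa> * v b"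
      using P\<^sub>h_convex_combination[OF T] by blast
    with * show "P\<^sub>h T v x \<le> P\<^sub>h T w x" by (simp add: add_mono mult_left_mono)
  qed
qed

lemma integral_sub_const:
  fixes f :: "real \<Rightarrow> real"
  assumes "f integrable_on {a..b}" "a \<le> b"
  shows "integral {a..b} (\<lambda>t. f t - m) = integral {a..b} f - m * (b - a)"
    and "integral {a..b} (\<lambda>t. m - f t) = m * (b - a) - integral {a..b} f"
  using integral_diff[OF assms(1) integrable_const_ivl, of m]
    integral_diff[OF integrable_const_ivl assms(1), of m] assms(2)
  by (simp_all add: mult.commute)

text \<open>
  A function given cell by cell. The arbitrary value 0 at the grid points does not affect integrals.
\<close>

definition glue :: "real set \<Rightarrow> (real \<times> real \<Rightarrow> real \<Rightarrow> real) \<Rightarrow> real \<Rightarrow> real" where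
  "glue T F x = (\<Sum>c\<in>cells T. indicator {fst c<..<snd c} x * F c x)"

lemma glue_eq:
  assumes T: "mesh T" and ab: "(a, b) \<in> cells T" and x: "x \<in> {a<..<b}"
  shows "glue T F x = F (a, b) x"
proof -
  have "glue T F x = (\<Sum>c\<in>{(a, b)}. indicator {fst c<..<snd c} x * F c x)"
    unfolding glue_def
  proof (rule sum.mono_neutral_right[OF cells_finite[OF T]])
    show "\<forall>c\<in>cells T - {(a, b)}. indicator {fst c<..<snd c} x * F c x = 0"
    proof
      fix c assume "c \<in> cells T - {(a, b)}"
      then have "x \<notin> {fst c<..<snd c}"
        using cells_disjoint[OF ab _ x, of "fst c" "snd c"] by auto
      then show "indicator {fst c<..<snd c} x * F c x = 0" by simp
    qed
  qed (use ab in auto)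
  with x show ?thesis by simp
qed

lemma glue_L2: "mesh T \<Longrightarrow> (\<And>c. F c \<in> L2) \<Longrightarrow> glue T F \<in> L2"
  unfolding glue_def[abs_def] by (intro L2_sum L2_indicator cells_finite)

lemma mesh_prim_eq:
  assumes T: "mesh T" and F: "L1 F" and H: "L1 H" and t: "t \<in> T"
    and cell: "\<And>a b. (a, b) \<in> cells T \<Longrightarrow> integral {a..b} F = integral {a..b} H"
  shows "prim F t = prim H t"
  using T t
proof (induction t rule: mesh_induct)
  case (cell a b)
  note c = cellsD[OF T cell(1)]
  show ?case
    using cell(2) assms(5)[OF cell(1)] prim_diff[OF F, of a b] prim_diff[OF H, of a b] c by simp
qed simp

lemma mesh_integral_le:
  assumes T: "mesh T" and F: "L1 F" and H: "L1 H"
    and cell: "\<And>a b. (a, b) \<in> cells T \<Longrightarrow> integral {a..b} F \<le> integral {a..b} H"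
  shows "integral {-1..1} F \<le> integral {-1..1} H"
proof -
  have "prim F t \<le> prim H t" if "t \<in> T" for t
    using T that
  proof (induction t rule: mesh_induct)
    case (cell a b)
    note c = cellsD[OF T cell(1)]
    show ?case
      using cell(2) assms(4)[OF cell(1)] prim_diff[OF F, of a b] prim_diff[OF H, of a b] c by simp
  qed simp
  from this[of 1] T show ?thesis by (simp add: mesh_def prim_def)
qed

definition mean :: "(real \<Rightarrow> real) \<Rightarrow> real \<Rightarrow> real \<Rightarrow> real" where
  "mean g a b = integral {a..b} g / (b - a)"

definition avg :: "real set \<Rightarrow> (real \<Rightarrow> real) \<Rightarrow> real \<Rightarrow> real" where
  "avg T g = glue T (\<lambda>c x. mean g (fst c) (snd c))"

text \<open>
  The squared distance in the mean of \<open>g\<close> from the functions that are constant on the cells.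
\<close>

definition osc :: "real set \<Rightarrow> (real \<Rightarrow> real) \<Rightarrow> real" where
  "osc T g = integral {-1..1} (\<lambda>x. (g x - avg T g x)\<^sup>2)"

lemma avg_eq: "mesh T \<Longrightarrow> (a, b) \<in> cells T \<Longrightarrow> x \<in> {a<..<b} \<Longrightarrow> avg T g x = mean g a b"
  unfolding avg_def by (simp add: glue_eq)

lemma avg_L2: "mesh T \<Longrightarrow> avg T g \<in> L2"
  unfolding avg_def by (intro glue_L2 L2_const)

lemma osc_L1: "mesh T \<Longrightarrow> g \<in> L2 \<Longrightarrow> L1 (\<lambda>x. (g x - avg T g x)\<^sup>2)"
  by (intro L2_square L2_diff avg_L2)

lemma osc_nonneg: "mesh T \<Longrightarrow> g \<in> L2 \<Longrightarrow> 0 \<le> osc T g"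
  unfolding osc_def by (intro integral_nonneg L1_integrable_J osc_L1) auto

lemma integral_mean:
  assumes "mesh T" "(a, b) \<in> cells T"
  shows "integral {a..b} g = mean g a b * (b - a)"
  using cellsD(4)[OF assms] by (simp add: mean_def)

lemma integral_cell_le_osc:
  assumes T: "mesh T" and g: "g \<in> L2" and ab: "(a, b) \<in> cells T" and s: "a \<le> s" "t \<le> b"
  shows "integral {s..t} (\<lambda>x. (g x - mean g a b)\<^sup>2) \<le> osc T g"
proof -
  note c = cellsD[OF T ab]
  have L: "L1 (\<lambda>x. (g x - mean g a b)\<^sup>2)" by (intro L2_square L2_diff g L2_const)
  have "integral {s..t} (\<lambda>x. (g x - mean g a b)\<^sup>2) \<le> integral {a..b} (\<lambda>x. (g x - mean g a b)\<^sup>2)"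
    by (rule integral_subset_le) (use L c s in \<open>auto intro!: L1_integrable\<close>)
  also have "\<dots> = integral {a..b} (\<lambda>x. (g x - avg T g x)\<^sup>2)"
    by (rule integral_cong_open) (simp add: avg_eq[OF T ab])
  also have "\<dots> \<le> osc T g"
    unfolding osc_def
    by (rule integral_subset_le) (use osc_L1[OF T g] c in \<open>auto intro!: L1_integrable\<close>)
  finally show ?thesis .
qed

lemma osc_add:
  assumes T: "mesh T" and u: "u \<in> L2" and v: "v \<in> L2"
  shows "osc T (\<lambda>x. u x + v x) \<le> 2 * osc T u + 2 * osc T v"
proof -
  have avg: "avg T (\<lambda>x. u x + v x) x = avg T u x + avg T v x" for x
  proof -
    have "mean (\<lambda>x. u x + v x) a b = mean u a b + mean v a b" if "(a, b) \<in> cells T" for a b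
      using cellsD[OF T that] L1_integrable[OF L2_L1[OF u], of a b] L1_integrable[OF L2_L1[OF v], of a b]
      by (simp add: mean_def integral_add add_divide_distrib)
    then show ?thesis
      unfolding avg_def glue_def sum.distrib[symmetric]
      by (intro sum.cong) (auto simp: algebra_simps)
  qed
  have "osc T (\<lambda>x. u x + v x)
      \<le> integral {-1..1} (\<lambda>x. 2 * (u x - avg T u x)\<^sup>2 + 2 * (v x - avg T v x)\<^sup>2)"
    unfolding osc_def
  proof (rule integral_mono_L1)
    show "(u x + v x - avg T (\<lambda>x. u x + v x) x)\<^sup>2
        \<le> 2 * (u x - avg T u x)\<^sup>2 + 2 * (v x - avg T v x)\<^sup>2" for x
      using sum_squares_bound[of "u x - avg T u x" "v x - avg T v x"]
      unfolding avg by (simp add: power2_eq_square algebra_simps)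
  qed (auto intro!: osc_L1 L2_add T u v L1_add L1_cmult)
  also have "\<dots> = 2 * osc T u + 2 * osc T v"
    using L1_integrable_J[OF L1_cmult[OF osc_L1[OF T u], of 2]]
      L1_integrable_J[OF L1_cmult[OF osc_L1[OF T v], of 2]]
    unfolding osc_def by (simp add: integral_add)
  finally show ?thesis .
qed

lemma osc_scale: "mesh T \<Longrightarrow> osc T (\<lambda>x. k * u x) = k\<^sup>2 * osc T u"
proof -
  have "avg T (\<lambda>x. k * u x) x = k * avg T u x" for x
    by (simp add: avg_def glue_def mean_def sum_distrib_left algebra_simps)
  then have "(k * u x - avg T (\<lambda>x. k * u x) x)\<^sup>2 = k\<^sup>2 * (u x - avg T u x)\<^sup>2" for x
    by (simp add: power_mult_distrib right_diff_distrib[symmetric])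
  then show ?thesis by (simp add: osc_def)
qed

lemma osc_le_norm:
  assumes T: "mesh T" and u: "u \<in> L2"
  shows "osc T u \<le> integral {-1..1} (\<lambda>x. (u x)\<^sup>2)"
  unfolding osc_def
proof (rule mesh_integral_le[OF T osc_L1[OF T u] L2_square[OF u]])
  fix a b assume ab: "(a, b) \<in> cells T"
  note c = cellsD[OF T ab]
  have i: "u integrable_on {a..b}" "(\<lambda>x. (u x)\<^sup>2) integrable_on {a..b}"
    using c by (auto intro!: L1_integrable L2_square[OF u] L2_L1[OF u])
  have "integral {a..b} (\<lambda>x. (u x - avg T u x)\<^sup>2) = integral {a..b} (\<lambda>x. (u x - mean u a b)\<^sup>2)"
    by (rule integral_cong_open) (simp add: avg_eq[OF T ab])
  also have "\<dots> = integral {a..b} (\<lambda>x. (u x)\<^sup>2 - (2 * mean u a b) * u x + (mean u a b)\<^sup>2)"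
    by (simp add: power2_diff algebra_simps)
  also have "\<dots> = integral {a..b} (\<lambda>x. (u x)\<^sup>2) - (2 * mean u a b) * integral {a..b} u
      + (mean u a b)\<^sup>2 * (b - a)"
    using c integral_add[OF integrable_diff[OF i(2) integrable_on_mult_right[OF i(1)]] integrable_const_ivl]
      integral_diff[OF i(2) integrable_on_mult_right[OF i(1)]] by simp
  also have "\<dots> = integral {a..b} (\<lambda>x. (u x)\<^sup>2) - (mean u a b)\<^sup>2 * (b - a)"
    by (simp add: integral_mean[OF T ab, of u] power2_eq_square algebra_simps)
  also have "\<dots> \<le> integral {a..b} (\<lambda>x. (u x)\<^sup>2)" using c by simp
  finally show "integral {a..b} (\<lambda>x. (u x - avg T u x)\<^sup>2) \<le> integral {a..b} (\<lambda>x. (u x)\<^sup>2)" .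
qed

lemma osc_cong_AE:
  assumes T: "mesh T" and ae: "AE x in lebesgue_on I. u x = v x"
  shows "osc T u = osc T v"
proof -
  have "mean u a b = mean v a b" if "(a, b) \<in> cells T" for a b
    unfolding mean_def using integral_cong_AE_I[OF ae] cellsD[OF T that] by simp
  then have "avg T u = avg T v"
    by (auto simp: avg_def glue_def intro!: ext sum.cong)
  then have "AE x in lebesgue_on I. (u x - avg T u x)\<^sup>2 = (v x - avg T v x)\<^sup>2"
    using ae by (auto elim: eventually_mono)
  then show ?thesis unfolding osc_def by (rule integral_cong_AE_I) auto
qed

text \<open>
  The error of linear interpolation of \<open>prim g\<close> vanishes at \<open>a\<close>, and its derivative is \<open>g\<close> minus the
  mean of \<open>g\<close>.
\<close>

lemma interpolation_error_cell:
  assumes g: "g \<in> L2" and c: "-1 \<le> a" "a < b" "b \<le> 1" and x: "x \<in> {a..b}"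
  shows "\<bar>prim g x - prim g a - mean g a b * (x - a)\<bar>
      \<le> sqrt ((b - a) * integral {a..b} (\<lambda>t. (g t - mean g a b)\<^sup>2))"
proof -
  have gint: "g integrable_on {a..x}" using c x by (auto intro!: L1_integrable L2_L1 g)
  have "prim g x - prim g a - mean g a b * (x - a) = integral {a..x} (\<lambda>t. g t - mean g a b)"
    using prim_diff[OF L2_L1[OF g], of a x] c x gint by (simp add: integral_sub_const)
  also have "\<bar>\<dots>\<bar> \<le> sqrt ((x - a) * integral {a..x} (\<lambda>t. (g t - mean g a b)\<^sup>2))"
    using c x by (intro abs_integral_le_L2 L2_diff g L2_const) auto
  also have "\<dots> \<le> sqrt ((b - a) * integral {a..b} (\<lambda>t. (g t - mean g a b)\<^sup>2))"
  proof (rule real_sqrt_le_mono, rule mult_mono)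
    have L: "L1 (\<lambda>t. (g t - mean g a b)\<^sup>2)" by (intro L2_square L2_diff g L2_const)
    show "integral {a..x} (\<lambda>t. (g t - mean g a b)\<^sup>2) \<le> integral {a..b} (\<lambda>t. (g t - mean g a b)\<^sup>2)"
      by (rule integral_subset_le) (use L c x in \<open>auto intro!: L1_integrable\<close>)
    show "0 \<le> integral {a..x} (\<lambda>t. (g t - mean g a b)\<^sup>2)"
      using c x by (intro integral_nonneg L1_integrable L) auto
  qed (use c x in auto)
  finally show ?thesis .
qed

lemma interpolation_error_osc:
  assumes T: "mesh T" and g: "g \<in> L2" and ab: "(a, b) \<in> cells T" and x: "x \<in> {a..b}"
  shows "\<bar>prim g x - prim g a - mean g a b * (x - a)\<bar> \<le> sqrt (mesh_size T * osc T g)"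
proof -
  note c = cellsD[OF T ab]
  have "\<bar>prim g x - prim g a - mean g a b * (x - a)\<bar>
      \<le> sqrt ((b - a) * integral {a..b} (\<lambda>t. (g t - mean g a b)\<^sup>2))"
    using c x by (intro interpolation_error_cell g) auto
  also have "\<dots> \<le> sqrt (mesh_size T * osc T g)"
    using c integral_cell_le_osc[OF T g ab, of a b] osc_nonneg[OF T g]
    by (intro real_sqrt_le_mono mult_mono integral_nonneg L1_integrable L2_square L2_diff g L2_const) auto
  finally show ?thesis .
qed

text \<open>
  On each cell the linear interpolant of \<open>v\<close> is a convex combination of nonpositive values, so only the
  interpolation error can be positive.
\<close>

lemma le_if_le_at_nodes:
  assumes T: "mesh T" and g: "g \<in> L2"
    and v: "\<And>x. x \<in> {-1..1} \<Longrightarrow> v x = d + prim g x" and nodes: "\<And>t. t \<in> T \<Longrightarrow> v t \<le> 0"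
    and x: "x \<in> {-1..1}"
  shows "v x \<le> sqrt (mesh_size T * osc T g)"
proof -
  obtain a b where ab: "(a, b) \<in> cells T" "x \<in> {a..b}" using cells_cover[OF T x] by blast
  note c = cellsD[OF T ab(1)]
  have vb: "v b = v a + mean g a b * (b - a)"
    using prim_diff[OF L2_L1[OF g], of a b] integral_mean[OF T ab(1), of g] v[of a] v[of b] c by simp
  define \<kappa> where "\<kappa> = (x - a) / (b - a)"
  have l: "0 \<le> \<kappa>" "\<kappa> \<le> 1" using ab c by (auto simp: \<kappa>_def divide_le_eq_1)
  have "mean g a b * (x - a) = \<kappa> * (v b - v a)" using vb c by (simp add: \<kappa>_def)
  then have "v a + mean g a b * (x - a) = (1 - \<kappa>) * v a + \<kappa> * v b" by (simp add: algebra_simps)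
  also have "\<dots> \<le> 0" using nodes[OF c(1)] nodes[OF c(2)] l
    by (intro add_nonpos_nonpos mult_nonneg_nonpos) auto
  finally show ?thesis
    using interpolation_error_osc[OF T g ab] v[of x] v[of a] x c by simp
qed

text \<open>
  The hypothesis on \<open>G\<close> is a weak form of bounded variation, which allows jumps. Take \<open>w = G - avg T G\<close>:
  the pairing of \<open>G\<close> with \<open>w\<close> is \<open>osc T G\<close>, while the primitive of \<open>w\<close> vanishes at the grid points and is
  therefore at most \<open>sqrt (h osc T G)\<close>. Cancelling one square root gives the bound.
\<close>

lemma osc_weak_BV:
  assumes T: "mesh T" and G: "G \<in> L2" and "M \<ge> 0"
    and BV: "\<And>w \<eta>. w \<in> L2 \<Longrightarrow> (\<And>x. x \<in> {-1..1} \<Longrightarrow> \<bar>prim w x\<bar> \<le> \<eta>) \<Longrightarrow>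
      integral {-1..1} (\<lambda>x. G x * w x) \<le> M * \<eta>"
  shows "osc T G \<le> M\<^sup>2 * mesh_size T"
proof -
  define w where "w = (\<lambda>x. G x - avg T G x)"
  have w: "w \<in> L2" unfolding w_def by (intro L2_diff G avg_L2 T)
  have cell0: "integral {a..b} w = 0" if ab: "(a, b) \<in> cells T" for a b
  proof -
    have "integral {a..b} w = integral {a..b} (\<lambda>x. G x - mean G a b)"
      by (rule integral_cong_open) (simp add: w_def avg_eq[OF T ab])
    also have "\<dots> = 0"
      using cellsD[OF T ab] L1_integrable[OF L2_L1[OF G], of a b] integral_mean[OF T ab, of G]
      by (simp add: integral_sub_const)
    finally show ?thesis .
  qed
  have node0: "prim w t = 0" if "t \<in> T" for t
  proof -
    have "prim w t = prim (\<lambda>_. 0) t"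
      by (rule mesh_prim_eq[OF T L2_L1[OF w] L1_const that]) (simp add: cell0)
    then show ?thesis by (simp add: prim_def)
  qed
  have sup: "\<bar>prim w x\<bar> \<le> sqrt (mesh_size T * osc T G)" if x: "x \<in> {-1..1}" for x
  proof -
    obtain a b where ab: "(a, b) \<in> cells T" "x \<in> {a..b}" using cells_cover[OF T x] by blast
    note c = cellsD[OF T ab(1)]
    have "prim w x = integral {a..x} w"
      using prim_diff[OF L2_L1[OF w], of a x] node0[OF c(1)] ab c by simp
    also have "\<dots> = integral {a..x} (\<lambda>t. G t - mean G a b)"
      by (rule integral_cong_open) (use ab in \<open>simp add: w_def avg_eq[OF T ab(1)]\<close>)
    also have "\<dots> = prim G x - prim G a - mean G a b * (x - a)"
      using prim_diff[OF L2_L1[OF G], of a x] ab c L1_integrable[OF L2_L1[OF G], of a x]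
      by (simp add: integral_sub_const)
    finally show ?thesis using interpolation_error_osc[OF T G ab] by simp
  qed
  have "integral {-1..1} (\<lambda>x. avg T G x * w x) = prim (\<lambda>x. avg T G x * w x) 1"
    by (simp add: prim_def)
  also have "\<dots> = prim (\<lambda>_. 0) 1"
  proof (rule mesh_prim_eq[OF T _ L1_const])
    show "L1 (\<lambda>x. avg T G x * w x)" by (intro L2_mult avg_L2 T w)
    show "1 \<in> T" using T by (simp add: mesh_def)
    fix a b assume ab: "(a, b) \<in> cells T"
    have "integral {a..b} (\<lambda>x. avg T G x * w x) = integral {a..b} (\<lambda>x. mean G a b * w x)"
      by (rule integral_cong_open) (simp add: avg_eq[OF T ab])
    then show "integral {a..b} (\<lambda>x. avg T G x * w x) = integral {a..b} (\<lambda>_. 0)"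
      using cell0[OF ab] by simp
  qed
  \<comment> \<open>\<open>w\<close> is orthogonal to all functions that are constant on the cells.\<close>
  finally have orth: "integral {-1..1} (\<lambda>x. avg T G x * w x) = 0" by (simp add: prim_def)
  have "integral {-1..1} (\<lambda>x. G x * w x) = integral {-1..1} (\<lambda>x. (w x)\<^sup>2 + avg T G x * w x)"
    by (simp add: w_def power2_eq_square algebra_simps)
  also have "\<dots> = osc T G"
    using L1_integrable_J[OF L2_square[OF w]] L1_integrable_J[OF L2_mult[OF avg_L2[OF T] w]] orth
    by (simp add: integral_add osc_def) (simp add: w_def)
  finally have "osc T G \<le> M * sqrt (mesh_size T * osc T G)"
    using BV[OF w sup] by simp
  then have "(osc T G)\<^sup>2 \<le> (M * sqrt (mesh_size T * osc T G))\<^sup>2"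
    using osc_nonneg[OF T G] by (rule power_mono)
  also have "\<dots> = M\<^sup>2 * mesh_size T * osc T G"
    using osc_nonneg[OF T G] mesh_size_bounds[OF T] by (simp add: power_mult_distrib)
  finally have "osc T G * osc T G \<le> (M\<^sup>2 * mesh_size T) * osc T G" by (simp add: power2_eq_square)
  then show ?thesis
    using osc_nonneg[OF T G] mesh_size_bounds[OF T] by (cases "osc T G = 0") auto
qed

text \<open>
  For \<open>x\<close> in a cell of length \<open>l\<close>, the square of the deviation of \<open>f x\<close> from the mean is at most the mean of
  \<open>(f x - f y)\<^sup>2\<close> over the cell, and there \<open>\<bar>x - y\<bar> \<le> l\<close>. Hence it is at most \<open>l powr (2 \<sigma>)\<close> times the
  inner integral \<open>\<Phi> x\<close> of the Slobodeckij kernel, and \<open>\<Phi>\<close> is integrable.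
\<close>

lemma osc_slobodeckij:
  assumes f: "f \<in> L2" and sl: "slobodeckij_finite \<sigma> f" and \<sigma>: "\<sigma> > 0"
  obtains A where "A \<ge> 0" "\<And>T. mesh T \<Longrightarrow> osc T f \<le> A * mesh_size T powr (2 * \<sigma>)"
proof -
  let ?M = "lebesgue_on I"
  interpret M: finite_measure ?M by (intro finite_measure_lebesgue_on) simp
  interpret P: pair_sigma_finite ?M ?M ..
  define D where "D = (\<lambda>x y. (f x - f y)\<^sup>2 / \<bar>x - y\<bar> powr (1 + 2 * \<sigma>))"
  have D0: "D x y \<ge> 0" for x y by (simp add: D_def)
  have Dint: "integrable (?M \<Otimes>\<^sub>M ?M) (case_prod D)"
    using sl unfolding slobodeckij_finite_def D_def .
  define \<Phi> where "\<Phi> = (\<lambda>x. \<integral>y. D x y \<partial>?M)"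
  have AE: "AE x in ?M. integrable ?M (D x)" using P.AE_integrable_fst'[OF Dint] by simp
  have \<Phi>: "integrable ?M \<Phi>" using P.integrable_fst'[OF Dint] by (simp add: \<Phi>_def)
  have \<Phi>0: "\<Phi> x \<ge> 0" for x unfolding \<Phi>_def by (intro integral_nonneg_AE) (simp add: D0)
  show thesis
  proof (rule that[of "integral\<^sup>L ?M \<Phi>"])
    show "integral\<^sup>L ?M \<Phi> \<ge> 0" by (intro integral_nonneg_AE) (simp add: \<Phi>0)
    fix T assume T: "mesh T"
    let ?h = "mesh_size T"
    have bound: "(f x - avg T f x)\<^sup>2 \<le> ?h powr (2 * \<sigma>) * \<Phi> x"
      if Dx: "integrable ?M (D x)" and x: "x \<in> I" "x \<notin> T" for x
    proof -
      have "x \<in> {-1..1}" using x by auto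
      then obtain a b where ab: "(a, b) \<in> cells T" "x \<in> {a..b}" using cells_cover[OF T] by blast
      note c = cellsD[OF T ab(1)]
      have xab: "x \<in> {a<..<b}" using ab x c(1,2) by (cases "x = a \<or> x = b") auto
      have L: "(\<lambda>y. f x - f y) \<in> L2" by (intro L2_diff L2_const f)
      have LD: "L1 (D x)" using Dx by (simp add: integrable_I_iff)
      define m where "m = mean f a b"
      have fint: "f integrable_on {a..b}" using c by (intro L1_integrable L2_L1 f) auto
      \<comment> \<open>Cauchy--Schwarz against the constant 1 compares the deviation from the mean with differences.\<close>
      have "((b - a) * (f x - m))\<^sup>2 = (integral {a..b} (\<lambda>y. 1 * (f x - f y)))\<^sup>2"
        using fint c integral_mean[OF T ab(1), of f]
        by (simp add: integral_sub_const m_def right_diff_distrib mult.commute)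
      also have "\<dots> \<le> integral {a..b} (\<lambda>_. 1\<^sup>2) * integral {a..b} (\<lambda>y. (f x - f y)\<^sup>2)"
        by (rule Cauchy_Schwarz_integral[OF L2_const L]) (use c in auto)
      also have "\<dots> = (b - a) * integral {a..b} (\<lambda>y. (f x - f y)\<^sup>2)"
        using c by simp
      also have "\<dots> \<le> (b - a) * integral {a..b} (\<lambda>y. (b - a) powr (1 + 2 * \<sigma>) * D x y)"
      proof (intro mult_left_mono integral_mono_L1)
        fix y assume y: "y \<in> {a..b}"
        show "(f x - f y)\<^sup>2 \<le> (b - a) powr (1 + 2 * \<sigma>) * D x y"
        proof (cases "x = y")
          case False
          have "\<bar>x - y\<bar> powr (1 + 2 * \<sigma>) \<le> (b - a) powr (1 + 2 * \<sigma>)"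
            using \<sigma> y xab by (intro powr_mono2) auto
          then have "\<bar>x - y\<bar> powr (1 + 2 * \<sigma>) * D x y \<le> (b - a) powr (1 + 2 * \<sigma>) * D x y"
            using D0 by (rule mult_right_mono)
          moreover have "\<bar>x - y\<bar> powr (1 + 2 * \<sigma>) * D x y = (f x - f y)\<^sup>2"
            using False by (simp add: D_def)
          ultimately show ?thesis by simp
        qed (simp add: D_def)
      qed (use c in \<open>auto intro!: L2_square L L1_cmult LD\<close>)
      also have "\<dots> \<le> (b - a) * ((b - a) powr (1 + 2 * \<sigma>) * \<Phi> x)"
      proof -
        have "integral {a..b} (D x) \<le> integral {-1..1} (D x)"
          by (rule integral_subset_le) (use c LD D0 in \<open>auto intro!: L1_integrable\<close>)
        also have "\<dots> = \<Phi> x" using LD by (simp add: \<Phi>_def integral_I)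
        finally show ?thesis using c by (simp add: mult_left_mono)
      qed
      finally have "(b - a)\<^sup>2 * (f x - m)\<^sup>2 \<le> (b - a)\<^sup>2 * ((b - a) powr (2 * \<sigma>) * \<Phi> x)"
        using c by (simp add: power_mult_distrib powr_add power2_eq_square mult.assoc)
      then have "(f x - m)\<^sup>2 \<le> (b - a) powr (2 * \<sigma>) * \<Phi> x"
        using c by simp
      also have "\<dots> \<le> ?h powr (2 * \<sigma>) * \<Phi> x"
        using \<Phi>0 c \<sigma> by (intro mult_right_mono powr_mono2) auto
      finally show ?thesis using avg_eq[OF T ab(1) xab] by (simp add: m_def)
    qed
    have "AE x in ?M. x \<notin> T"
      unfolding AE_I_iff using T by (auto simp: mesh_def intro!: negligible_finite)
    have "osc T f = (\<integral>x. (f x - avg T f x)\<^sup>2 \<partial>?M)"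
      unfolding osc_def using osc_L1[OF T f] by (simp add: integral_I)
    also have "\<dots> \<le> (\<integral>x. ?h powr (2 * \<sigma>) * \<Phi> x \<partial>?M)"
    proof (rule integral_mono_AE)
      show "AE x in ?M. (f x - avg T f x)\<^sup>2 \<le> ?h powr (2 * \<sigma>) * \<Phi> x"
        using AE \<open>AE x in ?M. x \<notin> T\<close> AE_space
        by eventually_elim (auto intro: bound)
    qed (use osc_L1[OF T f] \<Phi> in \<open>auto simp: integrable_I_iff\<close>)
    finally show "osc T f \<le> integral\<^sup>L ?M \<Phi> * ?h powr (2 * \<sigma>)" by (simp add: mult.commute)
  qed
qed

section \<open>Discrete and continuous admissible functions, Hermite interpolation\<close>

lemma derivs_DERIV:
  assumes d: "derivs y p g" and x: "x \<in> {-1..1}"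
  shows "(y has_real_derivative p x) (at x within {-1..1})"
  using prim_DERIV[OF derivs_L2(2)[OF d] x]
  by (rule has_field_derivative_transform_within[OF _ zero_less_one x])
    (simp add: derivsD(3)[OF d])

lemma derivs_C1: "derivs y p g \<Longrightarrow> C1_closed y"
  unfolding C1_closed_def using derivs_DERIV derivs_L2(2) by blast

lemma derivs_vector_derivative:
  assumes "derivs y p g" "x \<in> {-1..1}"
  shows "vector_derivative y (at x within {-1..1}) = p x"
  using vector_derivative_within_cbox[of "-1" 1 x y "p x"] derivs_DERIV[OF assms] assms(2)
  by (simp add: has_real_derivative_iff_has_vector_derivative)

lemma derivs_lincomb:
  assumes d: "derivs y p g" and d': "derivs y' p' g'"
  shows "derivs (\<lambda>x. s * y x + t * y' x) (\<lambda>x. s * p x + t * p' x) (\<lambda>x. s * g x + t * g' x)"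
  unfolding derivs_def
proof (intro conjI ballI)
  note L = derivs_L2[OF d] and L' = derivs_L2[OF d']
  show "(\<lambda>x. s * g x + t * g' x) \<in> L2" by (intro L2_add L2_scale L L')
  have prim_comb: "prim (\<lambda>x. s * u x + t * v x) x = s * prim u x + t * prim v x"
    if "u \<in> L2" "v \<in> L2" "x \<le> 1" for u v x
    using that by (simp add: prim_add L1_cmult L2_L1 prim_cmult)
  show "prim (\<lambda>x. s * p x + t * p' x) 1 = 0"
    using derivsD(4)[OF d] derivsD(4)[OF d'] L L' by (simp add: prim_comb)
  fix x :: real assume x: "x \<in> {-1..1}"
  show "s * p x + t * p' x = s * p (- 1) + t * p' (- 1) + prim (\<lambda>x. s * g x + t * g' x) x"
    using derivsD(2)[OF d x] derivsD(2)[OF d' x] x L L'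
    by (simp add: prim_comb) (simp add: algebra_simps)
  show "s * y x + t * y' x = prim (\<lambda>x. s * p x + t * p' x) x"
    using derivsD(3)[OF d x] derivsD(3)[OF d' x] x L L' by (simp add: prim_comb)
qed

lemma derivs_diff:
  assumes "derivs y p g" "derivs y' p' g'"
  shows "derivs (\<lambda>x. y x - y' x) (\<lambda>x. p x - p' x) (\<lambda>x. g x - g' x)"
  using derivs_lincomb[OF assms, of 1 "-1"] by simp

lemma derivs_add:
  assumes "derivs y p g" "derivs y' p' g'"
  shows "derivs (\<lambda>x. y x + y' x) (\<lambda>x. p x + p' x) (\<lambda>x. g x + g' x)"
  using derivs_lincomb[OF assms, of 1 1] by simp

lemma abs_integral_le_sup:
  fixes f :: "real \<Rightarrow> real"
  assumes "a \<le> b" "continuous_on {a..b} f" "\<And>x. x \<in> {a..b} \<Longrightarrow> \<bar>f x\<bar> \<le> B"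
  shows "\<bar>integral {a..b} f\<bar> \<le> B * (b - a)"
  using integral_bound[of a b f B] assms by simp

lemma derivs_sup_y:
  assumes d: "derivs y p g" and p: "\<And>x. x \<in> {-1..1} \<Longrightarrow> \<bar>p x\<bar> \<le> \<eta>" and x: "x \<in> {-1..1}"
  shows "\<bar>y x\<bar> \<le> 2 * \<eta>"
proof -
  have "\<eta> \<ge> 0" using p[of 0] by force
  have "\<bar>integral {-1..x} p\<bar> \<le> \<eta> * (x - (-1))"
    using x p continuous_on_subset[OF derivs_L2(2)[OF d]]
    by (intro abs_integral_le_sup) auto
  also have "\<dots> \<le> \<eta> * 2" using x \<open>\<eta> \<ge> 0\<close> by (intro mult_left_mono) auto
  finally show ?thesis using derivsD(3)[OF d x] by (simp add: prim_def)
qed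

text \<open>
  Since \<open>p\<close> has mean zero, its value at \<open>-1\<close> is minus the mean of \<open>prim g\<close>.
\<close>

lemma derivs_sup_p:
  assumes d: "derivs y p g" and g: "\<And>x. x \<in> {-1..1} \<Longrightarrow> \<bar>prim g x\<bar> \<le> \<eta>" and x: "x \<in> {-1..1}"
  shows "\<bar>p x\<bar> \<le> 2 * \<eta>"
proof -
  have g1: "L1 g" by (rule L2_L1[OF derivs_L2(1)[OF d]])
  have i: "prim g integrable_on {-1..1}"
    by (intro L1_integrable_J continuous_L1 prim_continuous g1)
  have "0 = integral {-1..1} p" using derivsD(4)[OF d] by (simp add: prim_def)
  also have "\<dots> = integral {-1..1} (\<lambda>x. p (-1) + prim g x)"
    by (rule integral_cong) (rule derivsD(2)[OF d])
  also have "\<dots> = 2 * p (-1) + integral {-1..1} (prim g)"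
    using integral_add[OF integrable_const_ivl i, of "p (-1)"] by simp
  finally have "2 * p (-1) = - integral {-1..1} (prim g)" by simp
  moreover have "\<bar>integral {-1..1} (prim g)\<bar> \<le> \<eta> * (1 - (-1))"
    using g prim_continuous[OF g1]
    by (intro abs_integral_le_sup) auto
  ultimately have "\<bar>p (-1)\<bar> \<le> \<eta>" by (simp add: abs_le_iff)
  with g[OF x] show ?thesis using derivsD(2)[OF d x] by linarith
qed

lemma derivs_of_second:
  assumes w: "w \<in> L2"
  obtains v q where "derivs v q w"
proof -
  define c where "c = prim (prim w) 1 / 2"
  define q where "q = (\<lambda>x. prim w x - c)"
  have L: "L1 (prim w)" by (intro continuous_L1 prim_continuous L2_L1 w)
  have "derivs (prim q) q w"
    unfolding derivs_def q_def using w L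
    by (simp add: prim_sub[OF L L1_const] prim_const c_def)
  then show thesis by (rule that)
qed

text \<open>
  Both sides of the constraint are continuous, so that an inequality almost everywhere is one
  everywhere.
\<close>

lemma K_iff:
  assumes d: "derivs y p g" and \<psi>: "continuous_on {-1..1} \<psi>"
  shows "y \<in> K \<psi> \<longleftrightarrow> (\<forall>x\<in>{-1..1}. p x \<le> \<psi> x)"
proof -
  have "y \<in> V" using d V_iff by blast
  then have "y \<in> K \<psi> \<longleftrightarrow> (AE x in lebesgue_on I. weak_deriv 1 y x \<le> \<psi> x)" by (simp add: K_def)
  also have "\<dots> \<longleftrightarrow> (AE x in lebesgue_on I. p x \<le> \<psi> x)"
  proof
    show "AE x in lebesgue_on I. p x \<le> \<psi> x" if "AE x in lebesgue_on I. weak_deriv 1 y x \<le> \<psi> x"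
      using that derivs_weak_deriv(1)[OF d] by eventually_elim simp
    show "AE x in lebesgue_on I. weak_deriv 1 y x \<le> \<psi> x" if "AE x in lebesgue_on I. p x \<le> \<psi> x"
      using that derivs_weak_deriv(1)[OF d] by eventually_elim simp
  qed
  also have "\<dots> \<longleftrightarrow> (\<forall>x\<in>{-1..1}. p x \<le> \<psi> x)"
  proof
    assume *: "AE x in lebesgue_on I. p x \<le> \<psi> x"
    have "AE x in lebesgue_on I. max (p x - \<psi> x) 0 = 0" using * by eventually_elim simp
    then have *: "max (p x - \<psi> x) 0 = 0" if "x \<in> {-1..1}" for x
      using that by (rule continuous_AE_eq[rotated 2])
        (auto intro!: continuous_intros derivs_L2(2)[OF d] \<psi>)
    show "\<forall>x\<in>{-1..1}. p x \<le> \<psi> x"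
    proof
      fix x :: real assume "x \<in> {-1..1}"
      from *[OF this] show "p x \<le> \<psi> x" by linarith
    qed
  qed (auto intro!: AE_I2)
  finally show ?thesis .
qed

lemma K\<^sub>h_iff:
  assumes T: "mesh T" and d: "derivs y p g"
  shows "y \<in> K\<^sub>h \<psi> T \<longleftrightarrow> y \<in> V\<^sub>h T \<and> (\<forall>t\<in>T. p t \<le> \<psi> t)"
proof -
  have "vector_derivative y (at t within {-1..1}) = p t" if "t \<in> T" for t
    using that T by (intro derivs_vector_derivative[OF d]) (auto simp: mesh_def)
  then show ?thesis
    unfolding K\<^sub>h_def using P\<^sub>h_le_iff[OF T] by auto
qed

lemma V\<^sub>h_lincomb:
  assumes "y \<in> V\<^sub>h T" "y' \<in> V\<^sub>h T"
  shows "(\<lambda>x. s * y x + t * y' x) \<in> V\<^sub>h T"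
proof -
  have "y \<in> V" "y' \<in> V" using assms by (simp_all add: V\<^sub>h_def)
  then obtain p g p' g' where d: "derivs y p g" "derivs y' p' g'"
    unfolding V_iff by blast
  note c = derivs_lincomb[OF d, of s t]
  have "\<exists>r :: real poly. degree r \<le> 3 \<and> (\<forall>x\<in>{a..b}. s * y x + t * y' x = poly r x)"
    if ab: "(a, b) \<in> cells T" for a b
  proof -
    obtain r r' :: "real poly" where "degree r \<le> 3" "\<forall>x\<in>{a..b}. y x = poly r x"
      "degree r' \<le> 3" "\<forall>x\<in>{a..b}. y' x = poly r' x"
      using assms ab unfolding V\<^sub>h_def by fast
    then show ?thesis
      by (intro exI[of _ "smult s r + smult t r'"])
        (auto intro!: degree_add_le order_trans[OF degree_smult_le])
  qed
  then show ?thesis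
    unfolding V\<^sub>h_def using derivs_C1[OF c] V_iff c by blast
qed

lemma integral_eq_primitive_diff:
  fixes F f :: "real \<Rightarrow> real"
  assumes "a \<le> b" "\<And>x. (F has_real_derivative f x) (at x)"
  shows "integral {a..b} f = F b - F a"
  using assms
  by (intro integral_unique fundamental_theorem_of_calculus)
    (auto simp: has_real_derivative_iff_has_vector_derivative[symmetric]
      intro: has_field_derivative_at_within)

text \<open>
  On a cell of length \<open>l\<close> the derivative \<open>p'\<close> of the interpolant is the linear interpolant of \<open>p\<close> plus the
  multiple \<open>\<kappa>\<close> of the parabola \<open>(x - a) (b - x)\<close>. The latter has integral \<open>l ^ 3 / 6\<close>, so the
  choice of \<open>\<kappa>\<close> below gives \<open>p'\<close> the same integral as \<open>p\<close> over the cell; thus the interpolant agrees with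
  \<open>y\<close> at the grid points and vanishes at \<open>1\<close>.
  
  If \<open>Q\<close> is the contribution of the cell to \<open>osc T g\<close>, the interpolation error bounds
  \<open>\<kappa>\<^sup>2 l ^ 3\<close> by \<open>36 Q\<close>; the derivative of the parabola has squared norm \<open>l ^ 3 / 3\<close>, and
  \<open>26 = 2 + 2 * 36 / 3\<close>.
\<close>

lemma Hermite_interpolant:
  assumes T: "mesh T" and d: "derivs y p g"
  obtains y' p' s where "derivs y' p' s" "y' \<in> V\<^sub>h T" "\<And>t. t \<in> T \<Longrightarrow> p' t = p t"
    "\<And>x. x \<in> {-1..1} \<Longrightarrow> \<bar>p' x - p x\<bar> \<le> sqrt (26 * mesh_size T * osc T g)"
    "integral {-1..1} (\<lambda>x. (s x - g x)\<^sup>2) \<le> 26 * osc T g"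
proof -
  note L = derivs_L2[OF d]
  have g1: "L1 g" by (rule L2_L1[OF L(1)])
  define \<kappa> where "\<kappa> = (\<lambda>a b. 6 / (b - a) ^ 3 *
    (integral {a..b} p - p a * (b - a) - mean g a b * (b - a)\<^sup>2 / 2))"
  define s where "s = glue T (\<lambda>c x. mean g (fst c) (snd c) + \<kappa> (fst c) (snd c) * (fst c + snd c - 2 * x))"
  have s: "s \<in> L2"
    unfolding s_def by (intro glue_L2 T L2_continuous continuous_intros)
  have s1: "L1 s" by (rule L2_L1[OF s])
  define p' where "p' = (\<lambda>x. p (-1) + prim s x)"
  have p'_start: "p' (-1) = p (-1)" by (simp add: p'_def)
  have p'cont: "continuous_on {-1..1} p'"
    unfolding p'_def by (intro continuous_intros prim_continuous s1)
  have p'1: "L1 p'" by (rule continuous_L1[OF p'cont])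
  have s_prim: "prim s x - prim s a = mean g a b * (x - a) + \<kappa> a b * ((x - a) * (b - x))"
    if ab: "(a, b) \<in> cells T" and x: "x \<in> {a..b}" for a b x
  proof -
    note c = cellsD[OF T ab]
    have "prim s x - prim s a = integral {a..x} s"
      using c x by (intro prim_diff s1) auto
    also have "\<dots> = integral {a..x} (\<lambda>t. mean g a b + \<kappa> a b * (a + b - 2 * t))"
      by (rule integral_cong_open) (use x in \<open>simp add: s_def glue_eq[OF T ab]\<close>)
    also have "\<dots> = (mean g a b * x + \<kappa> a b * ((a + b) * x - x\<^sup>2))
        - (mean g a b * a + \<kappa> a b * ((a + b) * a - a\<^sup>2))"
      by (rule integral_eq_primitive_diff[where F = "\<lambda>x. mean g a b * x + \<kappa> a b * ((a + b) * x - x\<^sup>2)"])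
        (use x in \<open>auto intro!: derivative_eq_intros\<close>)
    finally show ?thesis by (simp add: power2_eq_square algebra_simps)
  qed
  have cell_s: "integral {a..b} s = integral {a..b} g" if ab: "(a, b) \<in> cells T" for a b
    using s_prim[OF ab, of b] cellsD[OF T ab] prim_diff[OF s1, of a b] integral_mean[OF T ab, of g]
    by simp
  have node: "p' t = p t" if "t \<in> T" for t
  proof -
    have "t \<in> {-1..1}" using T that by (auto simp: mesh_def)
    then show ?thesis
      using mesh_prim_eq[OF T s1 g1 that cell_s] derivsD(2)[OF d, of t] by (simp add: p'_def)
  qed
  have p'_cell: "p' x = p a + (mean g a b * (x - a) + \<kappa> a b * ((x - a) * (b - x)))"
    if ab: "(a, b) \<in> cells T" and x: "x \<in> {a..b}" for a b x
    using s_prim[OF ab x] node[OF cellsD(1)[OF T ab]] by (simp add: p'_def)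
  have p'_prim: "prim p' x - prim p' a = p a * (x - a) + mean g a b * (x - a)\<^sup>2 / 2
      + \<kappa> a b * ((b - a) * (x - a)\<^sup>2 / 2 - (x - a) ^ 3 / 3)"
    if ab: "(a, b) \<in> cells T" and x: "x \<in> {a..b}" for a b x
  proof -
    note c = cellsD[OF T ab]
    let ?F = "\<lambda>x. p a * (x - a) + mean g a b * (x - a)\<^sup>2 / 2
      + \<kappa> a b * ((b - a) * (x - a)\<^sup>2 / 2 - (x - a) ^ 3 / 3)"
    have "prim p' x - prim p' a = integral {a..x} p'"
      using c x by (intro prim_diff p'1) auto
    also have "\<dots> = integral {a..x} (\<lambda>t. p a + (mean g a b * (t - a) + \<kappa> a b * ((t - a) * (b - t))))"
      by (rule integral_cong) (use x in \<open>simp add: p'_cell[OF ab]\<close>)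
    also have "\<dots> = ?F x - ?F a"
      by (rule integral_eq_primitive_diff)
        (use x in \<open>auto intro!: derivative_eq_intros simp: power2_eq_square field_simps\<close>)
    finally show ?thesis by simp
  qed
  have cell_p: "integral {a..b} p' = integral {a..b} p" if ab: "(a, b) \<in> cells T" for a b
  proof -
    note c = cellsD[OF T ab]
    have "integral {a..b} p' = p a * (b - a) + mean g a b * (b - a)\<^sup>2 / 2
      + \<kappa> a b * ((b - a) * (b - a)\<^sup>2 / 2 - (b - a) ^ 3 / 3)"
      using p'_prim[OF ab, of b] prim_diff[OF p'1, of a b] c by simp
    also have "(b - a) * (b - a)\<^sup>2 / 2 - (b - a) ^ 3 / 3 = (b - a) ^ 3 / 6"
      by (simp add: power2_eq_square power3_eq_cube)
    also have "\<kappa> a b * ((b - a) ^ 3 / 6)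
        = integral {a..b} p - p a * (b - a) - mean g a b * (b - a)\<^sup>2 / 2"
      using c by (simp add: \<kappa>_def)
    finally show ?thesis by simp
  qed
  have prim_p': "prim p' t = prim p t" if "t \<in> T" for t
    by (rule mesh_prim_eq[OF T p'1 L2_L1[OF L(3)] that cell_p])
  have "1 \<in> T" using T by (simp add: mesh_def)
  have d': "derivs (prim p') p' s"
    unfolding derivs_def using s prim_p'[OF \<open>1 \<in> T\<close>] derivsD(4)[OF d]
    by (simp add: p'_def)
  have Vh: "prim p' \<in> V\<^sub>h T"
    unfolding V\<^sub>h_def
  proof (intro CollectI conjI ballI)
    show "prim p' \<in> V" using d' V_iff by blast
    show "C1_closed (prim p')" using d' by (rule derivs_C1)
    fix c assume c: "c \<in> cells T"
    obtain a b where ab: "c = (a, b)" by force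
    define q where "q = [:prim p' a, p a, mean g a b / 2 + \<kappa> a b * (b - a) / 2, - \<kappa> a b / 3:]"
    have "degree (pcompose q [:- a, 1:]) \<le> 3"
      unfolding degree_pcompose by (simp add: q_def)
    moreover have "prim p' x = poly (pcompose q [:- a, 1:]) x" if x: "x \<in> {a..b}" for x
      using p'_prim[of a b x] c x unfolding ab
      by (simp add: q_def poly_pcompose power2_eq_square power3_eq_cube algebra_simps)
    ultimately show "case c of (a, b) \<Rightarrow> \<exists>q :: real poly. degree q \<le> 3 \<and> (\<forall>x\<in>{a..b}. prim p' x = poly q x)"
      unfolding ab by blast
  qed
  have cell_err: "integral {a..b} (\<lambda>x. (s x - g x)\<^sup>2) \<le> 26 * integral {a..b} (\<lambda>x. (g x - mean g a b)\<^sup>2)"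
    if ab: "(a, b) \<in> cells T" for a b
  proof -
    note c = cellsD[OF T ab]
    define m where "m = mean g a b"
    define Q where "Q = integral {a..b} (\<lambda>x. (g x - m)\<^sup>2)"
    define l where "l = b - a"
    have l: "l > 0" using c by (simp add: l_def)
    have Lm: "L1 (\<lambda>x. (g x - m)\<^sup>2)" by (intro L2_square L2_diff L L2_const)
    have Q: "Q \<ge> 0" unfolding Q_def using c by (intro integral_nonneg L1_integrable Lm) auto
    have dev: "\<bar>p x - (p a + m * (x - a))\<bar> \<le> sqrt (l * Q)" if "x \<in> {a..b}" for x
      using interpolation_error_cell[OF L(1) c(3,4,5) that] derivsD(2)[OF d, of x]
        derivsD(2)[OF d, of a] that c
      by (simp add: m_def Q_def l_def)
    have pint: "p integrable_on {a..b}" using c by (intro L1_integrable L2_L1 L) auto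
    have "integral {a..b} (\<lambda>x. p x - (p a + m * (x - a)))
        = integral {a..b} p - integral {a..b} (\<lambda>x. p a + m * (x - a))"
      by (intro integral_diff pint integrable_continuous_real continuous_intros)
    also have "integral {a..b} (\<lambda>x. p a + m * (x - a))
        = (p a * b + m * (b - a)\<^sup>2 / 2) - (p a * a + m * (a - a)\<^sup>2 / 2)"
      using c by (intro integral_eq_primitive_diff[where F = "\<lambda>x. p a * x + m * (x - a)\<^sup>2 / 2"])
        (auto intro!: derivative_eq_intros)
    finally have "integral {a..b} (\<lambda>x. p x - (p a + m * (x - a)))
        = integral {a..b} p - p a * (b - a) - m * (b - a)\<^sup>2 / 2" by (simp add: algebra_simps)
    then have k: "\<kappa> a b = 6 / l ^ 3 * integral {a..b} (\<lambda>x. p x - (p a + m * (x - a)))"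
      by (simp add: \<kappa>_def m_def l_def)
    have "\<bar>integral {a..b} (\<lambda>x. p x - (p a + m * (x - a)))\<bar> \<le> sqrt (l * Q) * l"
      unfolding l_def
    proof (rule abs_integral_le_sup)
      show "continuous_on {a..b} (\<lambda>x. p x - (p a + m * (x - a)))"
        using c by (intro continuous_intros continuous_on_subset[OF L(2)]) auto
    qed (use c dev in \<open>auto simp: l_def\<close>)
    then have "(integral {a..b} (\<lambda>x. p x - (p a + m * (x - a))))\<^sup>2 \<le> (sqrt (l * Q) * l)\<^sup>2"
      using l by (intro abs_le_square_iff[THEN iffD1]) simp
    also have "\<dots> = l ^ 3 * Q" using l Q by (simp add: power_mult_distrib power2_eq_square power3_eq_cube)
    finally have "(6 / l ^ 3)\<^sup>2 * (integral {a..b} (\<lambda>x. p x - (p a + m * (x - a))))\<^sup>2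
        \<le> (6 / l ^ 3)\<^sup>2 * (l ^ 3 * Q)"
      by (intro mult_left_mono) auto
    also have "\<dots> = 36 * Q / l ^ 3"
      using l by (simp add: power2_eq_square power3_eq_cube field_simps)
    finally have k2: "(\<kappa> a b)\<^sup>2 * l ^ 3 \<le> 36 * Q"
      using l unfolding k by (subst power_mult_distrib) (simp add: pos_le_divide_eq)
    have "integral {a..b} (\<lambda>x. (s x - g x)\<^sup>2)
        = integral {a..b} (\<lambda>x. (m + \<kappa> a b * (a + b - 2 * x) - g x)\<^sup>2)"
      by (rule integral_cong_open) (simp add: s_def glue_eq[OF T ab] m_def)
    also have "\<dots> \<le> integral {a..b} (\<lambda>x. 2 * (g x - m)\<^sup>2 + 2 * (\<kappa> a b)\<^sup>2 * (a + b - 2 * x)\<^sup>2)"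
    proof (rule integral_mono_L1)
      show "(m + \<kappa> a b * (a + b - 2 * x) - g x)\<^sup>2
          \<le> 2 * (g x - m)\<^sup>2 + 2 * (\<kappa> a b)\<^sup>2 * (a + b - 2 * x)\<^sup>2" for x
        using zero_le_power2[of "(g x - m) + \<kappa> a b * (a + b - 2 * x)"]
        by (simp add: power2_eq_square algebra_simps)
      show "L1 (\<lambda>x. (m + \<kappa> a b * (a + b - 2 * x) - g x)\<^sup>2)"
        by (intro L2_square L2_diff L L2_continuous continuous_intros)
      show "L1 (\<lambda>x. 2 * (g x - m)\<^sup>2 + 2 * (\<kappa> a b)\<^sup>2 * (a + b - 2 * x)\<^sup>2)"
        by (intro L1_add L1_cmult Lm continuous_L1 continuous_intros)
    qed (use c in auto)
    also have "\<dots> = 2 * Q + 2 * (\<kappa> a b)\<^sup>2 * integral {a..b} (\<lambda>x. (a + b - 2 * x)\<^sup>2)"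
    proof -
      have "(\<lambda>x. 2 * (g x - m)\<^sup>2) integrable_on {a..b}"
        using c by (intro L1_integrable L1_cmult Lm) auto
      moreover have "(\<lambda>x. 2 * (\<kappa> a b)\<^sup>2 * (a + b - 2 * x)\<^sup>2) integrable_on {a..b}"
        by (intro integrable_continuous_real continuous_intros)
      ultimately show ?thesis by (simp add: integral_add Q_def)
    qed
    also have "integral {a..b} (\<lambda>x. (a + b - 2 * x)\<^sup>2) = - ((a + b - 2 * b) ^ 3 / 6) - (- ((a + b - 2 * a) ^ 3 / 6))"
      using c by (intro integral_eq_primitive_diff[where F = "\<lambda>x. - ((a + b - 2 * x) ^ 3 / 6)"])
        (auto intro!: derivative_eq_intros)
    also have "\<dots> = l ^ 3 / 3"
      by (simp add: l_def power3_eq_cube field_simps)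
    finally have "integral {a..b} (\<lambda>x. (s x - g x)\<^sup>2) \<le> 2 * Q + 2 / 3 * ((\<kappa> a b)\<^sup>2 * l ^ 3)" by simp
    with k2 show ?thesis unfolding Q_def m_def by simp
  qed
  have err: "integral {-1..1} (\<lambda>x. (s x - g x)\<^sup>2) \<le> 26 * osc T g"
  proof -
    have "integral {-1..1} (\<lambda>x. (s x - g x)\<^sup>2) \<le> integral {-1..1} (\<lambda>x. 26 * (g x - avg T g x)\<^sup>2)"
    proof (rule mesh_integral_le[OF T])
      show "L1 (\<lambda>x. (s x - g x)\<^sup>2)" by (intro L2_square L2_diff s L)
      show "L1 (\<lambda>x. 26 * (g x - avg T g x)\<^sup>2)" by (intro L1_cmult osc_L1 T L)
      fix a b assume ab: "(a, b) \<in> cells T"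
      have "integral {a..b} (\<lambda>x. 26 * (g x - avg T g x)\<^sup>2) = integral {a..b} (\<lambda>x. 26 * (g x - mean g a b)\<^sup>2)"
        by (rule integral_cong_open) (simp add: avg_eq[OF T ab])
      with cell_err[OF ab]
      show "integral {a..b} (\<lambda>x. (s x - g x)\<^sup>2) \<le> integral {a..b} (\<lambda>x. 26 * (g x - avg T g x)\<^sup>2)"
        by simp
    qed
    then show ?thesis by (simp add: osc_def)
  qed
  have sup: "\<bar>p' x - p x\<bar> \<le> sqrt (26 * mesh_size T * osc T g)" if x: "x \<in> {-1..1}" for x
  proof -
    obtain a b where ab: "(a, b) \<in> cells T" "x \<in> {a..b}" using cells_cover[OF T x] by blast
    note c = cellsD[OF T ab(1)]
    have sg: "(\<lambda>x. s x - g x) \<in> L2" by (intro L2_diff s L)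
    have "p' x - p x = (p' x - p' a) - (p x - p a)" using node[OF c(1)] by simp
    also have "\<dots> = prim (\<lambda>x. s x - g x) x - prim (\<lambda>x. s x - g x) a"
      using derivsD(2)[OF d, of x] derivsD(2)[OF d, of a] x c ab
      by (simp add: p'_def prim_sub s1 g1)
    also have "\<dots> = integral {a..x} (\<lambda>x. s x - g x)"
      using c ab by (intro prim_diff L2_L1 sg) auto
    also have "\<bar>\<dots>\<bar> \<le> sqrt ((x - a) * integral {a..x} (\<lambda>x. (s x - g x)\<^sup>2))"
      using c ab by (intro abs_integral_le_L2 sg) auto
    also have "\<dots> \<le> sqrt (mesh_size T * (26 * osc T g))"
    proof (rule real_sqrt_le_mono, rule mult_mono)
      have "integral {a..x} (\<lambda>x. (s x - g x)\<^sup>2) \<le> integral {-1..1} (\<lambda>x. (s x - g x)\<^sup>2)"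
        by (rule integral_subset_le) (use L2_square[OF sg] c x ab in \<open>auto intro!: L1_integrable\<close>)
      with err show "integral {a..x} (\<lambda>x. (s x - g x)\<^sup>2) \<le> 26 * osc T g" by simp
      show "0 \<le> integral {a..x} (\<lambda>x. (s x - g x)\<^sup>2)"
        using L2_square[OF sg] c x by (intro integral_nonneg L1_integrable) auto
    qed (use c x ab in auto)
    finally show ?thesis by (simp add: mult_ac)
  qed
  show thesis by (rule that[OF d' Vh node sup err])
qed

section \<open>Variational inequalities and the error estimate\<close>

definition ip :: "(real \<Rightarrow> real) \<Rightarrow> (real \<Rightarrow> real) \<Rightarrow> real" where
  "ip u v = integral {-1..1} (\<lambda>x. u x * v x)"

lemma ip_commute: "ip u v = ip v u"
  by (simp add: ip_def mult.commute)

lemma ip_self: "ip u u = integral {-1..1} (\<lambda>x. (u x)\<^sup>2)"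
  by (simp add: ip_def power2_eq_square)

lemma ip_nonneg: "u \<in> L2 \<Longrightarrow> 0 \<le> ip u u"
  unfolding ip_self by (intro integral_nonneg L1_integrable_J L2_square) auto

lemma ip_lincomb:
  assumes "u \<in> L2" "v \<in> L2" "w \<in> L2"
  shows "ip u (\<lambda>x. s * v x + t * w x) = s * ip u v + t * ip u w"
proof -
  have "ip u (\<lambda>x. s * v x + t * w x) = integral {-1..1} (\<lambda>x. s * (u x * v x) + t * (u x * w x))"
    unfolding ip_def by (simp add: algebra_simps)
  also have "\<dots> = s * ip u v + t * ip u w"
    using L1_integrable_J[OF L1_cmult[OF L2_mult[OF assms(1,2)], of s]]
      L1_integrable_J[OF L1_cmult[OF L2_mult[OF assms(1,3)], of t]]
    unfolding ip_def by (simp add: integral_add)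
  finally show ?thesis .
qed

lemma ip_add_scaled:
  assumes "u \<in> L2" "d \<in> L2"
  shows "ip (\<lambda>x. u x + t * d x) (\<lambda>x. u x + t * d x) = ip u u + 2 * t * ip u d + t\<^sup>2 * ip d d"
proof -
  have s: "(\<lambda>x. u x + t * d x) \<in> L2" by (intro L2_add L2_scale assms)
  have *: "ip v (\<lambda>x. u x + t * d x) = ip v u + t * ip v d" if "v \<in> L2" for v
    using ip_lincomb[OF that assms, of 1 t] by simp
  have "ip (\<lambda>x. u x + t * d x) (\<lambda>x. u x + t * d x)
      = ip u (\<lambda>x. u x + t * d x) + t * ip d (\<lambda>x. u x + t * d x)"
    unfolding *[OF s] by (simp add: ip_commute)
  then show ?thesis
    using assms by (simp add: * ip_commute[of d u] power2_eq_square algebra_simps)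
qed

lemma ip_Young:
  assumes "u \<in> L2" "d \<in> L2"
  shows "2 * ip u d \<le> ip u u + ip d d"
  using ip_nonneg[of "\<lambda>x. u x + (-1) * d x"] ip_add_scaled[OF assms, of "-1"]
    L2_add[OF assms(1) L2_scale[OF assms(2), of "-1"]] by simp

lemma ip_le_sup:
  assumes v: "v \<in> L2" and b: "\<And>x. x \<in> {-1..1} \<Longrightarrow> \<bar>v x\<bar> \<le> \<eta>"
  shows "ip v v \<le> 2 * \<eta>\<^sup>2"
proof -
  have "ip v v \<le> integral {-1..1} (\<lambda>_ :: real. \<eta>\<^sup>2)"
    unfolding ip_self
  proof (rule integral_mono_L1[OF L2_square[OF v] L1_const], goal_cases)
    case (3 x)
    from power_mono[OF b[OF this], of 2] show ?case by simp
  qed auto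
  then show ?thesis by simp
qed

lemma ip_Cauchy_Schwarz:
  assumes "u \<in> L2" "v \<in> L2"
  shows "\<bar>ip u v\<bar> \<le> sqrt (ip u u) * sqrt (ip v v)"
  using Cauchy_Schwarz_integral[OF assms, of "-1" 1]
  by (simp add: ip_self ip_def[symmetric] real_le_rsqrt flip: real_sqrt_mult)

lemma cost_eq:
  assumes d: "derivs y p g" and "y\<^sub>d \<in> L2" "f \<in> L2"
  shows "cost y\<^sub>d \<beta> f y = 1 / 2 * (ip (\<lambda>x. y x - y\<^sub>d x) (\<lambda>x. y x - y\<^sub>d x)
    + \<beta> * ip (\<lambda>x. g x + f x) (\<lambda>x. g x + f x))"
proof -
  note L = derivs_L2[OF d]
  have "(\<lambda>x. g x + f x) \<in> L2" "AE x in lebesgue_on I. g x + f x = weak_deriv 2 y x + f x"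
    using L2_add[OF L(1) assms(3)] derivs_weak_deriv(2)[OF d] by (auto elim: eventually_mono)
  then have "L2_norm (\<lambda>x. weak_deriv 2 y x + f x) = L2_norm (\<lambda>x. g x + f x)"
    by (rule L2_norm_cong_AE)
  then show ?thesis
    unfolding cost_def ip_self
    using L2_norm_square[OF L2_diff[OF L(5) assms(2)]] L2_norm_square[OF L2_add[OF L(1) assms(3)]]
    by simp
qed

text \<open>
  The derivative of the cost at \<open>y\<close> in the direction \<open>v\<close>, where \<open>g\<close> and \<open>w\<close> are the second derivatives of \<open>y\<close>
  and \<open>v\<close>.
\<close>

definition first_variation where
  "first_variation y\<^sub>d \<beta> f y g v w = ip (\<lambda>x. y x - y\<^sub>d x) v + \<beta> * ip (\<lambda>x. g x + f x) w"

lemma first_variation_lincomb: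
  assumes "y\<^sub>d \<in> L2" "f \<in> L2" "derivs y p g" "derivs v q w" "derivs v' q' w'"
  shows "first_variation y\<^sub>d \<beta> f y g (\<lambda>x. s * v x + t * v' x) (\<lambda>x. s * w x + t * w' x)
    = s * first_variation y\<^sub>d \<beta> f y g v w + t * first_variation y\<^sub>d \<beta> f y g v' w'"
proof -
  note L = assms(1,2) derivs_L2[OF assms(3)] derivs_L2[OF assms(4)] derivs_L2[OF assms(5)]
  have "(\<lambda>x. y x - y\<^sub>d x) \<in> L2" "(\<lambda>x. g x + f x) \<in> L2" using L by (auto intro: L2_diff L2_add)
  then show ?thesis
    unfolding first_variation_def using L by (simp add: ip_lincomb algebra_simps)
qed

text \<open>
  Along the segment from \<open>y\<close> to \<open>z\<close> the cost is a quadratic polynomial in \<open>t\<close> with a minimum at \<open>t = 0\<close>.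
\<close>

lemma variational_inequality:
  assumes yd: "y\<^sub>d \<in> L2" and f: "f \<in> L2" and \<beta>: "\<beta> > 0"
    and d: "derivs y p g" and d': "derivs z q k"
    and min: "\<And>t. 0 < t \<Longrightarrow> t \<le> 1 \<Longrightarrow> cost y\<^sub>d \<beta> f y \<le> cost y\<^sub>d \<beta> f (\<lambda>x. (1 - t) * y x + t * z x)"
  shows "0 \<le> first_variation y\<^sub>d \<beta> f y g (\<lambda>x. z x - y x) (\<lambda>x. k x - g x)"
proof -
  note L = derivs_L2[OF d] and L' = derivs_L2[OF d']
  define e where "e = (\<lambda>x. z x - y x)"
  define w where "w = (\<lambda>x. k x - g x)"
  have ew: "e \<in> L2" "w \<in> L2" using L L' by (auto simp: e_def w_def intro: L2_diff)
  define F where "F = first_variation y\<^sub>d \<beta> f y g e w"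
  define Q where "Q = ip e e + \<beta> * ip w w"
  have Q: "Q \<ge> 0" using ew \<beta> by (simp add: Q_def ip_nonneg)
  have step: "0 \<le> F + t / 2 * Q" if t: "0 < t" "t \<le> 1" for t
  proof -
    have y: "(\<lambda>x. y x - y\<^sub>d x) \<in> L2" by (intro L2_diff L yd)
    have g: "(\<lambda>x. g x + f x) \<in> L2" by (intro L2_add L f)
    have 1: "(\<lambda>x. (1 - t) * y x + t * z x - y\<^sub>d x) = (\<lambda>x. (y x - y\<^sub>d x) + t * e x)"
      "(\<lambda>x. (1 - t) * g x + t * k x + f x) = (\<lambda>x. (g x + f x) + t * w x)"
      by (auto simp: e_def w_def algebra_simps)
    have "cost y\<^sub>d \<beta> f (\<lambda>x. (1 - t) * y x + t * z x)
        = cost y\<^sub>d \<beta> f y + (t * F + t\<^sup>2 / 2 * Q)"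
      unfolding cost_eq[OF derivs_lincomb[OF d d', of "1 - t" t] yd f] cost_eq[OF d yd f] 1
        ip_add_scaled[OF y ew(1)] ip_add_scaled[OF g ew(2)] F_def Q_def first_variation_def
      by (simp add: algebra_simps)
    with min[OF t] have "0 \<le> t * (F + t / 2 * Q)"
      by (simp add: power2_eq_square algebra_simps)
    with t show ?thesis by (simp add: zero_le_mult_iff)
  qed
  have "0 \<le> F"
  proof (rule ccontr)
    assume "\<not> 0 \<le> F"
    then have F: "F < 0" by simp
    \<comment> \<open>A step so short that the quadratic term cannot compensate the negative slope.\<close>
    define t where "t = min 1 (- F / (Q + 1))"
    have t: "0 < t" "t \<le> 1" using F Q by (auto simp: t_def divide_neg_pos)
    have "t * Q \<le> - F / (Q + 1) * Q" using Q by (intro mult_right_mono) (auto simp: t_def)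
    also have "\<dots> \<le> - F" using F Q by (simp add: field_simps)
    finally show False using step[OF t] F by simp
  qed
  then show ?thesis by (simp add: F_def e_def w_def)
qed

text \<open>
  The continuous problem in terms of classical derivatives. The Slater number \<open>m\<close> is the mean of \<open>\<psi>\<close> over the
  interval, which has length 2.
\<close>

locale continuous_solution =
  fixes y\<^sub>d f \<psi> \<psi>' y p g :: "real \<Rightarrow> real" and \<beta> m :: real
  assumes yd: "y\<^sub>d \<in> L2" and f: "f \<in> L2" and \<psi>': "\<psi>' \<in> L2" and \<beta>: "\<beta> > 0" and m: "m > 0"
    and \<psi>: "\<And>x. x \<in> {-1..1} \<Longrightarrow> \<psi> x = \<psi> (-1) + prim \<psi>' x"
    and mean_\<psi>: "prim \<psi> 1 = 2 * m"
    and d: "derivs y p g"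
    and feasible: "\<And>x. x \<in> {-1..1} \<Longrightarrow> p x \<le> \<psi> x"
    and optimal: "\<And>z q k. derivs z q k \<Longrightarrow> (\<And>x. x \<in> {-1..1} \<Longrightarrow> q x \<le> \<psi> x)
      \<Longrightarrow> cost y\<^sub>d \<beta> f y \<le> cost y\<^sub>d \<beta> f z"
begin

abbreviation J' where "J' \<equiv> first_variation y\<^sub>d \<beta> f y g"

lemmas J'_lincomb = first_variation_lincomb[OF yd f d]

lemma J'_diff: "derivs v q w \<Longrightarrow> derivs v' q' w' \<Longrightarrow>
    J' (\<lambda>x. v x - v' x) (\<lambda>x. w x - w' x) = J' v w - J' v' w'"
  using J'_lincomb[of v q w v' q' w' \<beta> 1 "-1"] by simp

lemma J'_add: "derivs v q w \<Longrightarrow> derivs v' q' w' \<Longrightarrow>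
    J' (\<lambda>x. v x + v' x) (\<lambda>x. w x + w' x) = J' v w + J' v' w'"
  using J'_lincomb[of v q w v' q' w' \<beta> 1 1] by simp

lemma J'_scale: "derivs v q w \<Longrightarrow> J' (\<lambda>x. s * v x) (\<lambda>x. s * w x) = s * J' v w"
  using J'_lincomb[of v q w v q w \<beta> s 0] by simp

lemma J'_nonneg:
  assumes z: "derivs z q k" and q: "\<And>x. x \<in> {-1..1} \<Longrightarrow> q x \<le> \<psi> x"
  shows "0 \<le> J' (\<lambda>x. z x - y x) (\<lambda>x. k x - g x)"
proof (rule variational_inequality[OF yd f \<beta> d z])
  fix t :: real assume t: "0 < t" "t \<le> 1"
  show "cost y\<^sub>d \<beta> f y \<le> cost y\<^sub>d \<beta> f (\<lambda>x. (1 - t) * y x + t * z x)"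
  proof (rule optimal[OF derivs_lincomb[OF d z]])
    fix x :: real assume x: "x \<in> {-1..1}"
    have "(1 - t) * p x + t * q x \<le> (1 - t) * \<psi> x + t * \<psi> x"
      using t feasible[OF x] q[OF x] by (intro add_mono mult_left_mono) auto
    then show "(1 - t) * p x + t * q x \<le> \<psi> x" by (simp add: algebra_simps)
  qed
qed

lemma \<psi>_continuous: "continuous_on {-1..1} \<psi>"
  by (rule primitive_continuous[OF L2_L1[OF \<psi>'] \<psi>])

text \<open>
  A Slater point: its derivative stays at distance \<open>m\<close> below the constraint.
\<close>

definition y\<^sub>0 where "y\<^sub>0 = prim (\<lambda>x. \<psi> x - m)"

lemma slater: "derivs y\<^sub>0 (\<lambda>x. \<psi> x - m) \<psi>'"
  unfolding derivs_def y\<^sub>0_def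
proof (intro conjI ballI \<psi>' refl)
  show "\<psi> x - m = \<psi> (- 1) - m + prim \<psi>' x" if "x \<in> {-1..1}" for x using \<psi>[OF that] by simp
  show "prim (\<lambda>x. \<psi> x - m) 1 = 0"
    using mean_\<psi> by (simp add: prim_sub[OF continuous_L1[OF \<psi>_continuous] L1_const] prim_const)
qed

text \<open>
  This number plays the role of the total mass of the Lagrange multiplier: it bounds \<open>J'\<close> with respect to the
  supremum norm of the first derivative.
\<close>

definition \<mu> where "\<mu> = J' (\<lambda>x. y\<^sub>0 x - y x) (\<lambda>x. \<psi>' x - g x) / m"

lemma \<mu>_nonneg: "0 \<le> \<mu>"
  using J'_nonneg[OF slater] m by (simp add: \<mu>_def)

lemma J'_slater: "J' (\<lambda>x. y\<^sub>0 x - y x) (\<lambda>x. \<psi>' x - g x) = \<mu> * m"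
  using m by (simp add: \<mu>_def)

lemma J'_lower:
  assumes v: "derivs v q w" and q: "\<And>x. x \<in> {-1..1} \<Longrightarrow> \<bar>q x\<bar> \<le> m"
  shows "- (\<mu> * m) \<le> J' v w"
proof -
  have "0 \<le> J' (\<lambda>x. (y\<^sub>0 x + v x) - y x) (\<lambda>x. (\<psi>' x + w x) - g x)"
  proof (rule J'_nonneg[OF derivs_add[OF slater v]])
    fix x :: real assume "x \<in> {-1..1}"
    from q[OF this] show "\<psi> x - m + q x \<le> \<psi> x" by linarith
  qed
  also have "\<dots> = J' (\<lambda>x. y\<^sub>0 x - y x) (\<lambda>x. \<psi>' x - g x) + J' v w"
    using J'_diff[OF derivs_add[OF slater v] d] J'_add[OF slater v] J'_diff[OF slater d] by simp
  finally show ?thesis by (simp add: J'_slater)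
qed

text \<open>
  Scale a direction \<open>v\<close> with \<open>\<bar>q\<bar> \<le> \<eta>\<close> by \<open>- m / \<eta>\<close> and add it to the Slater point. In order to cover
  \<open>\<eta> = 0\<close>, the bound \<open>\<eta>\<close> is first enlarged to a positive \<open>\<eta>'\<close>.
\<close>

lemma J'_le_sup:
  assumes v: "derivs v q w" and q: "\<And>x. x \<in> {-1..1} \<Longrightarrow> \<bar>q x\<bar> \<le> \<eta>"
  shows "J' v w \<le> \<mu> * \<eta>"
proof (rule field_le_epsilon)
  fix e :: real assume e: "e > 0"
  have \<eta>: "\<eta> \<ge> 0" using q[of 0] by force
  define \<eta>' where "\<eta>' = \<eta> + e / (\<mu> + 1)"
  have \<eta>': "\<eta>' > 0" "\<eta> \<le> \<eta>'" using \<eta> e \<mu>_nonneg by (auto simp: \<eta>'_def add_nonneg_pos)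
  define s where "s = - m / \<eta>'"
  have "- (\<mu> * m) \<le> J' (\<lambda>x. s * v x + 0 * v x) (\<lambda>x. s * w x + 0 * w x)"
  proof (rule J'_lower[OF derivs_lincomb[OF v v]])
    fix x :: real assume x: "x \<in> {-1..1}"
    have "\<bar>s\<bar> * \<bar>q x\<bar> \<le> m / \<eta>' * \<eta>'"
      using q[OF x] \<eta>' m by (intro mult_mono) (auto simp: s_def)
    then show "\<bar>s * q x + 0 * q x\<bar> \<le> m" using \<eta>' by (simp add: abs_mult)
  qed
  then have "- (\<mu> * m) \<le> s * J' v w" using J'_scale[OF v, of s] by simp
  then have "m * J' v w \<le> m * (\<mu> * \<eta>')" using \<eta>' m by (simp add: s_def field_simps)
  then have "J' v w \<le> \<mu> * \<eta>'" using m by simp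
  also have "\<dots> = \<mu> * \<eta> + e * (\<mu> / (\<mu> + 1))" by (simp add: \<eta>'_def algebra_simps)
  also have "\<dots> \<le> \<mu> * \<eta> + e" using e \<mu>_nonneg by (simp add: field_simps)
  finally show "J' v w \<le> \<mu> * \<eta> + e" .
qed

text \<open>
  The convex combination of \<open>z\<close> and the Slater point with weights \<open>m / (\<delta> + m)\<close> and \<open>\<delta> / (\<delta> + m)\<close> is
  admissible.
\<close>

lemma J'_violation:
  assumes z: "derivs z q k" and q: "\<And>x. x \<in> {-1..1} \<Longrightarrow> q x \<le> \<psi> x + \<delta>" and \<delta>: "\<delta> \<ge> 0"
  shows "J' (\<lambda>x. y x - z x) (\<lambda>x. g x - k x) \<le> \<mu> * \<delta>"
proof -
  define s where "s = m / (\<delta> + m)"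
  define t where "t = \<delta> / (\<delta> + m)"
  have st: "s > 0" "t \<ge> 0" "s + t = 1" "s * \<delta> = t * m"
    using m \<delta> by (auto simp: s_def t_def add_divide_distrib[symmetric] field_simps)
  have "0 \<le> J' (\<lambda>x. (s * z x + t * y\<^sub>0 x) - y x) (\<lambda>x. (s * k x + t * \<psi>' x) - g x)"
  proof (rule J'_nonneg[OF derivs_lincomb[OF z slater]])
    fix x :: real assume x: "x \<in> {-1..1}"
    have "s * q x + t * (\<psi> x - m) \<le> s * (\<psi> x + \<delta>) + t * (\<psi> x - m)"
      using st q[OF x] by simp
    also have "\<dots> = (s + t) * \<psi> x + (s * \<delta> - t * m)" by (simp add: algebra_simps)
    finally show "s * q x + t * (\<psi> x - m) \<le> \<psi> x" using st by simp
  qed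
  also have "\<dots> = s * J' z k + t * J' y\<^sub>0 \<psi>' - (s + t) * J' y g"
    using J'_diff[OF derivs_lincomb[OF z slater] d, of s t] J'_lincomb[OF z slater, of \<beta> s t] st
    by simp
  also have "\<dots> = s * (\<mu> * \<delta> - (J' y g - J' z k))"
    using J'_slater J'_diff[OF slater d] st(4) by (simp add: algebra_simps)
  finally have "0 \<le> s * (\<mu> * \<delta> - (J' y g - J' z k))" .
  then have "0 \<le> \<mu> * \<delta> - (J' y g - J' z k)" using st by (simp add: zero_le_mult_iff)
  then show ?thesis using J'_diff[OF d z] by simp
qed

text \<open>
  Let \<open>v\<close> be the element of \<open>V\<close> with second derivative \<open>w\<close>. Then \<open>\<beta>\<close> times the pairing of \<open>g + f\<close>
  with \<open>w\<close> is \<open>J' v w\<close> up to the term of order zero in \<open>v\<close>, and \<open>v\<close> and its first derivative are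
  bounded by the supremum of \<open>prim w\<close>. Hence \<open>g + f\<close> has bounded variation in the weak sense required by
  \<open>osc_weak_BV\<close>.
\<close>

lemma osc_state_eq:
  obtains M where "\<And>T. mesh T \<Longrightarrow> osc T (\<lambda>x. g x + f x) \<le> M * mesh_size T" "M \<ge> 0"
proof -
  define r where "r = (\<lambda>x. y x - y\<^sub>d x)"
  have r: "r \<in> L2" unfolding r_def by (intro L2_diff derivs_L2(5)[OF d] yd)
  have G: "(\<lambda>x. g x + f x) \<in> L2" by (intro L2_add derivs_L2(1)[OF d] f)
  define M where "M = (2 * \<mu> + 6 * sqrt (ip r r)) / \<beta>"
  have M: "M \<ge> 0" using \<mu>_nonneg \<beta> ip_nonneg[OF r] by (simp add: M_def)
  have BV: "integral {-1..1} (\<lambda>x. (g x + f x) * w x) \<le> M * \<eta>"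
    if w: "w \<in> L2" and sup: "\<And>x. x \<in> {-1..1} \<Longrightarrow> \<bar>prim w x\<bar> \<le> \<eta>" for w \<eta>
  proof -
    obtain v q where v: "derivs v q w" using derivs_of_second[OF w] by blast
    have \<eta>: "\<eta> \<ge> 0" using sup[of 0] by force
    have q: "\<bar>q x\<bar> \<le> 2 * \<eta>" if "x \<in> {-1..1}" for x using derivs_sup_p[OF v sup that] .
    have v4: "\<bar>v x\<bar> \<le> 4 * \<eta>" if "x \<in> {-1..1}" for x using derivs_sup_y[OF v q that] by simp
    have vL: "v \<in> L2" using derivs_L2[OF v] by blast
    have "- ip r v \<le> sqrt (ip r r) * sqrt (ip v v)" using ip_Cauchy_Schwarz[OF r vL] by linarith
    also have "\<dots> \<le> sqrt (ip r r) * (6 * \<eta>)"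
    proof (rule mult_left_mono)
      have "ip v v \<le> 2 * (4 * \<eta>)\<^sup>2" by (rule ip_le_sup[OF vL v4])
      also have "\<dots> \<le> (6 * \<eta>)\<^sup>2" by (simp add: power_mult_distrib)
      finally show "sqrt (ip v v) \<le> 6 * \<eta>" using \<eta> by (intro real_le_lsqrt) auto
    qed (use ip_nonneg[OF r] in simp)
    finally have 1: "- ip r v \<le> sqrt (ip r r) * (6 * \<eta>)" .
    have "\<beta> * ip (\<lambda>x. g x + f x) w = J' v w - ip r v"
      by (simp add: first_variation_def r_def)
    also have "\<dots> \<le> \<mu> * (2 * \<eta>) + sqrt (ip r r) * (6 * \<eta>)"
      using J'_le_sup[OF v q] 1 by simp
    also have "\<dots> = \<beta> * (M * \<eta>)" using \<beta> by (simp add: M_def field_simps)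
    finally show ?thesis using \<beta> by (simp add: ip_def)
  qed
  show thesis
    by (rule that[of "M\<^sup>2"]) (use osc_weak_BV[OF _ G M BV] in auto)
qed

text \<open>
  Let \<open>e = y\<^sub>h - y\<close> and let \<open>\<zeta> = z - y\<close> be the error of the Hermite interpolant \<open>z\<close>. The discrete variational
  inequality in the direction \<open>z - y\<^sub>h\<close> reads
  \<open>a(e, e) \<le> J' \<zeta> + J' (y - y\<^sub>h) + a(e, \<zeta>)\<close> with the bilinear form \<open>a\<close> of the cost. The first
  term is bounded by the supremum of \<open>\<zeta>'\<close>, the second by the violation \<open>\<delta>\<close> of the constraint by
  \<open>y\<^sub>h\<close>, and the third by Young's inequality. The violation depends on \<open>osc T (y\<^sub>h'' - \<psi>')\<close>, hence on
  the error itself, but with a factor \<open>h\<close>; a weighted Young inequality absorbs this part.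
\<close>

lemma discrete_error:
  assumes T: "mesh T" and dh: "derivs yh ph gh" and yh: "yh \<in> V\<^sub>h T"
    and nodes: "\<And>t. t \<in> T \<Longrightarrow> ph t \<le> \<psi> t"
    and opt: "\<And>z q k. derivs z q k \<Longrightarrow> z \<in> V\<^sub>h T \<Longrightarrow> (\<And>t. t \<in> T \<Longrightarrow> q t \<le> \<psi> t)
      \<Longrightarrow> cost y\<^sub>d \<beta> f yh \<le> cost y\<^sub>d \<beta> f z"
  shows "\<beta> / 4 * ip (\<lambda>x. gh x - g x) (\<lambda>x. gh x - g x)
    \<le> (13 * \<mu> + 2 * \<mu>\<^sup>2 / \<beta>) * mesh_size T + (\<mu> + 208 + 14 * \<beta>) * osc T g + \<beta> / 2 * osc T \<psi>'"
proof -
  define h where "h = mesh_size T"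
  have h: "h > 0" "h \<le> 2" using mesh_size_bounds[OF T] by (auto simp: h_def)
  note L = derivs_L2[OF d] and Lh = derivs_L2[OF dh]
  define a where "a = osc T g"
  define b where "b = osc T \<psi>'"
  have a: "a \<ge> 0" and b: "b \<ge> 0" unfolding a_def b_def using osc_nonneg[OF T] L \<psi>' by auto
  obtain z q s where z: "derivs z q s" "z \<in> V\<^sub>h T" "\<And>t. t \<in> T \<Longrightarrow> q t = p t"
    and q: "\<And>x. x \<in> {-1..1} \<Longrightarrow> \<bar>q x - p x\<bar> \<le> sqrt (26 * mesh_size T * osc T g)"
    and s: "integral {-1..1} (\<lambda>x. (s x - g x)\<^sup>2) \<le> 26 * osc T g"
    using Hermite_interpolant[OF T d] by blast
  note Lz = derivs_L2[OF z(1)]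
  have node_le: "p t \<le> \<psi> t" if "t \<in> T" for t
    using feasible[of t] that T by (auto simp: mesh_def)
  define e where "e = (\<lambda>x. yh x - y x)"
  define e2 where "e2 = (\<lambda>x. gh x - g x)"
  define \<zeta> where "\<zeta> = (\<lambda>x. z x - y x)"
  define \<zeta>2 where "\<zeta>2 = (\<lambda>x. s x - g x)"
  have inL2: "e \<in> L2" "e2 \<in> L2" "\<zeta> \<in> L2" "\<zeta>2 \<in> L2"
    using L Lh Lz by (auto simp: e_def e2_def \<zeta>_def \<zeta>2_def intro: L2_diff)
  define X where "X = ip e2 e2"
  have X: "X \<ge> 0" using inL2 by (simp add: X_def ip_nonneg)
  have VIh: "0 \<le> first_variation y\<^sub>d \<beta> f yh gh (\<lambda>x. z x - yh x) (\<lambda>x. s x - gh x)"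
  proof (rule variational_inequality[OF yd f \<beta> dh z(1)])
    fix t :: real assume t: "0 < t" "t \<le> 1"
    show "cost y\<^sub>d \<beta> f yh \<le> cost y\<^sub>d \<beta> f (\<lambda>x. (1 - t) * yh x + t * z x)"
    proof (rule opt[OF derivs_lincomb[OF dh z(1)] V\<^sub>h_lincomb[OF yh z(2)]])
      fix x assume x: "x \<in> T"
      have "(1 - t) * ph x + t * q x \<le> (1 - t) * \<psi> x + t * \<psi> x"
        using t nodes[OF x] node_le[OF x] z(3)[OF x] by (intro add_mono mult_left_mono) auto
      then show "(1 - t) * ph x + t * q x \<le> \<psi> x" by (simp add: algebra_simps)
    qed
  qed
  have split: "first_variation y\<^sub>d \<beta> f yh gh (\<lambda>x. z x - yh x) (\<lambda>x. s x - gh x)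
      = J' \<zeta> \<zeta>2 + J' (\<lambda>x. y x - yh x) (\<lambda>x. g x - gh x) + (ip e \<zeta> - ip e e) + \<beta> * (ip e2 \<zeta>2 - ip e2 e2)"
  proof -
    have r: "(\<lambda>x. y x - y\<^sub>d x) \<in> L2" and G: "(\<lambda>x. g x + f x) \<in> L2"
      using L yd f by (auto intro: L2_diff L2_add)
    have *: "ip (\<lambda>x. u x + v x) (\<lambda>x. w x - v x) = ip u w + ip u (\<lambda>x. - v x) + (ip v w - ip v v)"
      if "u \<in> L2" "v \<in> L2" "w \<in> L2" for u v w
    proof -
      have uv: "(\<lambda>x. u x + v x) \<in> L2" using that by (intro L2_add)
      have "ip (\<lambda>x. u x + v x) (\<lambda>x. w x - v x) = ip (\<lambda>x. u x + v x) w - ip (\<lambda>x. u x + v x) v"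
        using ip_lincomb[OF uv that(3,2), of 1 "-1"] by simp
      also have "ip (\<lambda>x. u x + v x) w = ip u w + ip v w"
        using ip_lincomb[OF that(3,1,2), of 1 1] by (simp add: ip_commute)
      also have "ip (\<lambda>x. u x + v x) v = ip u v + ip v v"
        using ip_lincomb[OF that(2,1,2), of 1 1] by (simp add: ip_commute)
      also have "ip u v = - ip u (\<lambda>x. - v x)"
        using ip_lincomb[OF that(1,2,2), of "-1" 0] by simp
      finally show ?thesis by simp
    qed
    have eqs: "(\<lambda>x. yh x - y\<^sub>d x) = (\<lambda>x. (y x - y\<^sub>d x) + e x)" "(\<lambda>x. z x - yh x) = (\<lambda>x. \<zeta> x - e x)"
      "(\<lambda>x. gh x + f x) = (\<lambda>x. (g x + f x) + e2 x)" "(\<lambda>x. s x - gh x) = (\<lambda>x. \<zeta>2 x - e2 x)"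
      "(\<lambda>x. y x - yh x) = (\<lambda>x. - e x)" "(\<lambda>x. g x - gh x) = (\<lambda>x. - e2 x)"
      by (auto simp: e_def e2_def \<zeta>_def \<zeta>2_def)
    show ?thesis
      unfolding first_variation_def eqs *[OF r inL2(1,3)] *[OF G inL2(2,4)]
      by (simp add: distrib_left)
  qed
  have d\<zeta>: "derivs \<zeta> (\<lambda>x. q x - p x) \<zeta>2"
    unfolding \<zeta>_def \<zeta>2_def by (rule derivs_diff[OF z(1) d])
  define \<eta> where "\<eta> = sqrt (26 * h * a)"
  have \<eta>: "\<eta> \<ge> 0" "\<eta>\<^sup>2 = 26 * h * a" using h a by (auto simp: \<eta>_def)
  have sup\<zeta>: "\<bar>q x - p x\<bar> \<le> \<eta>" if "x \<in> {-1..1}" for x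
    using q[OF that] by (simp add: \<eta>_def h_def a_def)
  have "2 * \<eta> \<le> 26 * h + a"
    using sum_squares_bound[of "sqrt (26 * h)" "sqrt a"] h a
    by (simp add: \<eta>_def real_sqrt_mult power_mult_distrib mult.assoc)
  then have t1: "J' \<zeta> \<zeta>2 \<le> \<mu> * (13 * h + a)"
    using J'_le_sup[OF d\<zeta> sup\<zeta>] mult_left_mono[of \<eta> "13 * h + a" \<mu>] \<mu>_nonneg a by auto
  define \<delta> where "\<delta> = sqrt (h * osc T (\<lambda>x. gh x - \<psi>' x))"
  have \<delta>0: "\<delta> \<ge> 0" unfolding \<delta>_def
    using h osc_nonneg[OF T L2_diff[OF Lh(1) \<psi>']] by simp
  have viol: "ph x \<le> \<psi> x + \<delta>" if x: "x \<in> {-1..1}" for x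
  proof -
    have "ph x - \<psi> x \<le> sqrt (mesh_size T * osc T (\<lambda>x. gh x - \<psi>' x))"
    proof (rule le_if_le_at_nodes[OF T L2_diff[OF Lh(1) \<psi>'], of "\<lambda>x. ph x - \<psi> x" "ph (-1) - \<psi> (-1)"])
      fix x :: real assume "x \<in> {-1..1}"
      then show "ph x - \<psi> x = ph (-1) - \<psi> (-1) + prim (\<lambda>x. gh x - \<psi>' x) x"
        using derivsD(2)[OF dh, of x] \<psi>[of x] by (simp add: prim_sub L2_L1 Lh \<psi>')
    qed (use nodes x in auto)
    then show ?thesis by (simp add: \<delta>_def h_def)
  qed
  have oscd: "osc T (\<lambda>x. gh x - \<psi>' x) \<le> 2 * X + 4 * a + 4 * b"
  proof -
    have n: "(\<lambda>x. (-1) * \<psi>' x) \<in> L2" by (intro L2_scale \<psi>')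
    have "(\<lambda>x. gh x - \<psi>' x) = (\<lambda>x. e2 x + (g x + (-1) * \<psi>' x))" by (simp add: e2_def)
    then have "osc T (\<lambda>x. gh x - \<psi>' x) \<le> 2 * osc T e2 + 2 * osc T (\<lambda>x. g x + (-1) * \<psi>' x)"
      using osc_add[OF T inL2(2) L2_add[OF L(1) n]] by simp
    also have "osc T e2 \<le> X" using osc_le_norm[OF T inL2(2)] by (simp add: X_def ip_self)
    also have "osc T (\<lambda>x. g x + (-1) * \<psi>' x) \<le> 2 * a + 2 * b"
      using osc_add[OF T L(1) n] osc_scale[OF T, of "-1" \<psi>'] by (simp add: a_def b_def)
    finally show ?thesis by simp
  qed
  have "\<mu> * \<delta> \<le> 2 * \<mu>\<^sup>2 / \<beta> * h + \<beta> / 8 * (2 * X + 4 * a + 4 * b)"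
  proof -
    have "\<delta>\<^sup>2 \<le> h * (2 * X + 4 * a + 4 * b)"
      using oscd h osc_nonneg[OF T L2_diff[OF Lh(1) \<psi>']] by (simp add: \<delta>_def)
    define Z where "Z = 2 * X + 4 * a + 4 * b"
    have Z: "Z \<ge> 0" using X a b by (simp add: Z_def)
    have "\<delta> \<le> sqrt (h * Z)" using \<open>\<delta>\<^sup>2 \<le> _\<close> by (intro real_le_rsqrt) (simp add: Z_def)
    then have "\<mu> * \<delta> \<le> \<mu> * sqrt (h * Z)" using \<mu>_nonneg by (rule mult_left_mono)
    also have "\<dots> = 2 * (\<mu> * sqrt (2 * h / \<beta>)) * sqrt (\<beta> / 8 * Z)"
    proof -
      \<comment> \<open>The weights make the coefficient of \<open>X\<close> equal to \<open>\<beta> / 4\<close>, half of the \<open>\<beta> / 2\<close> that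
        is left of \<open>a(e, e)\<close> after the bound for \<open>a(e, \<zeta>)\<close>.\<close>
      have "sqrt (2 * h / \<beta>) * sqrt (\<beta> / 8 * Z) = sqrt (h * Z / 4)"
        using \<beta> by (simp flip: real_sqrt_mult)
      also have "\<dots> = sqrt (h * Z) / 2" by (simp add: real_sqrt_divide)
      finally show ?thesis by simp
    qed
    also have "\<dots> \<le> (\<mu> * sqrt (2 * h / \<beta>))\<^sup>2 + (sqrt (\<beta> / 8 * Z))\<^sup>2"
      by (rule sum_squares_bound)
    also have "\<dots> = 2 * \<mu>\<^sup>2 / \<beta> * h + \<beta> / 8 * Z"
      using h Z \<beta> by (simp add: power_mult_distrib)
    finally show ?thesis by (simp add: Z_def)
  qed
  then have t2: "J' (\<lambda>x. y x - yh x) (\<lambda>x. g x - gh x)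
      \<le> 2 * \<mu>\<^sup>2 / \<beta> * h + \<beta> / 8 * (2 * X + 4 * a + 4 * b)"
    using J'_violation[OF dh viol \<delta>0] by simp
  have "ip \<zeta> \<zeta> \<le> 2 * (2 * \<eta>)\<^sup>2"
    by (rule ip_le_sup[OF inL2(3) derivs_sup_y[OF d\<zeta> sup\<zeta>]])
  also have "\<dots> = 208 * a * h" using \<eta> by (simp add: power_mult_distrib)
  also have "\<dots> \<le> 208 * a * 2" using h a by (intro mult_left_mono) auto
  finally have z1: "ip \<zeta> \<zeta> \<le> 416 * a" by simp
  have z2: "ip \<zeta>2 \<zeta>2 \<le> 26 * a" using s by (simp add: ip_self \<zeta>2_def a_def)
  have y1: "2 * ip e \<zeta> \<le> ip e e + ip \<zeta> \<zeta>" and y2: "2 * ip e2 \<zeta>2 \<le> X + ip \<zeta>2 \<zeta>2"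
    using ip_Young inL2 by (auto simp: X_def)
  have ee: "ip e e \<ge> 0" using inL2 by (simp add: ip_nonneg)
  have "\<beta> * (2 * (ip e2 \<zeta>2 - X)) \<le> \<beta> * (26 * a - X)"
    using y2 z2 \<beta> by (intro mult_left_mono) auto
  then have y3: "\<beta> * (ip e2 \<zeta>2 - X) \<le> 13 * (\<beta> * a) - \<beta> * X / 2" by (simp add: algebra_simps)
  have "0 \<le> \<mu> * (13 * h + a) + (2 * \<mu>\<^sup>2 / \<beta> * h + \<beta> / 8 * (2 * X + 4 * a + 4 * b))
      + 208 * a + (13 * (\<beta> * a) - \<beta> * X / 2)"
    using VIh y1 z1 ee t1 t2 y3 unfolding split X_def[symmetric] by linarith
  then have "\<beta> / 4 * X \<le> (13 * \<mu> + 2 * \<mu>\<^sup>2 / \<beta>) * h + (\<mu> + 208 + 14 * \<beta>) * a + \<beta> / 2 * b - \<beta> * a / 2"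
    by (simp add: algebra_simps)
  moreover have "\<beta> * a / 2 \<ge> 0" using a \<beta> by simp
  ultimately show ?thesis
    unfolding X_def e2_def h_def a_def b_def by linarith
qed

end

lemma osc_sobolev:
  assumes f: "f \<in> L2" and ae: "AE x in lebesgue_on I. f' x = f x"
    and sl: "slobodeckij_finite \<sigma> f'" and \<sigma>: "\<sigma> > 0"
  obtains A where "A \<ge> 0" "\<And>T. mesh T \<Longrightarrow> osc T f \<le> A * mesh_size T powr (2 * \<sigma>)"
proof -
  have "AE x in lebesgue_on I. f x = f' x" using ae by eventually_elim simp
  then have "f' \<in> L2" using L2_cong_AE[OF f] by blast
  then obtain A where "A \<ge> 0" "\<And>T. mesh T \<Longrightarrow> osc T f' \<le> A * mesh_size T powr (2 * \<sigma>)"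
    using osc_slobodeckij[OF _ sl \<sigma>] by blast
  with that osc_cong_AE[OF _ ae] show thesis by auto
qed

text \<open>
  For \<open>0 < \<sigma> < 1\<close> the integer and fractional parts of \<open>n + \<sigma>\<close> are \<open>n\<close> and \<open>\<sigma>\<close>.
\<close>

lemma sobolev_fractional:
  assumes "v \<in> sobolev (real n + \<sigma>)" and \<sigma>: "0 < \<sigma>" "\<sigma> < 1"
  shows "v \<in> L2" "\<exists>g\<in>L2. has_weak_deriv n v g" "slobodeckij_finite \<sigma> (weak_deriv n v)"
proof -
  have n: "nat \<lfloor>real n + \<sigma>\<rfloor> = n" using \<sigma> by (simp add: floor_eq_iff nat_eq_iff)
  have fr: "frac (real n + \<sigma>) = \<sigma>" using \<sigma> by (simp add: frac_unique_iff)
  then have "real n + \<sigma> \<notin> \<int>" using \<sigma> frac_eq_0_iff[of "real n + \<sigma>"] by simp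
  then show "v \<in> L2" "\<exists>g\<in>L2. has_weak_deriv n v g" "slobodeckij_finite \<sigma> (weak_deriv n v)"
    using assms(1) unfolding sobolev_def n fr by auto
qed

theorem theorem3p1:
  fixes y\<^sub>d f \<psi> ybar :: "real \<Rightarrow> real"
    and \<beta> :: real
    and \<T> :: "real set set"
    and ybar\<^sub>h :: "real set \<Rightarrow> real \<Rightarrow> real"
  assumes "y\<^sub>d \<in> L2"
    and "\<beta> > 0"
    and "\<forall>\<epsilon>\<in>{0<..<1/2}. f \<in> sobolev (1/2 - \<epsilon>)"
    and "\<forall>\<epsilon>\<in>{0<..<1/2}. \<psi> \<in> sobolev (3/2 - \<epsilon>)"
    and "continuous_on {-1..1} \<psi>"
    and "integral\<^sup>L (lebesgue_on I) \<psi> > 0"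
    and "is_arg_min (cost y\<^sub>d \<beta> f) (\<lambda>y. y \<in> K \<psi>) ybar"
    and "\<forall>T\<in>\<T>. mesh T"
    and "quasi_uniform \<T>"
    and "\<forall>T\<in>\<T>. is_arg_min (cost y\<^sub>d \<beta> f) (\<lambda>y. y \<in> K\<^sub>h \<psi> T) (ybar\<^sub>h T)"
  shows "\<forall>\<epsilon>>0. \<exists>C>0. \<forall>T\<in>\<T>.
    H1_seminorm (\<lambda>x. ybar x - ybar\<^sub>h T x)
      + L2_norm (\<lambda>x. control f ybar x - control f (ybar\<^sub>h T) x)
    \<le> C * mesh_size T powr (1/2 - \<epsilon>)"
proof (intro allI impI)
  fix \<epsilon> :: real assume "\<epsilon> > 0"
  \<comment> \<open>For large \<open>\<epsilon>\<close> the order \<open>1/2 - \<epsilon>'\<close> with a small \<open>\<epsilon>'\<close> is better than the one claimed, as \<open>h \<le> 2\<close>.\<close>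
  define \<epsilon>' where "\<epsilon>' = min \<epsilon> (1 / 4)"
  have \<epsilon>': "0 < \<epsilon>'" "\<epsilon>' < 1 / 2" "\<epsilon>' \<le> \<epsilon>" using \<open>\<epsilon> > 0\<close> by (auto simp: \<epsilon>'_def)
  define \<sigma> where "\<sigma> = 1 / 2 - \<epsilon>'"
  have \<sigma>: "0 < \<sigma>" "\<sigma> < 1 / 2" "\<sigma> < 1" using \<epsilon>' by (auto simp: \<sigma>_def)
  have "f \<in> sobolev (real 0 + \<sigma>)" using assms(3) \<epsilon>' by (auto simp: \<sigma>_def)
  note f = sobolev_fractional[OF this \<sigma>(1,3)]
  have "has_weak_deriv 0 f f"
    using L1_locally_integrable[OF L2_L1[OF f(1)]] by (simp add: has_weak_deriv_def)
  from osc_sobolev[OF f(1) weak_deriv_eq[OF this] f(3) \<sigma>(1)] obtain A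
    where A: "A \<ge> 0" "\<And>T. mesh T \<Longrightarrow> osc T f \<le> A * mesh_size T powr (2 * \<sigma>)" by blast
  have "3 / 2 - \<epsilon>' = real 1 + \<sigma>" by (simp add: \<sigma>_def)
  moreover have "\<psi> \<in> sobolev (3 / 2 - \<epsilon>')" using assms(4) \<epsilon>' by simp
  ultimately have "\<psi> \<in> sobolev (real 1 + \<sigma>)" by metis
  note \<psi> = sobolev_fractional[OF this \<sigma>(1,3)]
  obtain \<psi>' where \<psi>': "\<psi>' \<in> L2" "has_weak_deriv 1 \<psi> \<psi>'" using \<psi>(2) by blast
  from osc_sobolev[OF \<psi>'(1) weak_deriv_eq[OF \<psi>'(2)] \<psi>(3) \<sigma>(1)] obtain B
    where B: "B \<ge> 0" "\<And>T. mesh T \<Longrightarrow> osc T \<psi>' \<le> B * mesh_size T powr (2 * \<sigma>)" by blast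
  have min: "ybar \<in> K \<psi>" "\<And>z. z \<in> K \<psi> \<Longrightarrow> cost y\<^sub>d \<beta> f ybar \<le> cost y\<^sub>d \<beta> f z"
    using assms(7) by (auto simp: is_arg_min_def not_less)
  then have "ybar \<in> V" by (simp add: K_def)
  then obtain p g where d: "derivs ybar p g" unfolding V_iff by blast
  define m where "m = prim \<psi> 1 / 2"
  interpret continuous_solution y\<^sub>d f \<psi> \<psi>' ybar p g \<beta> m
  proof
    show "y\<^sub>d \<in> L2" "f \<in> L2" "\<psi>' \<in> L2" "\<beta> > 0" "derivs ybar p g" "prim \<psi> 1 = 2 * m"
      using assms(1,2) f \<psi>' d by (auto simp: m_def)
    show "m > 0" using assms(6) by (simp add: m_def prim_def integral_I[OF L2_L1[OF \<psi>(1)]])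
    show "\<psi> x = \<psi> (-1) + prim \<psi>' x" if "x \<in> {-1..1}" for x
      by (rule weak_deriv_continuous_primitive[OF assms(5) L2_L1[OF \<psi>'(1)] \<psi>'(2) that])
    show "p x \<le> \<psi> x" if "x \<in> {-1..1}" for x
      using min(1) that unfolding K_iff[OF d assms(5)] by blast
    show "cost y\<^sub>d \<beta> f ybar \<le> cost y\<^sub>d \<beta> f z"
      if "derivs z q k" "\<And>x. x \<in> {-1..1} \<Longrightarrow> q x \<le> \<psi> x" for z q k
      using min(2) K_iff[OF that(1) assms(5)] that(2) by blast
  qed
  obtain M where M: "\<And>T. mesh T \<Longrightarrow> osc T (\<lambda>x. g x + f x) \<le> M * mesh_size T" "M \<ge> 0"
    using osc_state_eq by blast
  define D where "D = 4 / \<beta> * ((13 * \<mu> + 2 * \<mu>\<^sup>2 / \<beta>) * 2 + (\<mu> + 208 + 14 * \<beta>) * (4 * M + 2 * A) + \<beta> / 2 * B)"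
  have D: "D \<ge> 0" using A B M \<mu>_nonneg assms(2) by (simp add: D_def)
  have error: "H1_seminorm (\<lambda>x. ybar x - ybar\<^sub>h T x)
      + L2_norm (\<lambda>x. control f ybar x - control f (ybar\<^sub>h T) x)
    \<le> 5 * sqrt D * mesh_size T powr \<sigma>" if "T \<in> \<T>" for T
  proof -
    have T: "mesh T" using assms(8) that by blast
    define h where "h = mesh_size T"
    define H where "H = h powr (2 * \<sigma>)"
    have h: "0 < h" "h \<le> 2" using mesh_size_bounds[OF T] by (auto simp: h_def)
    \<comment> \<open>The order \<open>h\<close> is better than \<open>h powr (2 \<sigma>)\<close>, as \<open>h \<le> 2\<close> and \<open>2 \<sigma> < 1\<close>.\<close>
    have "h powr (1 - 2 * \<sigma>) \<le> 2 powr (1 - 2 * \<sigma>)" using h \<sigma> by (intro powr_mono2) auto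
    also have "\<dots> \<le> 2 powr 1" using \<sigma> by (intro powr_mono) auto
    finally have "h powr (2 * \<sigma>) * h powr (1 - 2 * \<sigma>) \<le> h powr (2 * \<sigma>) * 2"
      by (intro mult_left_mono) auto
    then have hH: "h \<le> 2 * H" using h by (simp add: H_def flip: powr_add)
    have minh: "ybar\<^sub>h T \<in> K\<^sub>h \<psi> T"
      "\<And>z. z \<in> K\<^sub>h \<psi> T \<Longrightarrow> cost y\<^sub>d \<beta> f (ybar\<^sub>h T) \<le> cost y\<^sub>d \<beta> f z"
      using assms(10) that by (auto simp: is_arg_min_def not_less)
    then have "ybar\<^sub>h T \<in> V" by (simp add: K\<^sub>h_def V\<^sub>h_def)
    then obtain ph gh where dh: "derivs (ybar\<^sub>h T) ph gh" unfolding V_iff by blast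
    note Kh = K\<^sub>h_iff[OF T]
    define X where "X = ip (\<lambda>x. gh x - g x) (\<lambda>x. gh x - g x)"
    have "\<beta> / 4 * X \<le> (13 * \<mu> + 2 * \<mu>\<^sup>2 / \<beta>) * h + (\<mu> + 208 + 14 * \<beta>) * osc T g + \<beta> / 2 * osc T \<psi>'"
      unfolding X_def h_def
    proof (rule discrete_error[OF T dh])
      show "ybar\<^sub>h T \<in> V\<^sub>h T" "\<And>t. t \<in> T \<Longrightarrow> ph t \<le> \<psi> t" using minh(1) Kh[OF dh] by blast+
      show "cost y\<^sub>d \<beta> f (ybar\<^sub>h T) \<le> cost y\<^sub>d \<beta> f z"
        if "derivs z q k" "z \<in> V\<^sub>h T" "\<And>t. t \<in> T \<Longrightarrow> q t \<le> \<psi> t" for z q k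
        using minh(2) Kh[OF that(1)] that(2,3) by blast
    qed
    also have "\<dots> \<le> (13 * \<mu> + 2 * \<mu>\<^sup>2 / \<beta>) * (2 * H) + (\<mu> + 208 + 14 * \<beta>) * ((4 * M + 2 * A) * H)
        + \<beta> / 2 * (B * H)"
    proof (intro add_mono mult_left_mono)
      have n: "(\<lambda>x. (-1) * f x) \<in> L2" by (intro L2_scale f(1))
      have "osc T (\<lambda>x. (g x + f x) + (-1) * f x) \<le> 2 * osc T (\<lambda>x. g x + f x) + 2 * osc T (\<lambda>x. (-1) * f x)"
        by (rule osc_add[OF T L2_add[OF derivs_L2(1)[OF d] f(1)] n])
      also have "osc T (\<lambda>x. (-1) * f x) = osc T f" using osc_scale[OF T, of "-1" f] by simp
      finally have "osc T g \<le> 2 * osc T (\<lambda>x. g x + f x) + 2 * osc T f" by simp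
      also have "osc T (\<lambda>x. g x + f x) \<le> M * (2 * H)"
        using M(1)[OF T] mult_left_mono[OF hH M(2)] by (simp add: h_def)
      also have "osc T f \<le> A * H" using A(2)[OF T] by (simp add: H_def h_def)
      finally show "osc T g \<le> (4 * M + 2 * A) * H" by (simp add: algebra_simps)
      show "osc T \<psi>' \<le> B * H" using B(2)[OF T] by (simp add: H_def h_def)
    qed (use hH \<mu>_nonneg assms(2) in auto)
    also have "\<dots> = \<beta> / 4 * (D * H)"
      using assms(2) by (simp add: D_def field_simps)
    finally have "X \<le> D * H" using assms(2) by simp
    moreover have "H = (h powr \<sigma>)\<^sup>2" by (simp add: H_def power2_eq_square flip: powr_add)
    ultimately have sX: "sqrt X \<le> sqrt D * h powr \<sigma>"
      using D real_sqrt_le_mono[of X "D * (h powr \<sigma>)\<^sup>2"] by (simp add: real_sqrt_mult)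
    define q where "q = (\<lambda>x. p x - ph x)"
    define w where "w = (\<lambda>x. g x - gh x)"
    have dw: "derivs (\<lambda>x. ybar x - ybar\<^sub>h T x) q w"
      unfolding q_def w_def by (rule derivs_diff[OF d dh])
    note Lw = derivs_L2[OF dw]
    have Xw: "X = ip w w" by (simp add: X_def w_def ip_self power2_commute)
    have X: "X \<ge> 0" unfolding Xw by (rule ip_nonneg[OF Lw(1)])
    have "\<bar>prim w x\<bar> \<le> sqrt (2 * X)" if x: "x \<in> {-1..1}" for x
    proof -
      have "\<bar>prim w x\<bar> \<le> sqrt ((x - (-1)) * integral {-1..x} (\<lambda>x. (w x)\<^sup>2))"
        unfolding prim_def using x by (intro abs_integral_le_L2 Lw) auto
      also have "\<dots> \<le> sqrt (2 * X)"
      proof (intro real_sqrt_le_mono mult_mono)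
        show "integral {-1..x} (\<lambda>x. (w x)\<^sup>2) \<le> X"
          unfolding Xw ip_self
          by (rule integral_subset_le) (use L2_square[OF Lw(1)] x in \<open>auto intro!: L1_integrable\<close>)
        show "0 \<le> integral {-1..x} (\<lambda>x. (w x)\<^sup>2)"
          using L2_square[OF Lw(1)] x by (intro integral_nonneg L1_integrable) auto
      qed (use x in auto)
      finally show ?thesis .
    qed
    \<comment> \<open>The first derivative of the error has mean zero and is therefore dominated by the second.\<close>
    from ip_le_sup[OF Lw(3) derivs_sup_p[OF dw this]]
    have "ip q q \<le> 16 * X" using X by (simp add: power_mult_distrib)
    then have "sqrt (ip q q) \<le> 4 * sqrt X"
      using real_sqrt_le_mono[of "ip q q" "16 * X"] by (simp add: real_sqrt_mult)
    moreover have "H1_seminorm (\<lambda>x. ybar x - ybar\<^sub>h T x) = sqrt (ip q q)"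
    proof -
      have "AE x in lebesgue_on I. q x = weak_deriv 1 (\<lambda>x. ybar x - ybar\<^sub>h T x) x"
        using derivs_weak_deriv(1)[OF dw] by eventually_elim simp
      from L2_norm_cong_AE[OF Lw(3) this] show ?thesis
        by (simp add: H1_seminorm_def L2_norm_eq[OF Lw(3)] ip_self)
    qed
    moreover have "L2_norm (\<lambda>x. control f ybar x - control f (ybar\<^sub>h T) x) = sqrt X"
    proof -
      have L: "(\<lambda>x. gh x - g x) \<in> L2" by (intro L2_diff derivs_L2(1)[OF d] derivs_L2(1)[OF dh])
      have "AE x in lebesgue_on I. gh x - g x = control f ybar x - control f (ybar\<^sub>h T) x"
        using derivs_weak_deriv(2)[OF d] derivs_weak_deriv(2)[OF dh]
        by eventually_elim (simp add: control_def)
      from L2_norm_cong_AE[OF L this] show ?thesis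
        by (simp add: L2_norm_eq[OF L] X_def ip_self)
    qed
    ultimately show ?thesis using sX by (simp add: h_def)
  qed
  define C where "C = 5 * sqrt D * 2 powr (\<epsilon> - \<epsilon>') + 1"
  have C: "C > 0" using D by (simp add: C_def add_nonneg_pos)
  have "5 * sqrt D * mesh_size T powr \<sigma> \<le> C * mesh_size T powr (1 / 2 - \<epsilon>)" if "T \<in> \<T>" for T
  proof -
    have h: "0 < mesh_size T" "mesh_size T \<le> 2" using mesh_size_bounds assms(8) that by blast+
    have "mesh_size T powr \<sigma> = mesh_size T powr (\<epsilon> - \<epsilon>') * mesh_size T powr (1 / 2 - \<epsilon>)"
      by (simp add: \<sigma>_def flip: powr_add)
    also have "\<dots> \<le> 2 powr (\<epsilon> - \<epsilon>') * mesh_size T powr (1 / 2 - \<epsilon>)"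
      using h \<epsilon>' by (intro mult_right_mono powr_mono2) auto
    finally have "5 * sqrt D * mesh_size T powr \<sigma>
        \<le> 5 * sqrt D * (2 powr (\<epsilon> - \<epsilon>') * mesh_size T powr (1 / 2 - \<epsilon>))"
      using D by (intro mult_left_mono) auto
    also have "\<dots> \<le> C * mesh_size T powr (1 / 2 - \<epsilon>)" by (simp add: C_def algebra_simps)
    finally show ?thesis .
  qed
  with error C show "\<exists>C>0. \<forall>T\<in>\<T>.
    H1_seminorm (\<lambda>x. ybar x - ybar\<^sub>h T x)
      + L2_norm (\<lambda>x. control f ybar x - control f (ybar\<^sub>h T) x)
    \<le> C * mesh_size T powr (1/2 - \<epsilon>)"
    by (intro exI[of _ C]) (blast intro: order_trans)
qed

end
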